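(* Let $G$ be a profinite group such that the space $\mathcal{S}(G)$ of closed subgroups of $G$ is countably infinite. Let $k$ equal the number of primes $p$ such that $p^{\infty}\mid o(G)$. Then there exists a positive integer $n$ such that $\mathcal{S}(G)$ is homeomorphic to $\omega^k n+1$.
   Context: For a profinite group $G$, $\mathcal{S}(G)$ is the set of closed subgroups of $G$ with the profinite topology obtained from $\mathcal{S}(G)=\varprojlim\mathcal{S}(G_\lambda)$, where $G=\varprojlim G_\lambda$ with $G_\lambda$ finite and each finite set $\mathcal{S}(G_\lambda)$ is discrete; equivalently, the sets $B(H,N)=\{K \text{ a closed subgroup of } G\mid KN=HN\}$, with $N$ ranging over the open normal subgroups of $G$, form a base of open neighbourhoods of $H\in\mathcal{S}(G)$. $o(G)$ is the order of $G$ as a supernatural number (the least common multiple of the orders $|G:N|$ for $N$ open normal in $G$); $p^\infty\mid o(G)$ means that every power of $p$ divides $o(G)$, i.e. the Sylow pro-$p$ subgroups of $G$ are infinite. $\omega^k n+1$ is the ordinal (ordinal arithmetic) with its order topology. *)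

theory Defs
  imports
    "HOL-Analysis.Analysis"
    "HOL-Algebra.Coset"
    "HOL-Computational_Algebra.Primes"
    "HOL-Library.Extended_Nat"
begin

section \<open>Profinite groups\<close>

locale topological_group = group G for G (structure) +
  fixes T :: "'a topology"
  assumes topspace_eq: "topspace T = carrier G"
    and continuous_mult: "continuous_map (prod_topology T T) T (\<lambda>(x, y). x \<otimes> y)"
    and continuous_inv: "continuous_map T T (\<lambda>x. inv x)"

text \<open>A profinite group, i.e. an inverse limit of finite discrete groups, is taken to be a compact
  Hausdorff totally disconnected topological group.\<close>

locale profinite_group = topological_group +
  assumes compact: "compact_space T"
    and Hausdorff: "Hausdorff_space T"
    and totally_disconnected: "\<And>x. x \<in> topspace T \<Longrightarrow> connected_component_of_set T x = {x}"

definition open_normal_subgroups :: "('a, 'b) monoid_scheme \<Rightarrow> 'a topology \<Rightarrow> 'a set set" where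
  "open_normal_subgroups G T = {N. N \<lhd> G \<and> openin T N}"

section \<open>The space of closed subgroups\<close>

definition closed_subgroups :: "('a, 'b) monoid_scheme \<Rightarrow> 'a topology \<Rightarrow> 'a set set" where
  "closed_subgroups G T = {H. subgroup H G \<and> closedin T H}"

definition subgroup_nbhd ::
    "('a, 'b) monoid_scheme \<Rightarrow> 'a topology \<Rightarrow> 'a set \<Rightarrow> 'a set \<Rightarrow> 'a set set" where
  "subgroup_nbhd G T H N = {K \<in> closed_subgroups G T. K <#>\<^bsub>G\<^esub> N = H <#>\<^bsub>G\<^esub> N}"

text \<open>The sets \<open>subgroup_nbhd G T H N\<close> are the fibres of the maps from closed subgroups of \<open>G\<close> to
  subgroups of \<open>G/N\<close>, so the topology they generate is that of the inverse limit of the finite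
  discrete spaces of subgroups of the quotients \<open>G/N\<close>.\<close>

definition subgroup_space :: "('a, 'b) monoid_scheme \<Rightarrow> 'a topology \<Rightarrow> 'a set topology" where
  "subgroup_space G T = topology_generated_by
     {subgroup_nbhd G T H N | H N. H \<in> closed_subgroups G T \<and> N \<in> open_normal_subgroups G T}"

lemma (in topological_group) carrier_open_normal: "carrier G \<in> open_normal_subgroups G T"
proof -
  have "carrier G \<lhd> G"
    by (rule normal_invI) (auto simp: subgroup_self)
  then show ?thesis
    unfolding open_normal_subgroups_def using openin_topspace[of T] topspace_eq by auto
qed

lemma (in topological_group) topspace_subgroup_space:
  "topspace (subgroup_space G T) = closed_subgroups G T"
  unfolding subgroup_space_def topology_generated_by_topspace subgroup_nbhd_def
  using carrier_open_normal by blast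

lemma (in topological_group) subgroup_nbhd_mono:
  assumes "subgroup H G" "M \<in> open_normal_subgroups G T" "N \<in> open_normal_subgroups G T" "M \<subseteq> N"
  shows "subgroup_nbhd G T H M \<subseteq> subgroup_nbhd G T H N"
proof
  fix K assume K: "K \<in> subgroup_nbhd G T H M"
  have sub: "subgroup M G" "subgroup N G"
    using assms unfolding open_normal_subgroups_def by (auto simp: normal_imp_subgroup)
  have MN: "M <#> N = N"
  proof
    show "M <#> N \<subseteq> N"
      unfolding set_mult_def using \<open>M \<subseteq> N\<close> subgroup.m_closed[OF sub(2)] by blast
    show "N \<subseteq> M <#> N"
      unfolding set_mult_def using subgroup.one_closed[OF sub(1)] subgroup.mem_carrier[OF sub(2)]
      by (force intro: l_one[symmetric])
  qed
  have absorb: "L <#> N = (L <#> M) <#> N" if "subgroup L G" for L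
    using set_mult_assoc[of L M N] MN subgroup.subset that sub by metis
  have "subgroup K G" "K <#> M = H <#> M" "K \<in> closed_subgroups G T"
    using K unfolding subgroup_nbhd_def closed_subgroups_def by auto
  then show "K \<in> subgroup_nbhd G T H N"
    using absorb[of K] absorb[of H] assms(1) unfolding subgroup_nbhd_def by auto
qed

text \<open>The generating sets containing \<open>H\<close> form a base of neighbourhoods of \<open>H\<close>.\<close>

lemma (in topological_group) openin_subgroup_space_iff:
  "openin (subgroup_space G T) U \<longleftrightarrow>
     U \<subseteq> closed_subgroups G T \<and>
     (\<forall>H\<in>U. \<exists>N\<in>open_normal_subgroups G T. subgroup_nbhd G T H N \<subseteq> U)"
  (is "_ \<longleftrightarrow> ?R U")
proof
  let ?B = "{subgroup_nbhd G T H N | H N. H \<in> closed_subgroups G T \<and> N \<in> open_normal_subgroups G T}"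
  have sub: "subgroup H G" if "H \<in> closed_subgroups G T" for H
    using that unfolding closed_subgroups_def by auto
  show "?R U" if "openin (subgroup_space G T) U"
  proof -
    have "generate_topology_on ?B U"
      using that unfolding subgroup_space_def openin_topology_generated_by_iff .
    then show ?thesis
    proof induction
      case Empty
      then show ?case by simp
    next
      case (Int A B)
      show ?case
      proof (intro conjI ballI)
        fix H assume H: "H \<in> A \<inter> B"
        then obtain M N where MN: "M \<in> open_normal_subgroups G T" "N \<in> open_normal_subgroups G T"
          "subgroup_nbhd G T H M \<subseteq> A" "subgroup_nbhd G T H N \<subseteq> B"
          using Int.IH by blast
        have I: "M \<inter> N \<in> open_normal_subgroups G T"
          using MN unfolding open_normal_subgroups_def
          by (auto intro: normal_Int_subgroup normal_subgroup_intersect)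
        have "subgroup H G"
          using H Int.IH sub by blast
        then have "subgroup_nbhd G T H (M \<inter> N) \<subseteq> A \<inter> B"
          using subgroup_nbhd_mono[OF _ I MN(1)] subgroup_nbhd_mono[OF _ I MN(2)] MN(3,4) by blast
        with I show "\<exists>N\<in>open_normal_subgroups G T. subgroup_nbhd G T H N \<subseteq> A \<inter> B" by blast
      qed (use Int.IH in blast)
    next
      case (UN K)
      then show ?case by (meson Sup_le_iff UnionE Union_upper subset_trans)
    next
      case (Basis s)
      then obtain H N where "s = subgroup_nbhd G T H N" "N \<in> open_normal_subgroups G T" by blast
      then show ?case unfolding subgroup_nbhd_def by blast
    qed
  qed
  show "openin (subgroup_space G T) U" if U: "?R U"
  proof (subst openin_subopen, intro ballI)
    fix H assume H: "H \<in> U"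
    then obtain N where N: "N \<in> open_normal_subgroups G T" "subgroup_nbhd G T H N \<subseteq> U"
      using U by blast
    have "H \<in> closed_subgroups G T" using H U by blast
    then have "openin (subgroup_space G T) (subgroup_nbhd G T H N)" "H \<in> subgroup_nbhd G T H N"
      using N(1) unfolding subgroup_space_def
      by (auto intro!: topology_generated_by_Basis simp: subgroup_nbhd_def)
    with N(2) show "\<exists>V. openin (subgroup_space G T) V \<and> H \<in> V \<and> V \<subseteq> U" by blast
  qed
qed

section \<open>The order as a supernatural number\<close>

text \<open>A supernatural number is given by the exponents of the primes (and the value 0 at non-primes).
  Divisibility is then the pointwise order and least common multiples are pointwise suprema.\<close>

type_synonym supernatural = "nat \<Rightarrow> enat"

definition supernatural_of_nat :: "nat \<Rightarrow> supernatural" where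
  "supernatural_of_nat m = (\<lambda>p. if prime p then enat (multiplicity p m) else 0)"

definition profinite_order :: "('a, 'b) monoid_scheme \<Rightarrow> 'a topology \<Rightarrow> supernatural" where
  "profinite_order G T =
     (SUP N \<in> open_normal_subgroups G T. supernatural_of_nat (card (rcosets\<^bsub>G\<^esub> N)))"

definition infinite_order_primes :: "('a, 'b) monoid_scheme \<Rightarrow> 'a topology \<Rightarrow> nat set" where
  "infinite_order_primes G T =
     {p. prime p \<and> (\<forall>m. supernatural_of_nat (p ^ m) \<le> profinite_order G T)}"

section \<open>Ordinals\<close>

text \<open>Ordinals are represented by reflexive well-orderings, as in the library. In the sum \<open>r\<close>
  precedes \<open>s\<close>; the product consists of \<open>s\<close> copies of \<open>r\<close>, i.e. the second coordinate is the more
  significant one.\<close>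

definition ord_sum :: "'a rel \<Rightarrow> 'b rel \<Rightarrow> ('a + 'b) rel" where
  "ord_sum r s = dir_image r Inl \<union> dir_image s Inr \<union>
     {(Inl a, Inr b) | a b. a \<in> Field r \<and> b \<in> Field s}"

definition ord_prod :: "'a rel \<Rightarrow> 'b rel \<Rightarrow> ('a \<times> 'b) rel" where
  "ord_prod r s = {((a, b), (a', b')) | a b a' b'.
     a \<in> Field r \<and> a' \<in> Field r \<and> (b, b') \<in> s \<and> (b = b' \<longrightarrow> (a, a') \<in> r)}"

text \<open>The recursion \<open>\<omega>\<^sup>0 = 1\<close>, \<open>\<omega>\<^sup>k\<^sup>+\<^sup>1 = \<omega>\<^sup>k \<sqdot> \<omega>\<close>. To keep the type independent of \<open>k\<close>, the element
  \<open>(x, a)\<close> of the product is encoded as the list \<open>a # x\<close>.\<close>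

primrec omega_power :: "nat \<Rightarrow> nat list rel" where
  "omega_power 0 = {([], [])}"
| "omega_power (Suc k) = dir_image (ord_prod (omega_power k) natLeq) (\<lambda>(x, a). a # x)"

definition omega_power_mult_plus_one :: "nat \<Rightarrow> nat \<Rightarrow> (nat list \<times> nat + nat) rel" where
  "omega_power_mult_plus_one k n =
     ord_sum (ord_prod (omega_power k) (natLeq_on n)) (natLeq_on 1)"

text \<open>The whole set is included among the generators since a one-point order has no open rays
  covering it.\<close>

definition ord_topology :: "'a rel \<Rightarrow> 'a topology" where
  "ord_topology r =
     topology_generated_by (insert (Field r) (underS r ` Field r \<union> aboveS r ` Field r))"

end

theory Submission
  imports Defs "HOL-Algebra.Multiplicative_Group"
begin

text \<open>A countable compact Hausdorff space of finite Cantor-Bendixson rank is determined up to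
  homeomorphism by its rank \<open>k\<close> and the number \<open>n\<close> of points of rank \<open>k\<close> (Mazurkiewicz and
  Sierpinski), and \<open>\<omega>^k n + 1\<close> realises the pair \<open>(k, n)\<close> when \<open>k > 0\<close>. So the theorem follows from
  an analysis of ranks in the space of closed subgroups. Ranks enter only through two local
  properties of a function to the natural numbers, collected in \<open>ranked_space\<close>: near a point all other
  points have smaller rank, and every point of rank \<open>j + 1\<close> is a limit of points of rank \<open>j\<close>.
  Spaces with these properties are classified in \<open>homeomorphic_space_ranked\<close>; the ordinals have them
  by \<open>ranked_space_ordinal\<close>.

  On the side of groups the key is Baire's theorem. If \<open>G\<close> has countably many closed subgroups then
  \<open>G\<close>, and every coset of an open subgroup, is a union of countably many closed sets that lie in
  procyclic subgroups, one of which must have interior points. The whole group yields an open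
  procyclic subgroup, the cosets yield that an open part of it is central
  (\<open>open_central_subgroup_of_hull\<close>). Thus \<open>G\<close> has an open central procyclic subgroup \<open>A\<close>. Only
  finitely many primes divide the order of \<open>A\<close>, since distinct sets of such primes give distinct
  closed subgroups (\<open>finite_relevant_primes\<close>). In essence \<open>A\<close> is a finite group times
  the product of the \<open>p\<close>-adic integers for the primes \<open>p\<close> with \<open>p^\<infinity>\<close> dividing the order of \<open>G\<close>.

  The rank of a closed subgroup \<open>K\<close> is the number of primes \<open>p\<close> for which \<open>p^\<infinity>\<close> divides the index of
  \<open>K\<close>, which can be read off from \<open>B = K \<inter> A\<close>. A subgroup \<open>K'\<close> close to \<open>K\<close> has a
  trace on \<open>A\<close> with the same \<open>p\<close>-part as \<open>B\<close> for each prime whose power in the index of \<open>B\<close> is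
  finite. If the other primes are the same for \<open>K'\<close> as well then the traces coincide, and as \<open>A / B\<close> has
  no small torsion this forces \<open>K' = K\<close> (\<open>corank_isolating\<close>). Conversely, multiplying \<open>K\<close> by a small
  open subgroup of the \<open>p\<close>-part of \<open>A\<close> removes precisely the prime \<open>p\<close>
  (\<open>corank_accumulation\<close>). The largest rank is that of the trivial subgroup, which is the number of
  primes \<open>p\<close> with \<open>p^\<infinity>\<close> dividing the order of \<open>G\<close>.\<close>

section \<open>Countable compact spaces with a rank function\<close>

text \<open>The last two conditions determine \<open>r\<close>: it is the Cantor-Bendixson rank, described without derived
  sets. The separation of points by clopen sets makes the space Hausdorff and, being compact,
  zero-dimensional.\<close>

definition ranked_space :: "'a topology \<Rightarrow> ('a \<Rightarrow> nat) \<Rightarrow> bool" where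
  "ranked_space X r \<longleftrightarrow> compact_space X \<and> countable (topspace X) \<and>
     (\<forall>x\<in>topspace X. \<forall>y\<in>topspace X. x \<noteq> y \<longrightarrow> (\<exists>V. openin X V \<and> closedin X V \<and> x \<in> V \<and> y \<notin> V)) \<and>
     (\<forall>x\<in>topspace X. \<exists>U. openin X U \<and> x \<in> U \<and> (\<forall>y\<in>U. y \<noteq> x \<longrightarrow> r y < r x)) \<and>
     (\<forall>x U. openin X U \<longrightarrow> x \<in> U \<longrightarrow> r x > 0 \<longrightarrow> (\<exists>y\<in>U. Suc (r y) = r x))"

lemma ranked_space_separation:
  assumes "ranked_space X r" "x \<in> topspace X" "y \<in> topspace X" "x \<noteq> y"
  obtains V where "openin X V" "closedin X V" "x \<in> V" "y \<notin> V"
  using assms unfolding ranked_space_def by blast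

lemma ranked_space_compact: "ranked_space X r \<Longrightarrow> compact_space X"
  and ranked_space_countable: "ranked_space X r \<Longrightarrow> countable (topspace X)"
  unfolding ranked_space_def by simp_all

lemma ranked_space_isolating:
  assumes "ranked_space X r" "x \<in> topspace X"
  obtains U where "openin X U" "x \<in> U" "\<forall>y\<in>U - {x}. r y < r x"
proof -
  have "\<forall>x\<in>topspace X. \<exists>U. openin X U \<and> x \<in> U \<and> (\<forall>y\<in>U. y \<noteq> x \<longrightarrow> r y < r x)"
    using assms(1) unfolding ranked_space_def by simp
  then obtain U where "openin X U" "x \<in> U" "\<forall>y\<in>U. y \<noteq> x \<longrightarrow> r y < r x"
    using assms(2) by meson
  then show thesis using that[of U] by blast
qed

lemma ranked_space_accumulation:
  assumes "ranked_space X r" "openin X U" "x \<in> U" "r x > 0"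
  obtains y where "y \<in> U" "Suc (r y) = r x"
proof -
  have "\<forall>x U. openin X U \<longrightarrow> x \<in> U \<longrightarrow> r x > 0 \<longrightarrow> (\<exists>y\<in>U. Suc (r y) = r x)"
    using assms(1) unfolding ranked_space_def by simp
  then show thesis using assms(2-4) that by meson
qed

lemma ranked_space_Hausdorff:
  assumes "ranked_space X r"
  shows "Hausdorff_space X"
  unfolding Hausdorff_space_def
proof (intro allI impI)
  fix x y assume "x \<in> topspace X \<and> y \<in> topspace X \<and> x \<noteq> y"
  then obtain V where "openin X V" "closedin X V" "x \<in> V" "y \<notin> V"
    using ranked_space_separation[OF assms, of x y] by blast
  then show "\<exists>U V. openin X U \<and> openin X V \<and> x \<in> U \<and> y \<in> V \<and> disjnt U V"
    using \<open>x \<in> topspace X \<and> y \<in> topspace X \<and> x \<noteq> y\<close>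
    by (intro exI[of _ V] exI[of _ "topspace X - V"]) (auto simp: disjnt_def closedin_def)
qed

text \<open>The complement of \<open>U\<close> is compact, so finitely many of the clopen sets that miss \<open>x\<close> cover it.\<close>

lemma compact_space_clopen_base:
  assumes X: "compact_space X"
    and sep: "\<And>y. y \<in> topspace X \<Longrightarrow> y \<noteq> x \<Longrightarrow> \<exists>V. openin X V \<and> closedin X V \<and> y \<in> V \<and> x \<notin> V"
    and U: "openin X U" "x \<in> U"
  obtains V where "openin X V" "closedin X V" "x \<in> V" "V \<subseteq> U"
proof -
  have x: "x \<in> topspace X" using U openin_subset by blast
  have K: "compactin X (topspace X - U)"
    using closedin_compact_space[OF X] U(1) by blast
  let ?\<C> = "{W. openin X W \<and> closedin X W \<and> x \<notin> W}"
  have "topspace X - U \<subseteq> \<Union>?\<C>"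
  proof
    fix y assume y: "y \<in> topspace X - U"
    then obtain W where "openin X W" "closedin X W" "y \<in> W" "x \<notin> W"
      using sep[of y] U(2) by blast
    then show "y \<in> \<Union>?\<C>" by blast
  qed
  then obtain \<F> where F: "finite \<F>" "\<F> \<subseteq> ?\<C>" "topspace X - U \<subseteq> \<Union>\<F>"
    using compactinD[OF K, of ?\<C>] by blast
  show thesis
  proof
    have "closedin X (\<Union>\<F>)" by (rule closedin_Union) (use F in auto)
    then show "openin X (topspace X - \<Union>\<F>)" by blast
    have "openin X (\<Union>\<F>)" by (rule openin_Union) (use F in auto)
    then show "closedin X (topspace X - \<Union>\<F>)" by blast
    show "x \<in> topspace X - \<Union>\<F>" using x F(2) by blast
    show "topspace X - \<Union>\<F> \<subseteq> U" using F(3) by blast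
  qed
qed

lemma ranked_space_clopen_base:
  assumes X: "ranked_space X r" and U: "openin X U" "x \<in> U"
  obtains V where "openin X V" "closedin X V" "x \<in> V" "V \<subseteq> U"
proof (rule compact_space_clopen_base[OF ranked_space_compact[OF X] _ U])
  fix y assume "y \<in> topspace X" "y \<noteq> x"
  moreover have "x \<in> topspace X" using U openin_subset by blast
  ultimately show "\<exists>V. openin X V \<and> closedin X V \<and> y \<in> V \<and> x \<notin> V"
    using ranked_space_separation[OF X, of y x] by metis
qed

lemma ranked_space_isolating_clopen:
  assumes X: "ranked_space X r" and x: "x \<in> topspace X" and U: "openin X U" "x \<in> U"
  obtains V where "openin X V" "closedin X V" "x \<in> V" "V \<subseteq> U" "\<forall>y\<in>V - {x}. r y < r x"
proof -
  obtain W where W: "openin X W" "x \<in> W" "\<forall>y\<in>W - {x}. r y < r x"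
    by (rule ranked_space_isolating[OF X x])
  have "openin X (U \<inter> W)" "x \<in> U \<inter> W" using U W by auto
  then obtain V where "openin X V" "closedin X V" "x \<in> V" "V \<subseteq> U \<inter> W"
    by (rule ranked_space_clopen_base[OF X])
  then show thesis using that[of V] W(3) by blast
qed

lemma ranked_space_clopen_subspace:
  assumes X: "ranked_space X r" and V: "openin X V" "closedin X V"
  shows "ranked_space (subtopology X V) r"
  unfolding ranked_space_def
proof (intro conjI ballI allI impI)
  have sub: "V \<subseteq> topspace X" using V openin_subset by blast
  have top: "topspace (subtopology X V) = V" using sub by auto
  have op: "openin (subtopology X V) W" if "openin X W" "W \<subseteq> V" for W
    using that openin_open_subtopology[OF V(1)] by blast
  have cl: "closedin (subtopology X V) W" if "closedin X W" "W \<subseteq> V" for W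
    using that V closedin_closed_subtopology by blast
  show "compact_space (subtopology X V)"
    using closedin_compact_space[OF ranked_space_compact[OF X] V(2)] by (rule compact_space_subtopology)
  show "countable (topspace (subtopology X V))"
    using X sub top countable_subset unfolding ranked_space_def by auto
  fix x
  {
    fix y assume "x \<in> topspace (subtopology X V)" "y \<in> topspace (subtopology X V)" "x \<noteq> y"
    then obtain W where "openin X W" "closedin X W" "x \<in> W" "y \<notin> W"
      using ranked_space_separation[OF X, of x y] by auto
    then show "\<exists>W. openin (subtopology X V) W \<and> closedin (subtopology X V) W \<and> x \<in> W \<and> y \<notin> W"
      using V op[of "W \<inter> V"] cl[of "W \<inter> V"] \<open>x \<in> topspace (subtopology X V)\<close>
      by (intro exI[of _ "W \<inter> V"]) auto
  next
    assume x: "x \<in> topspace (subtopology X V)"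
    have "x \<in> topspace X" "x \<in> V" using x by auto
    then obtain W where "openin X W" "x \<in> W" "W \<subseteq> V" "\<forall>y\<in>W - {x}. r y < r x"
      by (rule ranked_space_isolating_clopen[OF X _ V(1)])
    then show "\<exists>U. openin (subtopology X V) U \<and> x \<in> U \<and> (\<forall>y\<in>U. y \<noteq> x \<longrightarrow> r y < r x)"
      using op by blast
  next
    fix U assume "openin (subtopology X V) U" "x \<in> U" "0 < r x"
    then show "\<exists>y\<in>U. Suc (r y) = r x"
      using ranked_space_accumulation[OF X, of U x] openin_open_subtopology[OF V(1)] by metis
  }
qed

lemma continuous_map_disjoint_union:
  assumes D: "\<And>i. i \<in> I \<Longrightarrow> openin X (D i)" "topspace X = (\<Union>i\<in>I. D i)"
    and f: "\<And>i. i \<in> I \<Longrightarrow> continuous_map (subtopology X (D i)) (subtopology Y (E i)) (f i)"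
    and a: "\<And>i x. i \<in> I \<Longrightarrow> x \<in> D i \<Longrightarrow> a x = i"
  shows "continuous_map X Y (\<lambda>x. f (a x) x)"
proof (rule pasting_lemma[where I = I and T = D and f = f])
  show "continuous_map (subtopology X (D i)) Y (f i)" if "i \<in> I" for i
    using f[OF that] by (rule continuous_map_into_fulltopology)
  show "f i x = f j x" if "i \<in> I" "j \<in> I" "x \<in> topspace X \<inter> D i \<inter> D j" for i j x
    using that a by (metis IntE)
  show "\<exists>j. j \<in> I \<and> x \<in> D j \<and> f (a x) x = f j x" if "x \<in> topspace X" for x
    using that D(2) a by auto
qed (rule D)

lemma homeomorphic_space_disjoint_union:
  assumes D: "\<And>i. i \<in> I \<Longrightarrow> openin X (D i)" "topspace X = (\<Union>i\<in>I. D i)" "disjoint_family_on D I"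
    and E: "\<And>i. i \<in> I \<Longrightarrow> openin Y (E i)" "topspace Y = (\<Union>i\<in>I. E i)" "disjoint_family_on E I"
    and h: "\<And>i. i \<in> I \<Longrightarrow> subtopology X (D i) homeomorphic_space subtopology Y (E i)"
  shows "X homeomorphic_space Y"
proof -
  have "\<forall>i\<in>I. \<exists>f g. homeomorphic_maps (subtopology X (D i)) (subtopology Y (E i)) f g"
    using h unfolding homeomorphic_space_def by blast
  then obtain f g where fg: "\<And>i. i \<in> I \<Longrightarrow> homeomorphic_maps (subtopology X (D i)) (subtopology Y (E i)) (f i) (g i)"
    by metis
  have index: "\<exists>a. \<forall>i\<in>I. \<forall>x\<in>F i. a x = i" if "disjoint_family_on F I" for F :: "_ \<Rightarrow> 'z set"
  proof (intro exI ballI)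
    fix i x assume "i \<in> I" "x \<in> F i"
    then show "(SOME i. i \<in> I \<and> x \<in> F i) = i"
      using that unfolding disjoint_family_on_def by (intro some_equality) auto
  qed
  obtain a where a: "\<And>i x. i \<in> I \<Longrightarrow> x \<in> D i \<Longrightarrow> a x = i" using index[OF D(3)] by blast
  obtain b where b: "\<And>i y. i \<in> I \<Longrightarrow> y \<in> E i \<Longrightarrow> b y = i" using index[OF E(3)] by blast
  have tops: "topspace (subtopology X (D i)) = D i" "topspace (subtopology Y (E i)) = E i" if "i \<in> I" for i
    using D(2) E(2) that by auto
  have f: "continuous_map (subtopology X (D i)) (subtopology Y (E i)) (f i)"
    and g: "continuous_map (subtopology Y (E i)) (subtopology X (D i)) (g i)"
    and gf: "\<And>x. x \<in> D i \<Longrightarrow> g i (f i x) = x" and fg': "\<And>y. y \<in> E i \<Longrightarrow> f i (g i y) = y" if "i \<in> I" for i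
    using fg[OF that] tops[OF that] unfolding homeomorphic_maps_def by auto
  have fE: "f i x \<in> E i" if "i \<in> I" "x \<in> D i" for i x
    using continuous_map_funspace[OF f[OF that(1)]] tops that by auto
  have gD: "g i y \<in> D i" if "i \<in> I" "y \<in> E i" for i y
    using continuous_map_funspace[OF g[OF that(1)]] tops that by auto
  have "homeomorphic_maps X Y (\<lambda>x. f (a x) x) (\<lambda>y. g (b y) y)"
    unfolding homeomorphic_maps_def
  proof (intro conjI ballI)
    show "continuous_map X Y (\<lambda>x. f (a x) x)" by (rule continuous_map_disjoint_union[OF D(1,2) f a])
    show "continuous_map Y X (\<lambda>y. g (b y) y)" by (rule continuous_map_disjoint_union[OF E(1,2) g b])
    show "g (b (f (a x) x)) (f (a x) x) = x" if "x \<in> topspace X" for x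
    proof -
      have "x \<in> (\<Union>i\<in>I. D i)" using that D(2) by simp
      then obtain i where "i \<in> I" "x \<in> D i" by blast
      then show ?thesis using a b[OF _ fE] gf by simp
    qed
    show "f (a (g (b y) y)) (g (b y) y) = y" if "y \<in> topspace Y" for y
    proof -
      have "y \<in> (\<Union>i\<in>I. E i)" using that E(2) by simp
      then obtain i where "i \<in> I" "y \<in> E i" by blast
      then show ?thesis using b a[OF _ gD] fg' by simp
    qed
  qed
  then show ?thesis unfolding homeomorphic_space_def by blast
qed

text \<open>A compact Hausdorff space is the one-point compactification of the complement of any of its
  points, so a homeomorphism between the complements extends.\<close>

lemma homeomorphic_space_compact_remove_point:
  assumes X: "compact_space X" "Hausdorff_space X" "x \<in> topspace X"
    and Y: "compact_space Y" "Hausdorff_space Y" "y \<in> topspace Y"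
    and h: "subtopology X (topspace X - {x}) homeomorphic_space subtopology Y (topspace Y - {y})"
  shows "X homeomorphic_space Y"
proof -
  obtain f g where fg: "homeomorphic_maps (subtopology X (topspace X - {x})) (subtopology Y (topspace Y - {y})) f g"
    using h unfolding homeomorphic_space_def by blast
  have f: "continuous_map (subtopology X (topspace X - {x})) (subtopology Y (topspace Y - {y})) f"
    and g: "continuous_map (subtopology Y (topspace Y - {y})) (subtopology X (topspace X - {x})) g"
    and gf: "\<And>v. v \<in> topspace X \<Longrightarrow> v \<noteq> x \<Longrightarrow> g (f v) = v"
    and fg: "\<And>w. w \<in> topspace Y \<Longrightarrow> w \<noteq> y \<Longrightarrow> f (g w) = w"
    using fg unfolding homeomorphic_maps_def by auto
  have fY: "f v \<in> topspace Y \<and> f v \<noteq> y" if "v \<in> topspace X" "v \<noteq> x" for v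
    using continuous_map_funspace[OF f] that by (auto simp: Pi_iff)
  have gX: "g w \<in> topspace X \<and> g w \<noteq> x" if "w \<in> topspace Y" "w \<noteq> y" for w
    using continuous_map_funspace[OF g] that by (auto simp: Pi_iff)
  let ?F = "\<lambda>v. if v = x then y else f v"
  have "continuous_map X Y ?F"
    unfolding continuous_map_def
  proof (intro conjI allI impI)
    show "?F \<in> topspace X \<rightarrow> topspace Y" using fY Y(3) by auto
    fix U assume U: "openin Y U"
    show "openin X {v \<in> topspace X. ?F v \<in> U}"
    proof (cases "y \<in> U")
      case False
      have *: "openin (subtopology Y (topspace Y - {y})) U"
        unfolding openin_subtopology using U False openin_subset by (intro exI[of _ U]) auto
      have "openin (subtopology X (topspace X - {x})) {v \<in> topspace X - {x}. f v \<in> U}"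
        using openin_continuous_map_preimage[OF f *] by (simp add: Int_absorb1 Diff_subset)
      moreover have "openin X (topspace X - {x})"
        using closedin_Hausdorff_singleton[OF X(2,3)] by (rule openin_diff[OF openin_topspace])
      ultimately have "openin X {v \<in> topspace X - {x}. f v \<in> U}"
        using openin_trans_full by blast
      moreover have "{v \<in> topspace X - {x}. f v \<in> U} = {v \<in> topspace X. ?F v \<in> U}"
        using False by auto
      ultimately show ?thesis by simp
    next
      case True
      \<comment> \<open>The complement of \<open>U\<close> is compact and misses \<open>y\<close>, so its preimage is a compact image under \<open>g\<close>.\<close>
      have "compactin Y (topspace Y - U)"
        using closedin_compact_space[OF Y(1)] U by blast
      then have "compactin (subtopology Y (topspace Y - {y})) (topspace Y - U)"
        using True by (auto simp: compactin_subtopology)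
      from image_compactin[OF this g] have "compactin X (g ` (topspace Y - U))"
        by (simp add: compactin_subtopology)
      then have "closedin X (g ` (topspace Y - U))"
        using X(2) compactin_imp_closedin by blast
      moreover have "{v \<in> topspace X. ?F v \<in> U} = topspace X - g ` (topspace Y - U)"
      proof (intro equalityI subsetI)
        fix v assume v: "v \<in> {v \<in> topspace X. ?F v \<in> U}"
        have "v \<noteq> g w" if w: "w \<in> topspace Y - U" for w
        proof
          assume eq: "v = g w"
          have "w \<noteq> y" using w True by auto
          then show False using v w gX[of w] fg[of w] eq by auto
        qed
        then show "v \<in> topspace X - g ` (topspace Y - U)" using v by auto
      next
        fix v assume v: "v \<in> topspace X - g ` (topspace Y - U)"
        show "v \<in> {v \<in> topspace X. ?F v \<in> U}"
        proof (cases "v = x")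
          case False
          then have "f v \<in> U"
            using v gf[of v] fY[of v] by (metis DiffD1 DiffD2 DiffI imageI)
          then show ?thesis using v False by simp
        qed (use v True in auto)
      qed
      ultimately show ?thesis by (simp add: openin_diff)
    qed
  qed
  moreover have "bij_betw ?F (topspace X) (topspace Y)"
    by (rule bij_betw_byWitness[where f' = "\<lambda>w. if w = y then x else g w"])
      (use fY gX gf fg X(3) Y(3) in \<open>auto split: if_splits\<close>)
  ultimately show ?thesis
    using continuous_imp_homeomorphic_map[of X Y ?F] X(1) Y(2) homeomorphic_map_imp_homeomorphic_space
    unfolding bij_betw_def by blast
qed

text \<open>Every \<open>v \<noteq> x\<close> has a clopen neighbourhood \<open>V v\<close> missing \<open>x\<close> and all points of rank \<open>k\<close> but possibly \<open>v\<close>.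
  The points of rank \<open>k\<close> accumulate at \<open>x\<close>, so they can be enumerated as \<open>z 0\<close>, \<open>z 1\<close>, and so on without
  repetition; let \<open>y\<close> enumerate all points other than \<open>x\<close>. The union \<open>F i\<close> of \<open>V (z i)\<close> and, unless \<open>y i\<close>
  has rank \<open>k\<close>, of \<open>V (y i)\<close> has \<open>z i\<close> as its only point of rank \<open>k\<close>. Making the \<open>F i\<close> disjoint does not
  change this.\<close>

lemma ranked_space_punctured_decomposition:
  assumes X: "ranked_space X r" and x: "x \<in> topspace X" "r x = Suc k"
    and below: "\<And>y. y \<in> topspace X \<Longrightarrow> y \<noteq> x \<Longrightarrow> r y \<le> k"
  obtains D :: "nat \<Rightarrow> 'a set" where "\<forall>i. openin X (D i)" "\<forall>i. closedin X (D i)" "disjoint_family D"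
    "(\<Union>i. D i) = topspace X - {x}" "\<forall>i. \<exists>z. {w \<in> D i. r w = k} = {z}"
proof -
  define R where "R = {z \<in> topspace X. r z = k}"
  have xR: "x \<notin> R" using x unfolding R_def by auto
  have "infinite R"
  proof
    assume "finite R"
    moreover have "R \<subseteq> topspace X" unfolding R_def by blast
    ultimately have "closedin X R"
      using ranked_space_Hausdorff[OF X] by (metis Hausdorff_imp_t1_space t1_space_closedin_finite)
    then have "openin X (topspace X - R)" by blast
    then obtain y where "y \<in> topspace X - R" "Suc (r y) = r x"
      using X x xR unfolding ranked_space_def by (metis Diff_iff zero_less_Suc)
    then show False using x unfolding R_def by simp
  qed
  moreover have "countable R"
    using X unfolding R_def ranked_space_def by (auto intro: countable_subset)
  ultimately obtain z :: "nat \<Rightarrow> 'a" where z: "bij_betw z UNIV R"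
    using bij_betw_from_nat_into by blast
  have zR: "z i \<in> R" for i using z bij_betw_apply by force
  have z_eq: "z i = z j \<longleftrightarrow> i = j" for i j
    using z unfolding bij_betw_def inj_on_def by blast
  have z_top: "z i \<in> topspace X - {x}" for i using zR[of i] xR unfolding R_def by auto
  have cX: "countable (topspace X - {x})" "topspace X - {x} \<noteq> {}"
    using ranked_space_countable[OF X] z_top[of 0] by (auto intro: countable_subset)
  then have surj: "range (from_nat_into (topspace X - {x})) = topspace X - {x}"
    by (rule range_from_nat_into[rotated])
  define y where "y = from_nat_into (topspace X - {x})"
  have y_top: "y i \<in> topspace X - {x}" for i using surj unfolding y_def by (metis rangeI)
  have "\<exists>V. openin X V \<and> closedin X V \<and> v \<in> V \<and> x \<notin> V \<and> V \<inter> R \<subseteq> {v}" if v: "v \<in> topspace X - {x}" for v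
  proof -
    have "openin X (topspace X - {x})"
      using closedin_Hausdorff_singleton[OF ranked_space_Hausdorff[OF X] x(1)] by (rule openin_diff[OF openin_topspace])
    moreover have "v \<in> topspace X" using v by simp
    ultimately obtain V where V: "openin X V" "closedin X V" "v \<in> V" "V \<subseteq> topspace X - {x}" "\<forall>y\<in>V - {v}. r y < r v"
      using v ranked_space_isolating_clopen[OF X] by metis
    have "V \<inter> R \<subseteq> {v}"
    proof
      fix w assume w: "w \<in> V \<inter> R"
      show "w \<in> {v}"
      proof (rule ccontr)
        assume "w \<notin> {v}"
        then have "r w < r v" using V(5) w by blast
        moreover have "r v \<le> k" using below v by blast
        ultimately show False using w unfolding R_def by auto
      qed
    qed
    then show ?thesis using V by blast
  qed
  then obtain V where V: "\<And>v. v \<in> topspace X - {x} \<Longrightarrow>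
      openin X (V v) \<and> closedin X (V v) \<and> v \<in> V v \<and> x \<notin> V v \<and> V v \<inter> R \<subseteq> {v}"
    by metis
  define F where "F i = (if y i \<in> R then V (z i) else V (z i) \<union> V (y i))" for i
  have F_open: "openin X (F i)" and F_closed: "closedin X (F i)" and F_x: "x \<notin> F i" for i
    using V[OF z_top, of i] V[OF y_top, of i] unfolding F_def by auto
  have F_R: "F i \<inter> R = {z i}" for i
    using V[OF z_top, of i] V[OF y_top, of i] zR[of i] unfolding F_def by auto
  have F_un: "(\<Union>i. F i) = topspace X - {x}"
  proof (intro equalityI subsetI)
    fix v assume "v \<in> (\<Union>i. F i)"
    then obtain i where "v \<in> F i" by blast
    then show "v \<in> topspace X - {x}" using F_x F_open openin_subset by blast
  next
    fix v assume v: "v \<in> topspace X - {x}"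
    show "v \<in> (\<Union>i. F i)"
    proof (cases "v \<in> R")
      case True
      then obtain i where "v = z i" using z unfolding bij_betw_def by blast
      then show ?thesis using F_R[of i] by blast
    next
      case False
      obtain i where "v = y i" using v surj unfolding y_def by blast
      then show ?thesis using False V[OF v] unfolding F_def by auto
    qed
  qed
  show thesis
  proof (rule that[of "disjointed F"]; (intro allI)?)
    fix i
    have D: "disjointed F i = F i - (\<Union>j\<in>{0..<i}. F j)" unfolding disjointed_def ..
    have "openin X (\<Union>j\<in>{0..<i}. F j)" using F_open by (intro openin_Union) auto
    moreover have "closedin X (\<Union>j\<in>{0..<i}. F j)" using F_closed by (intro closedin_Union) auto
    ultimately show "openin X (disjointed F i)" "closedin X (disjointed F i)"
      unfolding D using F_open F_closed by (auto intro: openin_diff closedin_diff)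
    have "{w \<in> disjointed F i. r w = k} = disjointed F i \<inter> R"
      unfolding R_def D using F_open[of i] openin_subset by auto
    also have "\<dots> = {z i}"
    proof -
      have "z i \<notin> F j" if "j < i" for j using F_R[of j] zR[of i] z_eq[of i j] that by auto
      then show ?thesis unfolding D using F_R[of i] by auto
    qed
    finally show "\<exists>z. {w \<in> disjointed F i. r w = k} = {z}" by blast
  next
    show "disjoint_family (disjointed F)" by (rule disjoint_family_disjointed)
    show "(\<Union>i. disjointed F i) = topspace X - {x}" using F_un by (simp add: UN_disjointed_eq)
  qed
qed

text \<open>Without their top points both spaces are disjoint unions of sequences of clopen pieces, each with a
  single point of the next lower rank. The pieces are homeomorphic by induction.\<close>

lemma homeomorphic_space_ranked_single_top:
  assumes "ranked_space X r" "\<And>x. x \<in> topspace X \<Longrightarrow> r x \<le> k" "{x \<in> topspace X. r x = k} = {x0}"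
    and "ranked_space Y s" "\<And>y. y \<in> topspace Y \<Longrightarrow> s y \<le> k" "{y \<in> topspace Y. s y = k} = {y0}"
  shows "X homeomorphic_space Y"
  using assms
proof (induction k arbitrary: X Y x0 y0)
  case 0
  have "topspace X = {x0}" "topspace Y = {y0}" using 0 by auto
  then have "homeomorphic_maps X Y (\<lambda>_. y0) (\<lambda>_. x0)"
    unfolding homeomorphic_maps_def by auto
  then show ?case unfolding homeomorphic_space_def by blast
next
  case (Suc k)
  have x0: "x0 \<in> topspace X" "r x0 = Suc k" and y0: "y0 \<in> topspace Y" "s y0 = Suc k"
    using Suc.prems by auto
  have x_le: "r x \<le> k" if "x \<in> topspace X" "x \<noteq> x0" for x
    using Suc.prems(2)[OF that(1)] Suc.prems(3) that by (auto simp: le_Suc_eq)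
  obtain D :: "nat \<Rightarrow> 'a set" where D: "\<forall>i. openin X (D i)" "\<forall>i. closedin X (D i)" "disjoint_family D"
    "(\<Union>i. D i) = topspace X - {x0}" "\<forall>i. \<exists>z. {w \<in> D i. r w = k} = {z}"
    by (rule ranked_space_punctured_decomposition[OF Suc.prems(1) x0 x_le])
  have y_le: "s y \<le> k" if "y \<in> topspace Y" "y \<noteq> y0" for y
    using Suc.prems(5)[OF that(1)] Suc.prems(6) that by (auto simp: le_Suc_eq)
  obtain E :: "nat \<Rightarrow> 'b set" where E: "\<forall>i. openin Y (E i)" "\<forall>i. closedin Y (E i)" "disjoint_family E"
    "(\<Union>i. E i) = topspace Y - {y0}" "\<forall>i. \<exists>z. {w \<in> E i. s w = k} = {z}"
    by (rule ranked_space_punctured_decomposition[OF Suc.prems(4) y0 y_le])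
  have Dk: "r x \<le> k" if "x \<in> D i" for i x using x_le[of x] D(4) that by blast
  have Ek: "s y \<le> k" if "y \<in> E i" for i y using y_le[of y] E(4) that by blast
  have DE: "subtopology X (D i) homeomorphic_space subtopology Y (E i)" for i
  proof -
    obtain z w where "{v \<in> D i. r v = k} = {z}" "{v \<in> E i. s v = k} = {w}"
      using D(5) E(5) by meson
    moreover have "topspace (subtopology X (D i)) = D i" "topspace (subtopology Y (E i)) = E i"
      using D(1) E(1) openin_subset by (metis topspace_subtopology_subset)+
    ultimately show ?thesis
      using Suc.IH[of "subtopology X (D i)" z "subtopology Y (E i)" w]
        ranked_space_clopen_subspace[OF Suc.prems(1)] ranked_space_clopen_subspace[OF Suc.prems(4)] D(1,2) E(1,2) Dk Ek
      by simp
  qed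
  have sub: "D i \<subseteq> topspace X - {x0}" "E i \<subseteq> topspace Y - {y0}" for i using D(4) E(4) by blast+
  have "subtopology X (topspace X - {x0}) homeomorphic_space subtopology Y (topspace Y - {y0})"
  proof (rule homeomorphic_space_disjoint_union[where I = UNIV and D = D and E = E])
    fix i :: nat
    show "openin (subtopology X (topspace X - {x0})) (D i)"
      unfolding openin_subtopology using D(1) sub(1)[of i] by (intro exI[of _ "D i"]) auto
    show "openin (subtopology Y (topspace Y - {y0})) (E i)"
      unfolding openin_subtopology using E(1) sub(2)[of i] by (intro exI[of _ "E i"]) auto
    show "subtopology (subtopology X (topspace X - {x0})) (D i) homeomorphic_space
        subtopology (subtopology Y (topspace Y - {y0})) (E i)"
      using DE[of i] sub[of i] by (simp add: subtopology_subtopology inf.absorb2)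
  qed (use D E in auto)
  then show ?case
    by (rule homeomorphic_space_compact_remove_point[OF
          ranked_space_compact[OF Suc.prems(1)] ranked_space_Hausdorff[OF Suc.prems(1)] x0(1)
          ranked_space_compact[OF Suc.prems(4)] ranked_space_Hausdorff[OF Suc.prems(4)] y0(1)])
qed

text \<open>The theorem of Mazurkiewicz and Sierpinski for finite ranks. A clopen neighbourhood of a point of
  top rank that contains no other such point is split off, which lowers their number by one.\<close>

theorem homeomorphic_space_ranked:
  assumes "ranked_space X r" "\<And>x. x \<in> topspace X \<Longrightarrow> r x \<le> k" "card {x \<in> topspace X. r x = k} = Suc n"
    and "ranked_space Y s" "\<And>y. y \<in> topspace Y \<Longrightarrow> s y \<le> k" "card {y \<in> topspace Y. s y = k} = Suc n"
  shows "X homeomorphic_space Y"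
  using assms
proof (induction n arbitrary: X Y)
  case 0
  then obtain x0 y0 where "{x \<in> topspace X. r x = k} = {x0}" "{y \<in> topspace Y. s y = k} = {y0}"
    by (auto simp: card_1_singleton_iff)
  then show ?case
    using homeomorphic_space_ranked_single_top[OF 0(1,2) _ 0(4,5)] by blast
next
  case (Suc n)
  have split: "\<exists>z V. z \<in> V \<and> openin Z V \<and> closedin Z V \<and> {v \<in> V. t v = k} = {z} \<and> card {v \<in> topspace Z - V. t v = k} = Suc n"
    if Z: "ranked_space Z t" and le: "\<And>v. v \<in> topspace Z \<Longrightarrow> t v \<le> k"
      and c: "card {v \<in> topspace Z. t v = k} = Suc (Suc n)" for Z :: "'c topology" and t
  proof -
    obtain z where z: "z \<in> topspace Z" "t z = k"
      using c by (cases "{v \<in> topspace Z. t v = k} = {}") auto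
    obtain V where V: "openin Z V" "closedin Z V" "z \<in> V" "\<forall>y\<in>V - {z}. t y < t z"
      by (rule ranked_space_isolating_clopen[OF Z z(1) openin_topspace z(1)])
    have "{v \<in> V. t v = k} = {z}" using V(3,4) z by (fastforce dest: bspec)
    moreover have "{v \<in> topspace Z - V. t v = k} = {v \<in> topspace Z. t v = k} - {z}"
      using V(3,4) z by (fastforce dest: bspec)
    ultimately show ?thesis using V c z by (intro exI[of _ z] exI[of _ V]) auto
  qed
  obtain z V where V: "openin X V" "closedin X V" "{v \<in> V. r v = k} = {z}" "card {v \<in> topspace X - V. r v = k} = Suc n"
    using split[OF Suc.prems(1-3)] by blast
  obtain w W where W: "openin Y W" "closedin Y W" "{v \<in> W. s v = k} = {w}" "card {v \<in> topspace Y - W. s v = k} = Suc n"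
    using split[OF Suc.prems(4-6)] by blast
  have sub: "V \<subseteq> topspace X" "W \<subseteq> topspace Y" using V W openin_subset by blast+
  have tops: "topspace (subtopology X V) = V" "topspace (subtopology Y W) = W"
    "topspace (subtopology X (topspace X - V)) = topspace X - V"
    "topspace (subtopology Y (topspace Y - W)) = topspace Y - W"
    using sub by auto
  have co: "openin X (topspace X - V)" "closedin X (topspace X - V)" "openin Y (topspace Y - W)" "closedin Y (topspace Y - W)"
    using V W by blast+
  have 1: "subtopology X V homeomorphic_space subtopology Y W"
    by (rule homeomorphic_space_ranked_single_top[of _ r k z _ s w])
      (use V W sub Suc.prems ranked_space_clopen_subspace in \<open>simp_all only: tops subset_iff\<close>)
  have 2: "subtopology X (topspace X - V) homeomorphic_space subtopology Y (topspace Y - W)"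
    by (rule Suc.IH) (use V W co sub Suc.prems ranked_space_clopen_subspace in \<open>simp_all only: tops Diff_iff\<close>)
  show ?case
  proof (rule homeomorphic_space_disjoint_union[where I = UNIV])
    show "openin X (if b then V else topspace X - V)" for b using V co by simp
    show "openin Y (if b then W else topspace Y - W)" for b using W co by simp
    show "topspace X = (\<Union>b. if b then V else topspace X - V)" using sub by (auto split: if_splits)
    show "topspace Y = (\<Union>b. if b then W else topspace Y - W)" using sub by (auto split: if_splits)
    show "subtopology X (if b then V else topspace X - V) homeomorphic_space
      subtopology Y (if b then W else topspace Y - W)" for b using 1 2 by simp
  qed (auto simp: disjoint_family_on_def)
qed

text \<open>Finitely many neighbourhoods as in the definition of \<open>ranked_space\<close> cover the space, and each
  contains at most one point of top rank, namely its centre.\<close>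

lemma ranked_space_finite_top:
  assumes X: "ranked_space X r" and le: "\<And>x. x \<in> topspace X \<Longrightarrow> r x \<le> k"
  shows "finite {x \<in> topspace X. r x = k}"
proof -
  have "\<forall>x\<in>topspace X. \<exists>U. openin X U \<and> x \<in> U \<and> (\<forall>y\<in>U. y \<noteq> x \<longrightarrow> r y < r x)"
    using X unfolding ranked_space_def by blast
  then obtain U where U: "\<And>x. x \<in> topspace X \<Longrightarrow> openin X (U x) \<and> x \<in> U x \<and> (\<forall>y\<in>U x. y \<noteq> x \<longrightarrow> r y < r x)"
    by metis
  have "compactin X (topspace X)" using X unfolding ranked_space_def compact_space_def by blast
  then obtain \<F> where F: "finite \<F>" "\<F> \<subseteq> U ` topspace X" "topspace X \<subseteq> \<Union>\<F>"
    using compactinD[of X "topspace X" "U ` topspace X"] U by blast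
  then obtain S where S: "finite S" "S \<subseteq> topspace X" "\<F> = U ` S"
    by (meson finite_subset_image)
  have "{x \<in> topspace X. r x = k} \<subseteq> S"
  proof
    fix x assume x: "x \<in> {x \<in> topspace X. r x = k}"
    then obtain v where v: "v \<in> S" "x \<in> U v" using F S by auto
    then have "x = v" using U[of v] S le[of v] x by (metis (mono_tags, lifting) leD mem_Collect_eq subsetD)
    then show "x \<in> S" using v by simp
  qed
  then show ?thesis using S finite_subset by blast
qed

section \<open>The order topology of \<open>\<omega>^k n + 1\<close>\<close>

lemma topspace_ord_topology [simp]: "topspace (ord_topology r) = Field r"
  unfolding ord_topology_def topology_generated_by_topspace
  by (auto simp: underS_def aboveS_def Field_def)

lemma openin_ord_topology_underS: "x \<in> Field r \<Longrightarrow> openin (ord_topology r) (underS r x)"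
  and openin_ord_topology_aboveS: "x \<in> Field r \<Longrightarrow> openin (ord_topology r) (aboveS r x)"
  unfolding ord_topology_def by (rule topology_generated_by_Basis, blast)+

text \<open>Cutting off at \<open>x\<close> removes the need for an upper bound: rays to the left contain the whole segment
  \<open>under r x\<close> as soon as they contain \<open>x\<close>.\<close>

lemma ord_topology_left_nbhd:
  assumes r: "Well_order r" and "openin (ord_topology r) U" and "x \<in> U" and "underS r x \<noteq> {}"
  shows "\<exists>b\<in>underS r x. aboveS r b \<inter> under r x \<subseteq> U"
proof -
  have tr: "trans r" and an: "antisym r" and tot: "total_on (Field r) r"
    using r unfolding well_order_on_def linear_order_on_def partial_order_on_def preorder_on_def by auto
  have "generate_topology_on (insert (Field r) (underS r ` Field r \<union> aboveS r ` Field r)) U"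
    using assms(2) unfolding ord_topology_def openin_topology_generated_by_iff .
  then show ?thesis using assms(3,4)
  proof (induction arbitrary: x)
    case Empty
    then show ?case by simp
  next
    case (Int A B)
    from Int.IH(1)[of x] Int.prems obtain a where a: "a \<in> underS r x" "aboveS r a \<inter> under r x \<subseteq> A" by blast
    from Int.IH(2)[of x] Int.prems obtain b where b: "b \<in> underS r x" "aboveS r b \<inter> under r x \<subseteq> B" by blast
    have F: "a \<in> Field r" "b \<in> Field r" using a b by (auto simp: underS_def Field_def)
    have sub: "aboveS r v \<subseteq> aboveS r u" if "(u, v) \<in> r" for u v
      using that transD[OF tr] antisymD[OF an] unfolding aboveS_def by blast
    show ?case
    proof (cases "(a, b) \<in> r")
      case True
      then show ?thesis using sub[OF True] a b by blast
    next
      case False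
      then have "(b, a) \<in> r \<or> a = b" using tot F unfolding total_on_def by blast
      then show ?thesis using sub[of b a] a b by blast
    qed
  next
    case (UN K)
    then obtain A where "A \<in> K" "x \<in> A" by blast
    then show ?case using UN.IH[of A x] UN.prems by blast
  next
    case (Basis s)
    from \<open>underS r x \<noteq> {}\<close> obtain b where b: "b \<in> underS r x" by blast
    from Basis consider "s = Field r" | a where "s = underS r a" | a where "s = aboveS r a" by blast
    then show ?case
    proof cases
      case 1
      then show ?thesis using b by (auto simp: aboveS_def Field_def)
    next
      case 2
      then have "under r x \<subseteq> s"
        using Basis.prems(1) transD[OF tr] antisymD[OF an] unfolding under_def underS_def by blast
      then show ?thesis using b by blast
    next
      case 3
      then have "a \<in> underS r x" using Basis.prems(1) by (auto simp: underS_def aboveS_def)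
      then show ?thesis using 3 by blast
    qed
  qed
qed

lemma clopen_under_ord_topology:
  assumes r: "Well_order r" and x: "x \<in> Field r"
  shows "openin (ord_topology r) (under r x)" "closedin (ord_topology r) (under r x)"
proof -
  have rf: "refl_on (Field r) r" and an: "antisym r" and tr: "trans r" and tot: "total_on (Field r) r" and wf: "wf (r - Id)"
    using r unfolding well_order_on_def linear_order_on_def partial_order_on_def preorder_on_def by auto
  have cmp: "(u, v) \<in> r \<or> (v, u) \<in> r" if "u \<in> Field r" "v \<in> Field r" for u v
    using that tot[unfolded total_on_def] refl_onD[OF rf that(1)] by metis
  have "under r x = Field r - aboveS r x"
  proof (intro equalityI subsetI)
    fix v assume "v \<in> under r x"
    then show "v \<in> Field r - aboveS r x"
      using antisymD[OF an, of v x] unfolding under_def aboveS_def Field_def by blast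
  next
    fix v assume "v \<in> Field r - aboveS r x"
    then show "v \<in> under r x"
      using cmp[of v x] x rf unfolding under_def aboveS_def refl_on_def by blast
  qed
  then show "closedin (ord_topology r) (under r x)"
    using openin_ord_topology_aboveS[OF x] by (metis closedin_diff closedin_topspace topspace_ord_topology)
  show "openin (ord_topology r) (under r x)"
  proof (cases "aboveS r x = {}")
    case True
    then have "under r x = topspace (ord_topology r)" using \<open>under r x = _\<close> by simp
    then show ?thesis using openin_topspace by metis
  next
    case False
    \<comment> \<open>The initial segment up to \<open>x\<close> consists of the elements below the successor of \<open>x\<close>.\<close>
    then obtain z where z: "z \<in> aboveS r x" "\<And>y. (y, z) \<in> r - Id \<Longrightarrow> y \<notin> aboveS r x"
      using wfE_min[OF wf, of _ "aboveS r x"] by blast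
    have zF: "z \<in> Field r" using z(1) by (auto simp: aboveS_def Field_def)
    have "under r x = underS r z"
    proof (intro equalityI subsetI)
      fix v assume v: "v \<in> under r x"
      then have "(v, z) \<in> r" using z(1) transD[OF tr] unfolding under_def aboveS_def by blast
      moreover have "v \<noteq> z" using v z(1) antisymD[OF an, of x z] unfolding under_def aboveS_def by blast
      ultimately show "v \<in> underS r z" unfolding underS_def by blast
    next
      fix v assume v: "v \<in> underS r z"
      then have "v \<in> Field r" "v \<notin> aboveS r x"
        using z(2)[of v] unfolding underS_def Field_def by auto
      then show "v \<in> under r x" using \<open>under r x = _\<close> by blast
    qed
    then show ?thesis using openin_ord_topology_underS[OF zF] by simp
  qed
qed

text \<open>Well-founded induction on the end point of a segment: a member of the cover that contains \<open>x\<close>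
  contains a whole interval from some \<open>b < x\<close> to \<open>x\<close>, and the segment up to \<open>b\<close> is compact by induction.\<close>

lemma compact_space_ord_topology:
  assumes r: "Well_order r" and m: "m \<in> Field r" "\<And>x. x \<in> Field r \<Longrightarrow> (x, m) \<in> r"
  shows "compact_space (ord_topology r)"
proof -
  have rf: "refl_on (Field r) r" and tot: "total_on (Field r) r" and wf: "wf (r - Id)"
    using r unfolding well_order_on_def linear_order_on_def partial_order_on_def preorder_on_def by auto
  have cmp: "(u, v) \<in> r \<or> (v, u) \<in> r" if "u \<in> Field r" "v \<in> Field r" for u v
    using that tot[unfolded total_on_def] refl_onD[OF rf that(1)] by metis
  have "x \<in> Field r \<longrightarrow> compactin (ord_topology r) (under r x)" for x
    using wf
  proof (induction x rule: wf_induct_rule)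
    case (less x)
    show ?case
    proof
      assume x: "x \<in> Field r"
      have xx: "x \<in> under r x" using x rf unfolding refl_on_def under_def by blast
      have top: "under r x \<subseteq> Field r" by (auto simp: under_def Field_def)
      show "compactin (ord_topology r) (under r x)"
        unfolding compactin_def
      proof (intro conjI allI impI)
        show "under r x \<subseteq> topspace (ord_topology r)" using top by simp
        fix \<U> assume U: "Ball \<U> (openin (ord_topology r)) \<and> under r x \<subseteq> \<Union>\<U>"
        then obtain W where W: "W \<in> \<U>" "x \<in> W" using xx by blast
        show "\<exists>\<F>. finite \<F> \<and> \<F> \<subseteq> \<U> \<and> under r x \<subseteq> \<Union>\<F>"
        proof (cases "underS r x = {}")
          case True
          then have "under r x \<subseteq> {x}" by (auto simp: under_def underS_def)
          then show ?thesis using W by (intro exI[of _ "{W}"]) auto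
        next
          case False
          then obtain b where b: "b \<in> underS r x" "aboveS r b \<inter> under r x \<subseteq> W"
            using ord_topology_left_nbhd[OF r _ W(2)] U W(1) by blast
          then have bF: "b \<in> Field r" and bx: "(b, x) \<in> r - Id" by (auto simp: underS_def Field_def)
          have "under r b \<subseteq> under r x"
            using bx r unfolding well_order_on_def linear_order_on_def partial_order_on_def preorder_on_def
            by (auto simp: under_def dest: transD)
          then obtain \<F> where F: "finite \<F>" "\<F> \<subseteq> \<U>" "under r b \<subseteq> \<Union>\<F>"
            using less.IH[OF bx] bF U unfolding compactin_def by (meson order_trans)
          have "under r x \<subseteq> \<Union>(insert W \<F>)"
          proof
            fix y assume y: "y \<in> under r x"
            then have "y \<in> Field r" using top by blast
            then have "(b, y) \<in> r \<and> b \<noteq> y \<or> (y, b) \<in> r"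
              using cmp[OF bF] refl_onD[OF rf bF] by metis
            then show "y \<in> \<Union>(insert W \<F>)"
            proof
              assume "(b, y) \<in> r \<and> b \<noteq> y"
              then have "y \<in> aboveS r b \<inter> under r x" using y unfolding aboveS_def by auto
              then show ?thesis using b(2) by blast
            next
              assume "(y, b) \<in> r"
              then have "y \<in> under r b" unfolding under_def by simp
              then show ?thesis using F(3) by blast
            qed
          qed
          then show ?thesis using F W(1) by (intro exI[of _ "insert W \<F>"]) auto
        qed
      qed
    qed
  qed
  moreover have "under r m = Field r" using m by (auto simp: under_def Field_def)
  ultimately show ?thesis using m(1) unfolding compact_space_def topspace_ord_topology by metis
qed

abbreviation list_less :: "nat list rel" where "list_less \<equiv> lex less_than"

lemma list_less_irrefl: "(xs, xs) \<notin> list_less"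
  by (induction xs) auto

lemma list_less_trans: "(xs, ys) \<in> list_less \<Longrightarrow> (ys, zs) \<in> list_less \<Longrightarrow> (xs, zs) \<in> list_less"
  using lex_transI[of less_than] trans_less_than unfolding trans_def by blast

lemma list_less_length: "(xs, ys) \<in> list_less \<Longrightarrow> length xs = length ys"
  by (auto simp: lex_conv)

lemma list_less_total: "length xs = length ys \<Longrightarrow> (xs, ys) \<in> list_less \<or> xs = ys \<or> (ys, xs) \<in> list_less"
  by (induction xs ys rule: list_induct2) auto

lemma not_list_less_zeros: "(xs, replicate j 0) \<notin> list_less"
proof (induction j arbitrary: xs)
  case (Suc j)
  then show ?case by (cases xs) auto
qed simp

text \<open>For the list of coefficients in the Cantor normal form of an ordinal, the most significant one
  first, this is the exponent of the last term, and hence the Cantor-Bendixson rank of the ordinal.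
  The ordinal zero is isolated, so its list has to get the value zero.\<close>

definition trailing_zeros :: "nat list \<Rightarrow> nat" where
  "trailing_zeros xs = (if set xs \<subseteq> {0} then 0 else length (takeWhile (\<lambda>x. x = 0) (rev xs)))"

lemma trailing_zeros_append:
  assumes "\<not> set vs \<subseteq> {0}"
  shows "trailing_zeros (us @ vs) = trailing_zeros vs"
proof -
  obtain v where "v \<in> set (rev vs)" "v \<noteq> 0" using assms by auto
  then have "takeWhile (\<lambda>x. x = 0) (rev vs @ rev us) = takeWhile (\<lambda>x. x = 0) (rev vs)"
    by (rule takeWhile_append1)
  then show ?thesis using assms unfolding trailing_zeros_def by auto
qed

lemma trailing_zeros_Suc [simp]: "trailing_zeros (us @ Suc c # replicate j 0) = j"
proof -
  have "takeWhile (\<lambda>x. x = 0) (replicate j 0 @ Suc c # rev us) = replicate j 0"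
    by (subst takeWhile_append2) auto
  then show ?thesis unfolding trailing_zeros_def by auto
qed

lemma trailing_zeros_less_length: "\<not> set vs \<subseteq> {0} \<Longrightarrow> trailing_zeros vs < length vs"
proof -
  assume "\<not> set vs \<subseteq> {0}"
  then obtain v where v: "v \<in> set (rev vs)" "v \<noteq> 0" by auto
  then have "takeWhile (\<lambda>x. x = 0) (rev vs) \<noteq> rev vs"
    using set_takeWhileD[of v "\<lambda>x. x = 0" "rev vs"] by metis
  then have "length (takeWhile (\<lambda>x. x = 0) (rev vs)) \<noteq> length (rev vs)"
    by (metis takeWhile_eq_take take_all order_refl)
  then show ?thesis
    using length_takeWhile_le[of "\<lambda>x. x = 0" "rev vs"] unfolding trailing_zeros_def by auto
qed

lemma trailing_zeros_split:
  assumes "\<not> set xs \<subseteq> {0}"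
  obtains us c where "xs = us @ Suc c # replicate (trailing_zeros xs) 0"
proof -
  have "\<exists>x\<in>set xs. x \<noteq> 0" using assms by auto
  then obtain us v vs where xs: "xs = us @ v # vs" "v \<noteq> 0" "\<forall>w\<in>set vs. \<not> w \<noteq> 0"
    by (rule split_list_last_propE)
  obtain c where c: "v = Suc c" using xs(2) not0_implies_Suc by blast
  have "vs = replicate (length vs) 0" using xs(3) by (simp add: replicate_eqI)
  then have "xs = us @ Suc c # replicate (length vs) 0" using xs(1) c by simp
  then show thesis using that trailing_zeros_Suc by metis
qed

text \<open>The ordinals strictly between \<open>\<alpha>\<close> and \<open>\<alpha> + \<omega>^j\<close>, where all exponents in \<open>\<alpha>\<close> are at least \<open>j\<close>, are
  \<open>\<alpha> + \<beta>\<close> with \<open>0 < \<beta> < \<omega>^j\<close>.\<close>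

lemma list_less_between:
  assumes "(us @ c # replicate j 0, xs) \<in> list_less" "(xs, us @ Suc c # replicate j 0) \<in> list_less"
  shows "trailing_zeros xs < j"
proof -
  have "\<exists>vs. xs = us @ c # vs \<and> (replicate j 0, vs) \<in> list_less"
    using assms
  proof (induction us arbitrary: xs)
    case Nil
    then obtain y ys where "xs = y # ys" by (cases xs) auto
    then show ?case using Nil not_list_less_zeros[of ys j] by auto
  next
    case (Cons u us)
    then obtain y ys where xs: "xs = y # ys" by (cases xs) auto
    then have "y = u" "(us @ c # replicate j 0, ys) \<in> list_less" "(ys, us @ Suc c # replicate j 0) \<in> list_less"
      using Cons.prems by auto
    then show ?case using Cons.IH[of ys] xs by auto
  qed
  then obtain vs where vs: "xs = us @ c # vs" "(replicate j 0, vs) \<in> list_less" by blast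
  have len: "length vs = j" using list_less_length[OF vs(2)] by simp
  have "\<not> set vs \<subseteq> {0}"
  proof
    assume "set vs \<subseteq> {0}"
    then have "vs = replicate j 0" using len by (intro replicate_eqI) auto
    then show False using vs(2) list_less_irrefl by simp
  qed
  then show ?thesis
    using trailing_zeros_append[of vs "us @ [c]"] trailing_zeros_less_length[of vs] len vs(1) by simp
qed

text \<open>The ordinals \<open>\<alpha> + \<omega>^j m\<close> are cofinal below \<open>\<alpha> + \<omega>^(j+1)\<close>. The sum of all coefficients serves as a lower
  bound for \<open>m\<close> because it dominates each of them and does not grow when the head of the list is dropped.\<close>

lemma list_less_cofinal:
  assumes "(xs, us @ Suc c # replicate (Suc j) 0) \<in> list_less" "m > sum_list xs"
  shows "(xs, us @ c # m # replicate j 0) \<in> list_less"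
  using assms
proof (induction us arbitrary: xs)
  case Nil
  then obtain y ys where xs: "xs = y # ys" by (cases xs) auto
  have "length ys = Suc j" using list_less_length[OF Nil.prems(1)] xs by simp
  moreover have "y < Suc c"
    using Nil.prems(1) not_list_less_zeros[of ys "Suc j"] unfolding xs append_Nil Cons_in_lex by auto
  ultimately have y: "y < Suc c" "length ys = Suc j" by simp_all
  then obtain z zs where "ys = z # zs" by (cases ys) auto
  then show ?case using xs y Nil.prems(2) by auto
next
  case (Cons u us)
  then obtain y ys where xs: "xs = y # ys" by (cases xs) auto
  then show ?case using Cons.prems Cons.IH[of ys] by auto
qed

lemma dir_image_swap_Cons_iff:
  "(a # x, b # y) \<in> dir_image r (\<lambda>(x, a). a # x) \<longleftrightarrow> ((x, a), (y, b)) \<in> r"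
proof
  assume "((x, a), (y, b)) \<in> r"
  then have "((\<lambda>(x, a). a # x) (x, a), (\<lambda>(x, a). a # x) (y, b)) \<in> dir_image r (\<lambda>(x, a). a # x)"
    unfolding dir_image_def by blast
  then show "(a # x, b # y) \<in> dir_image r (\<lambda>(x, a). a # x)" by simp
qed (auto simp: dir_image_def)

lemma omega_power_eq:
  "omega_power k = {(xs, ys). length xs = k \<and> length ys = k \<and> (xs = ys \<or> (xs, ys) \<in> list_less)}"
proof (induction k)
  case 0
  then show ?case by auto
next
  case (Suc k)
  have F: "x \<in> Field (omega_power k) \<longleftrightarrow> length x = k" for x
    unfolding Suc Field_def by auto
  have "(zs, ws) \<in> omega_power (Suc k) \<longleftrightarrow>
     length zs = Suc k \<and> length ws = Suc k \<and> (zs = ws \<or> (zs, ws) \<in> list_less)" for zs ws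
  proof (cases zs; cases ws)
    fix a x b y assume zs: "zs = a # x" and ws: "ws = b # y"
    have "(zs, ws) \<in> omega_power (Suc k) \<longleftrightarrow> ((x, a), (y, b)) \<in> ord_prod (omega_power k) natLeq"
      unfolding zs ws omega_power.simps by (rule dir_image_swap_Cons_iff)
    also have "\<dots> \<longleftrightarrow> length x = k \<and> length y = k \<and> a \<le> b \<and> (a = b \<longrightarrow> x = y \<or> (x, y) \<in> list_less)"
    proof -
      have "((x, a), (y, b)) \<in> ord_prod (omega_power k) natLeq \<longleftrightarrow>
          x \<in> Field (omega_power k) \<and> y \<in> Field (omega_power k) \<and> a \<le> b \<and> (a = b \<longrightarrow> (x, y) \<in> omega_power k)"
        by (simp add: ord_prod_def natLeq_def)
      moreover have "(x, y) \<in> omega_power k \<longleftrightarrow> length x = k \<and> length y = k \<and> (x = y \<or> (x, y) \<in> list_less)"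
        by (simp add: Suc)
      ultimately show ?thesis using F[of x] F[of y] by metis
    qed
    also have "\<dots> \<longleftrightarrow> length zs = Suc k \<and> length ws = Suc k \<and> (zs = ws \<or> (zs, ws) \<in> list_less)"
      unfolding zs ws by (cases a b rule: linorder_cases) auto
    finally show ?thesis .
  qed (auto simp: dir_image_def)
  then show ?case by auto
qed

text \<open>The top element \<open>\<omega>^k n\<close> gets the leading coefficient \<open>n\<close>. With this convention the order is the
  lexicographic order on lists of length \<open>k + 1\<close>.\<close>

fun ordinal_digits :: "nat \<Rightarrow> nat \<Rightarrow> nat list \<times> nat + nat \<Rightarrow> nat list" where
  "ordinal_digits k n (Inl (xs, i)) = i # xs"
| "ordinal_digits k n (Inr _) = n # replicate k 0"

lemma Field_omega_power: "Field (omega_power k) = {xs. length xs = k}"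
  unfolding omega_power_eq Field_def by auto

lemma Field_omega_power_mult:
  "Field (ord_prod (omega_power k) (natLeq_on n)) = {(xs, i). length xs = k \<and> i < n}" (is "Field ?r = ?S")
proof (intro equalityI subsetI)
  have iff: "((xs, i), (ys, j)) \<in> ?r \<longleftrightarrow> length xs = k \<and> length ys = k \<and> i < n \<and> j < n \<and> i \<le> j \<and>
      (i = j \<longrightarrow> (xs, ys) \<in> omega_power k)" for xs i ys j
    unfolding ord_prod_def Field_omega_power by simp
  {
    fix p assume "p \<in> Field ?r"
    then obtain q where "(p, q) \<in> ?r \<or> (q, p) \<in> ?r" unfolding Field_def by blast
    then show "p \<in> ?S" by (cases p; cases q) (auto simp: iff)
  next
    fix p assume "p \<in> ?S"
    moreover obtain xs i where "p = (xs, i)" by fastforce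
    ultimately have "(p, p) \<in> ?r" using iff[of xs i xs i] omega_power_eq[of k] by auto
    then show "p \<in> Field ?r" by (rule FieldI1)
  }
qed

lemma Field_omega_power_mult_plus_one:
  "Field (omega_power_mult_plus_one k n) = {Inl (xs, i) | xs i. length xs = k \<and> i < n} \<union> {Inr 0}"
proof -
  let ?r = "ord_prod (omega_power k) (natLeq_on n)"
  have "Field (ord_sum ?r (natLeq_on 1)) = Inl ` Field ?r \<union> Inr ` Field (natLeq_on 1)"
  proof (rule subset_antisym)
    show "Field (ord_sum ?r (natLeq_on 1)) \<subseteq> Inl ` Field ?r \<union> Inr ` Field (natLeq_on 1)"
      unfolding ord_sum_def Field_Un dir_image_Field by (auto simp: Field_def)
    show "Inl ` Field ?r \<union> Inr ` Field (natLeq_on 1) \<subseteq> Field (ord_sum ?r (natLeq_on 1))"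
      unfolding ord_sum_def Field_Un dir_image_Field by blast
  qed
  also have "Field (natLeq_on 1) = {0}" by (auto simp: Field_def)
  finally show ?thesis
    unfolding omega_power_mult_plus_one_def Field_omega_power_mult by auto
qed

lemma omega_power_mult_plus_one_iff:
  "(p, q) \<in> omega_power_mult_plus_one k n \<longleftrightarrow>
     p \<in> Field (omega_power_mult_plus_one k n) \<and> q \<in> Field (omega_power_mult_plus_one k n) \<and>
     (p = q \<or> (ordinal_digits k n p, ordinal_digits k n q) \<in> list_less)"
proof -
  show ?thesis
  proof (cases p; cases q)
    fix u v assume p: "p = Inl u" and q: "q = Inl v"
    obtain xs i ys j where uv: "u = (xs, i)" "v = (ys, j)" by fastforce
    have "(p, q) \<in> omega_power_mult_plus_one k n \<longleftrightarrow> (u, v) \<in> ord_prod (omega_power k) (natLeq_on n)"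
    proof -
      have "(Inl u, Inl v) \<in> dir_image r Inl \<longleftrightarrow> (u, v) \<in> r" for r :: "(nat list \<times> nat) rel"
        unfolding dir_image_def by (cases u; cases v) simp
      moreover have "(Inl u, Inl v) \<notin> dir_image s Inr" for s :: "nat rel"
        unfolding dir_image_def by simp
      ultimately show ?thesis
        unfolding p q omega_power_mult_plus_one_def ord_sum_def by simp
    qed
    also have "\<dots> \<longleftrightarrow> length xs = k \<and> length ys = k \<and> i < n \<and> j < n \<and> i \<le> j \<and> (i = j \<longrightarrow> xs = ys \<or> (xs, ys) \<in> list_less)"
      unfolding uv ord_prod_def Field_omega_power by (auto simp: omega_power_eq)
    also have "\<dots> \<longleftrightarrow> length xs = k \<and> i < n \<and> length ys = k \<and> j < n \<and>
        (xs = ys \<and> i = j \<or> (i # xs, j # ys) \<in> list_less)"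
      by (cases i j rule: linorder_cases) auto
    finally show ?thesis
      unfolding Field_omega_power_mult_plus_one p q uv by simp
  next
    fix u b assume p: "p = Inl u" and q: "q = Inr b"
    obtain xs i where u: "u = (xs, i)" by fastforce
    have "Field (natLeq_on 1) = {0}" by (auto simp: Field_def)
    then have "(p, q) \<in> omega_power_mult_plus_one k n \<longleftrightarrow> length xs = k \<and> i < n \<and> b = 0"
      unfolding p q u omega_power_mult_plus_one_def ord_sum_def
      by (auto simp: dir_image_def Field_omega_power_mult simp del: One_nat_def less_one)
    then show ?thesis
      unfolding Field_omega_power_mult_plus_one p q u by auto
  next
    fix a v assume p: "p = Inr a" and q: "q = Inl v"
    obtain ys j where v: "v = (ys, j)" by fastforce
    have "(p, q) \<notin> omega_power_mult_plus_one k n"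
      unfolding p q omega_power_mult_plus_one_def ord_sum_def by (auto simp: dir_image_def)
    then show ?thesis
      unfolding Field_omega_power_mult_plus_one p q v by auto
  next
    fix a b assume p: "p = Inr a" and q: "q = Inr b"
    have "(p, q) \<in> omega_power_mult_plus_one k n \<longleftrightarrow> a = 0 \<and> b = 0"
      unfolding p q omega_power_mult_plus_one_def ord_sum_def by (auto simp: dir_image_def)
    then show ?thesis
      unfolding Field_omega_power_mult_plus_one p q by auto
  qed
qed

lemma ordinal_digits_inj:
  assumes "p \<in> Field (omega_power_mult_plus_one k n)" "q \<in> Field (omega_power_mult_plus_one k n)"
    "ordinal_digits k n p = ordinal_digits k n q"
  shows "p = q"
proof -
  have "(\<exists>xs i. p = Inl (xs, i) \<and> i < n) \<or> p = Inr 0" "(\<exists>xs i. q = Inl (xs, i) \<and> i < n) \<or> q = Inr 0"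
    using assms(1,2) unfolding Field_omega_power_mult_plus_one by auto
  then show ?thesis using assms(3) by auto
qed

lemma ordinal_digits_length:
  "p \<in> Field (omega_power_mult_plus_one k n) \<Longrightarrow> length (ordinal_digits k n p) = Suc k"
  unfolding Field_omega_power_mult_plus_one by auto

text \<open>The lists that occur form an initial segment of the lists of length \<open>k + 1\<close>: anything below
  the top element has a leading coefficient smaller than \<open>n\<close>, since nothing is below the zero list.\<close>

lemma ordinal_digits_downward:
  assumes p: "p \<in> Field (omega_power_mult_plus_one k n)" and less: "(xs, ordinal_digits k n p) \<in> list_less"
  obtains q where "q \<in> Field (omega_power_mult_plus_one k n)" "ordinal_digits k n q = xs"
proof -
  have "length xs = Suc k" using list_less_length[OF less] ordinal_digits_length[OF p] by simp
  then obtain i ys where xs: "xs = i # ys" "length ys = k" by (cases xs) auto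
  have "i < n"
    using p less not_list_less_zeros[of ys k] unfolding xs Field_omega_power_mult_plus_one by auto
  then show thesis
    using that[of "Inl (ys, i)"] xs unfolding Field_omega_power_mult_plus_one by auto
qed

lemma Well_order_omega_power_mult_plus_one: "Well_order (omega_power_mult_plus_one k n)"
proof -
  let ?r = "omega_power_mult_plus_one k n"
  let ?d = "ordinal_digits k n"
  note iff = omega_power_mult_plus_one_iff[of _ _ k n]
  have "refl_on (Field ?r) ?r" unfolding refl_on_def using iff by blast
  moreover have "trans ?r"
    unfolding trans_def
  proof (intro allI impI)
    fix x y z assume "(x, y) \<in> ?r" "(y, z) \<in> ?r"
    then show "(x, z) \<in> ?r"
      unfolding iff[of x y] iff[of y z] iff[of x z] using list_less_trans by blast
  qed
  moreover have "antisym ?r"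
    unfolding antisym_def
  proof (intro allI impI)
    fix x y assume "(x, y) \<in> ?r" "(y, x) \<in> ?r"
    then show "x = y"
      unfolding iff[of x y] iff[of y x] using list_less_trans list_less_irrefl by blast
  qed
  moreover have "total_on (Field ?r) ?r"
    unfolding total_on_def
  proof (intro ballI impI)
    fix x y assume x: "x \<in> Field ?r" and y: "y \<in> Field ?r" and "x \<noteq> y"
    then have "?d x \<noteq> ?d y" using ordinal_digits_inj by blast
    then show "(x, y) \<in> ?r \<or> (y, x) \<in> ?r"
      unfolding iff[of x y] iff[of y x]
      using x y list_less_total[of "?d x" "?d y"] ordinal_digits_length[OF x] ordinal_digits_length[OF y] by auto
  qed
  moreover have "wf (?r - Id)"
  proof (rule wf_subset)
    show "wf (inv_image list_less ?d)" by (intro wf_inv_image wf_lex wf_less_than)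
    show "?r - Id \<subseteq> inv_image list_less ?d"
      using iff by (auto simp: inv_image_def)
  qed
  moreover have "?r \<subseteq> Field ?r \<times> Field ?r" by (auto simp: Field_def)
  ultimately show ?thesis
    unfolding well_order_on_def linear_order_on_def partial_order_on_def preorder_on_def by auto
qed

text \<open>A nonzero ordinal has the form \<open>\<alpha> + \<omega>^j\<close> with all exponents in \<open>\<alpha>\<close> at least \<open>j\<close>. The other ordinals in
  the interval from \<open>\<alpha>\<close> (exclusive) to \<open>\<alpha> + \<omega>^j\<close> have smaller ranks, and if \<open>j > 0\<close> then the ordinals
  \<open>\<alpha> + \<omega>^(j-1) m\<close> of rank \<open>j - 1\<close> converge to \<open>\<alpha> + \<omega>^j\<close>.\<close>

theorem ranked_space_ordinal:
  "ranked_space (ord_topology (omega_power_mult_plus_one k n)) (\<lambda>p. trailing_zeros (ordinal_digits k n p))"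
proof -
  let ?r = "omega_power_mult_plus_one k n"
  let ?d = "ordinal_digits k n"
  let ?X = "ord_topology ?r"
  note iff = omega_power_mult_plus_one_iff[of _ _ k n]
  note wo = Well_order_omega_power_mult_plus_one[of k n]
  have top: "Inr 0 \<in> Field ?r" unfolding Field_omega_power_mult_plus_one by simp
  have le_top: "(p, Inr 0) \<in> ?r" if p: "p \<in> Field ?r" for p
    using p unfolding iff[of p "Inr 0"] Field_omega_power_mult_plus_one by auto
  have refl: "p \<in> under ?r p" if "p \<in> Field ?r" for p
    using that iff[of p p] unfolding under_def by simp
  have below: "\<exists>b\<in>Field ?r. ?d b = us @ c # vs \<and> (b, p) \<in> ?r \<and> b \<noteq> p"
    if p: "p \<in> Field ?r" "?d p = us @ Suc c # replicate j 0" and "length vs = j" for p us c vs j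
  proof -
    have less: "(us @ c # vs, ?d p) \<in> list_less"
      unfolding p(2) using that(3) by (induction us) auto
    then obtain b where "b \<in> Field ?r" "?d b = us @ c # vs"
      using ordinal_digits_downward[OF p(1)] by metis
    then show ?thesis using less p list_less_irrefl iff[of b p] by auto
  qed
  show ?thesis
    unfolding ranked_space_def topspace_ord_topology
  proof (intro conjI ballI allI impI)
    show "compact_space ?X" using compact_space_ord_topology[OF wo top le_top] .
    show "countable (Field ?r)" by simp
    fix x
    {
      fix y assume x: "x \<in> Field ?r" and y: "y \<in> Field ?r" and "x \<noteq> y"
      have cl: "openin ?X (Field ?r - under ?r z)" "closedin ?X (Field ?r - under ?r z)" if "z \<in> Field ?r" for z
        using clopen_under_ord_topology[OF wo that] openin_diff[OF openin_topspace] closedin_diff[OF closedin_topspace]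
        by (metis topspace_ord_topology)+
      have "y \<notin> under ?r x \<or> x \<notin> under ?r y"
        using wo \<open>x \<noteq> y\<close> unfolding under_def well_order_on_def linear_order_on_def partial_order_on_def antisym_def by blast
      then show "\<exists>V. openin ?X V \<and> closedin ?X V \<and> x \<in> V \<and> y \<notin> V"
      proof
        assume "y \<notin> under ?r x"
        then show ?thesis using clopen_under_ord_topology[OF wo x] refl[OF x] by blast
      next
        assume "x \<notin> under ?r y"
        then show ?thesis using cl[OF y] refl[OF y] x by blast
      qed
    next
      assume x: "x \<in> Field ?r"
      show "\<exists>U. openin ?X U \<and> x \<in> U \<and> (\<forall>y\<in>U. y \<noteq> x \<longrightarrow> trailing_zeros (?d y) < trailing_zeros (?d x))"
      proof (cases "set (?d x) \<subseteq> {0}")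
        case True
        then have "?d x = replicate (Suc k) 0"
          using ordinal_digits_length[OF x] by (metis (no_types) replicate_eqI singletonD subsetD)
        then have "under ?r x \<subseteq> {x}"
          using iff[of _ x] not_list_less_zeros[of _ "Suc k"] unfolding under_def by fastforce
        then show ?thesis using clopen_under_ord_topology(1)[OF wo x] refl[OF x] by blast
      next
        case False
        then obtain us c where d: "?d x = us @ Suc c # replicate (trailing_zeros (?d x)) 0"
          by (rule trailing_zeros_split)
        define j where "j = trailing_zeros (?d x)"
        have dx: "?d x = us @ Suc c # replicate j 0" using d unfolding j_def .
        obtain b where b: "b \<in> Field ?r" "?d b = us @ c # replicate j 0" "(b, x) \<in> ?r" "b \<noteq> x"
          using below[OF x dx, of "replicate j 0"] by auto
        have "trailing_zeros (?d y) < j" if y: "y \<in> aboveS ?r b \<inter> under ?r x" "y \<noteq> x" for y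
        proof (rule list_less_between)
          show "(us @ c # replicate j 0, ?d y) \<in> list_less"
            using y iff[of b y] b(2) unfolding aboveS_def by auto
          show "(?d y, us @ Suc c # replicate j 0) \<in> list_less"
            using y iff[of y x] dx unfolding under_def by auto
        qed
        moreover have "openin ?X (aboveS ?r b \<inter> under ?r x)"
          using openin_ord_topology_aboveS[OF b(1)] clopen_under_ord_topology(1)[OF wo x] by blast
        moreover have "x \<in> aboveS ?r b \<inter> under ?r x"
          using b refl[OF x] unfolding aboveS_def by blast
        ultimately show ?thesis using j_def by blast
      qed
    next
      fix U assume U: "openin ?X U" "x \<in> U" and pos: "0 < trailing_zeros (?d x)"
      then have x: "x \<in> Field ?r" using openin_subset by fastforce
      have "\<not> set (?d x) \<subseteq> {0}" using pos unfolding trailing_zeros_def by (auto split: if_splits)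
      then obtain us c where d: "?d x = us @ Suc c # replicate (trailing_zeros (?d x)) 0"
        by (rule trailing_zeros_split)
      obtain j where j: "trailing_zeros (?d x) = Suc j" using pos gr0_implies_Suc by blast
      have dx: "?d x = us @ Suc c # replicate (Suc j) 0" using d unfolding j .
      have "underS ?r x \<noteq> {}" using below[OF x dx, of "replicate (Suc j) 0"] unfolding underS_def by auto
      then obtain b where b: "b \<in> underS ?r x" "aboveS ?r b \<inter> under ?r x \<subseteq> U"
        using ord_topology_left_nbhd[OF wo U] by blast
      then have b': "b \<in> Field ?r" "(?d b, ?d x) \<in> list_less"
        using iff[of b x] unfolding underS_def by auto
      define m where "m = sum_list (?d b)"
      obtain y where y: "y \<in> Field ?r" "?d y = us @ c # Suc m # replicate j 0" "(y, x) \<in> ?r" "y \<noteq> x"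
        using below[OF x dx, of "Suc m # replicate j 0"] by auto
      have "(?d b, ?d y) \<in> list_less"
        unfolding y(2) using list_less_cofinal[of "?d b" us c j "Suc m"] b'(2) dx m_def by simp
      then have "y \<in> aboveS ?r b"
        using iff[of b y] b'(1) y(1) list_less_irrefl unfolding aboveS_def by auto
      then have "y \<in> U" using b(2) y(3) unfolding under_def by blast
      moreover have "Suc (trailing_zeros (?d y)) = trailing_zeros (?d x)"
        using trailing_zeros_Suc[of "us @ [c]" m j] y(2) j by simp
      ultimately show "\<exists>y\<in>U. Suc (trailing_zeros (?d y)) = trailing_zeros (?d x)" by blast
    }
  qed
qed

lemma ordinal_rank_le:
  assumes "p \<in> Field (omega_power_mult_plus_one k n)"
  shows "trailing_zeros (ordinal_digits k n p) \<le> k"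
proof (cases "set (ordinal_digits k n p) \<subseteq> {0}")
  case False
  then show ?thesis using trailing_zeros_less_length ordinal_digits_length[OF assms] by fastforce
qed (simp add: trailing_zeros_def)

text \<open>These are the ordinals \<open>\<omega>^k c\<close> with \<open>0 < c \<le> n\<close>. For \<open>k = 0\<close> the ordinal zero would count as well.\<close>

lemma card_ordinal_top_rank:
  assumes "k > 0" "n > 0"
  shows "card {p \<in> Field (omega_power_mult_plus_one k n). trailing_zeros (ordinal_digits k n p) = k} = n"
proof -
  let ?r = "omega_power_mult_plus_one k n"
  let ?d = "ordinal_digits k n"
  have "bij_betw ?d {p \<in> Field ?r. trailing_zeros (?d p) = k} ((\<lambda>c. Suc c # replicate k 0) ` {..<n})"
  proof (rule bij_betw_imageI)
    show "inj_on ?d {p \<in> Field ?r. trailing_zeros (?d p) = k}"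
      using ordinal_digits_inj by (intro inj_onI) blast
    show "?d ` {p \<in> Field ?r. trailing_zeros (?d p) = k} = (\<lambda>c. Suc c # replicate k 0) ` {..<n}"
    proof (intro equalityI subsetI)
      fix xs assume "xs \<in> ?d ` {p \<in> Field ?r. trailing_zeros (?d p) = k}"
      then obtain p where p: "p \<in> Field ?r" "trailing_zeros (?d p) = k" "xs = ?d p" by blast
      then have "\<not> set xs \<subseteq> {0}" using assms(1) unfolding trailing_zeros_def by (auto split: if_splits)
      then obtain us c where xs: "xs = us @ Suc c # replicate k 0"
        using p(2,3) trailing_zeros_split by metis
      then have "us = []" using ordinal_digits_length[OF p(1)] p(3) by simp
      then have "xs = Suc c # replicate k 0" using xs by simp
      moreover have "c < n"
        using p(1,3) calculation unfolding Field_omega_power_mult_plus_one by auto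
      ultimately show "xs \<in> (\<lambda>c. Suc c # replicate k 0) ` {..<n}" by blast
    next
      fix xs :: "nat list" assume "xs \<in> (\<lambda>c. Suc c # replicate k 0) ` {..<n}"
      then obtain c where c: "xs = Suc c # replicate k 0" "c < n" by blast
      have "\<exists>p\<in>Field ?r. ?d p = xs"
      proof (cases "Suc c = n")
        case True
        then show ?thesis using c unfolding Field_omega_power_mult_plus_one by auto
      next
        case False
        then have "Inl (replicate k 0, Suc c) \<in> Field ?r"
          using c unfolding Field_omega_power_mult_plus_one by auto
        then show ?thesis using c by force
      qed
      moreover have "trailing_zeros xs = k" using trailing_zeros_Suc[of "[]" c k] c by simp
      ultimately show "xs \<in> ?d ` {p \<in> Field ?r. trailing_zeros (?d p) = k}" by blast
    qed
  qed
  then have "card {p \<in> Field ?r. trailing_zeros (?d p) = k} = card ((\<lambda>c. Suc c # replicate k 0) ` {..<n})"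
    by (rule bij_betw_same_card)
  also have "\<dots> = n" by (subst card_image) (auto intro: inj_onI)
  finally show ?thesis .
qed

section \<open>Products and indices of subgroups\<close>

context group begin

lemma set_mult_normal_subgroup:
  assumes H: "subgroup H G" and N: "N \<lhd> G"
  shows "subgroup (H <#> N) G"
proof -
  have NG: "subgroup N G" using N by (rule normal_imp_subgroup)
  note Hc = subgroup.mem_carrier[OF H] and Nc = subgroup.mem_carrier[OF NG]
  show ?thesis
  proof (rule subgroupI)
    show "H <#> N \<subseteq> carrier G" using Hc Nc unfolding set_mult_def by blast
    have "\<one> \<otimes> \<one> \<in> H <#> N"
      using subgroup.one_closed[OF H] subgroup.one_closed[OF NG] unfolding set_mult_def by blast
    then show "H <#> N \<noteq> {}" by blast
    fix a assume "a \<in> H <#> N"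
    then obtain h n where a: "a = h \<otimes> n" "h \<in> H" "n \<in> N" unfolding set_mult_def by blast
    have "inv a = inv h \<otimes> (h \<otimes> inv n \<otimes> inv h)"
      using a Hc Nc by (simp add: inv_mult_group m_assoc[symmetric])
    moreover have "h \<otimes> inv n \<otimes> inv h \<in> N"
      using normal.inv_op_closed2[OF N Hc[OF a(2)] subgroup.m_inv_closed[OF NG a(3)]] .
    ultimately show "inv a \<in> H <#> N"
      using subgroup.m_inv_closed[OF H a(2)] unfolding set_mult_def by blast
    fix b assume "b \<in> H <#> N"
    then obtain h' n' where b: "b = h' \<otimes> n'" "h' \<in> H" "n' \<in> N" unfolding set_mult_def by blast
    have "a \<otimes> b = (h \<otimes> h') \<otimes> ((inv h' \<otimes> n \<otimes> h') \<otimes> n')"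
      using a b Hc[OF a(2)] Hc[OF b(2)] Nc[OF a(3)] Nc[OF b(3)]
      by (simp add: m_assoc inv_solve_left') (simp add: m_assoc[symmetric])
    moreover have "(inv h' \<otimes> n \<otimes> h') \<otimes> n' \<in> N"
      using subgroup.m_closed[OF NG normal.inv_op_closed1[OF N Hc[OF b(2)] a(3)] b(3)] .
    ultimately show "a \<otimes> b \<in> H <#> N"
      using subgroup.m_closed[OF H a(2) b(2)] unfolding set_mult_def by blast
  qed
qed

lemma subset_set_mult_left: "H \<subseteq> carrier G \<Longrightarrow> \<one> \<in> K \<Longrightarrow> H \<subseteq> H <#> K"
  unfolding set_mult_def by (force intro: r_one[symmetric])

lemma subset_set_mult_right: "K \<subseteq> carrier G \<Longrightarrow> \<one> \<in> H \<Longrightarrow> K \<subseteq> H <#> K"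
  unfolding set_mult_def by (force intro: l_one[symmetric])

lemma set_mult_absorb:
  assumes "subgroup K G" "\<one> \<in> H" "H \<subseteq> K"
  shows "H <#> K = K"
proof
  show "H <#> K \<subseteq> K" using assms(3) subgroup.m_closed[OF assms(1)] unfolding set_mult_def by blast
  show "K \<subseteq> H <#> K" by (rule subset_set_mult_right) (use assms subgroup.subset in blast)+
qed

lemma set_mult_absorb_right:
  assumes "subgroup K G" "\<one> \<in> H" "H \<subseteq> K"
  shows "K <#> H = K"
proof
  show "K <#> H \<subseteq> K" using assms(3) subgroup.m_closed[OF assms(1)] unfolding set_mult_def by blast
  show "K \<subseteq> K <#> H" by (rule subset_set_mult_left) (use assms subgroup.subset in blast)+
qed

text \<open>With a representative \<open>g\<close> for each coset of \<open>K\<close>, every coset of \<open>H\<close> is the translate by exactly one \<open>g\<close> of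
  a coset of \<open>H\<close> in \<open>K\<close>.\<close>

lemma index_eq_index_times:
  assumes H: "subgroup H G" and K: "subgroup K G" and "H \<subseteq> K"
  shows "card (rcosets H) = card (rcosets K) * card ((\<lambda>k. H #> k) ` K)"
proof -
  have Kc: "\<And>k. k \<in> K \<Longrightarrow> k \<in> carrier G" and Hc: "H \<subseteq> carrier G"
    using subgroup.mem_carrier[OF K] subgroup.subset[OF H] by auto
  have "\<exists>g. g \<in> carrier G \<and> C = K #> g" if "C \<in> rcosets K" for C
    using that unfolding RCOSETS_def by blast
  then obtain g where g: "\<And>C. C \<in> rcosets K \<Longrightarrow> g C \<in> carrier G \<and> C = K #> g C" by metis
  let ?F = "\<lambda>(C, D). D #> g C"
  have "bij_betw ?F ((rcosets K) \<times> ((\<lambda>k. H #> k) ` K)) (rcosets H)"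
  proof (rule bij_betw_imageI)
    show "inj_on ?F ((rcosets K) \<times> ((\<lambda>k. H #> k) ` K))"
    proof (rule inj_onI, clarify)
      fix C C' k k'
      assume C: "C \<in> rcosets K" "C' \<in> rcosets K" and k: "k \<in> K" "k' \<in> K"
        and eq: "(H #> k) #> g C = (H #> k') #> g C'"
      have gC: "g C \<in> carrier G" "g C' \<in> carrier G" using g C by auto
      have "k \<otimes> g C \<in> H #> (k \<otimes> g C)"
        using rcos_self[OF _ H] k gC Kc by blast
      then have "k \<otimes> g C \<in> H #> (k' \<otimes> g C')"
        using eq coset_mult_assoc[OF Hc] k gC Kc by metis
      then obtain h where h: "h \<in> H" "k \<otimes> g C = h \<otimes> (k' \<otimes> g C')" unfolding r_coset_def by blast
      have hc: "h \<in> carrier G" "h \<in> K" using h(1) Hc \<open>H \<subseteq> K\<close> by auto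
      have "g C = inv k \<otimes> (k \<otimes> g C)" using k Kc gC by (simp add: m_assoc[symmetric])
      also have "\<dots> = (inv k \<otimes> (h \<otimes> k')) \<otimes> g C'" using h hc k Kc gC by (simp add: m_assoc)
      finally have "g C \<in> K #> g C'"
        using subgroup.m_closed[OF K subgroup.m_inv_closed[OF K k(1)] subgroup.m_closed[OF K hc(2) k(2)]]
        unfolding r_coset_def by blast
      then have "K #> g C' = K #> g C" by (rule repr_independence[OF _ gC(2) K])
      then have CC: "C = C'" using g C by metis
      have "(H #> k) #> g C #> inv g C = (H #> k') #> g C #> inv g C" using eq CC by simp
      then have "H #> k = H #> k'"
        using coset_mult_assoc[OF r_coset_subset_G[OF Hc]] k Kc gC(1) r_coset_subset_G[OF Hc] by simp
      with CC show "C = C' \<and> H #> k = H #> k'" ..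
    qed
    show "?F ` ((rcosets K) \<times> ((\<lambda>k. H #> k) ` K)) = rcosets H"
    proof (intro equalityI subsetI)
      fix D assume "D \<in> ?F ` ((rcosets K) \<times> ((\<lambda>k. H #> k) ` K))"
      then obtain C k where "C \<in> rcosets K" "k \<in> K" "D = (H #> k) #> g C" by blast
      then have "D = H #> (k \<otimes> g C)" "k \<otimes> g C \<in> carrier G"
        using g Kc coset_mult_assoc[OF Hc] by auto
      then show "D \<in> rcosets H" unfolding RCOSETS_def by blast
    next
      fix D assume "D \<in> rcosets H"
      then obtain x where x: "x \<in> carrier G" "D = H #> x" unfolding RCOSETS_def by blast
      let ?C = "K #> x"
      have C: "?C \<in> rcosets K" using x unfolding RCOSETS_def by blast
      have "x \<in> K #> g ?C" using g[OF C] rcos_self[OF x(1) K] by metis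
      then obtain k where k: "k \<in> K" "x = k \<otimes> g ?C" unfolding r_coset_def by blast
      have "D = (H #> k) #> g ?C"
        using x(2) k Kc g[OF C] coset_mult_assoc[OF Hc] by metis
      then show "D \<in> ?F ` ((rcosets K) \<times> ((\<lambda>k. H #> k) ` K))" using C k(1) by force
    qed
  qed
  then have "card (rcosets H) = card ((rcosets K) \<times> ((\<lambda>k. H #> k) ` K))"
    by (rule bij_betw_same_card[symmetric])
  then show ?thesis by (simp add: card_cartesian_product)
qed

lemma nat_pow_mem_subgroup:
  fixes n :: nat
  assumes "subgroup H G" "x \<in> H"
  shows "x [^] n \<in> H"
  using subgroup.m_closed[OF assms(1)] subgroup.one_closed[OF assms(1)] assms(2) by (induction n) auto

text \<open>Bezout's identity.\<close>

lemma pow_gcd_mem_subgroup: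
  fixes m n :: nat
  assumes H: "subgroup H G" and a: "a \<in> carrier G" "a [^] n \<in> H" "a [^] m \<in> H" and "n > 0"
  shows "a [^] gcd n m \<in> H"
proof -
  obtain s t where st: "n * s = m * t + gcd n m" using bezout_nat[of n m] \<open>n > 0\<close> by auto
  have 1: "a [^] (n * s) \<in> H" "a [^] (m * t) \<in> H"
    using nat_pow_mem_subgroup[OF H] a by (simp_all add: nat_pow_pow[symmetric])
  have "a [^] (n * s) = a [^] (m * t) \<otimes> a [^] gcd n m" using a(1) st by (simp add: nat_pow_mult)
  then have "a [^] gcd n m = inv (a [^] (m * t)) \<otimes> a [^] (n * s)"
    using a(1) by (simp add: m_assoc[symmetric])
  then show ?thesis using 1 subgroup.m_closed[OF H subgroup.m_inv_closed[OF H]] by simp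
qed

end

section \<open>Profinite groups\<close>

context topological_group begin

lemma continuous_map_mult:
  assumes "continuous_map X T f" "continuous_map X T g"
  shows "continuous_map X T (\<lambda>x. f x \<otimes> g x)"
proof -
  have "continuous_map X (prod_topology T T) (\<lambda>x. (f x, g x))"
    using assms by (simp add: continuous_map_pairedI)
  from continuous_map_compose[OF this continuous_mult] show ?thesis by (simp add: o_def)
qed

lemma continuous_map_const_carrier: "c \<in> carrier G \<Longrightarrow> continuous_map X T (\<lambda>_. c)"
  using topspace_eq by simp

lemma continuous_map_left_mult: "c \<in> carrier G \<Longrightarrow> continuous_map T T (\<lambda>x. c \<otimes> x)"
  by (intro continuous_map_mult continuous_map_const_carrier continuous_map_id[unfolded id_def])

lemma continuous_map_right_mult: "c \<in> carrier G \<Longrightarrow> continuous_map T T (\<lambda>x. x \<otimes> c)"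
  by (intro continuous_map_mult continuous_map_const_carrier continuous_map_id[unfolded id_def])

lemma continuous_map_pow: "continuous_map T T (\<lambda>x. x [^] (n::nat))"
proof (induction n)
  case 0
  then show ?case by (simp add: topspace_eq)
next
  case (Suc n)
  then show ?case using continuous_map_mult[OF Suc continuous_map_id[unfolded id_def]] by simp
qed

lemma openin_left_translate:
  assumes "openin T U" "c \<in> carrier G"
  shows "openin T {x \<in> carrier G. c \<otimes> x \<in> U}"
  using openin_continuous_map_preimage[OF continuous_map_left_mult[OF assms(2)] assms(1)] topspace_eq by simp

lemma openin_right_translate:
  assumes "openin T U" "c \<in> carrier G"
  shows "openin T {x \<in> carrier G. x \<otimes> c \<in> U}"
  using openin_continuous_map_preimage[OF continuous_map_right_mult[OF assms(2)] assms(1)] topspace_eq by simp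

lemma closedin_right_translate:
  assumes "closedin T U" "c \<in> carrier G"
  shows "closedin T {x \<in> carrier G. x \<otimes> c \<in> U}"
  using closedin_continuous_map_preimage[OF continuous_map_right_mult[OF assms(2)] assms(1)] topspace_eq by simp

lemma closedin_left_translate:
  assumes "closedin T U" "c \<in> carrier G"
  shows "closedin T {x \<in> carrier G. c \<otimes> x \<in> U}"
  using closedin_continuous_map_preimage[OF continuous_map_left_mult[OF assms(2)] assms(1)] topspace_eq by simp

lemma openin_subgroupI:
  assumes H: "subgroup H G" and V: "openin T V" "\<one> \<in> V" "V \<subseteq> H"
  shows "openin T H"
proof (subst openin_subopen, intro ballI)
  fix h assume h: "h \<in> H"
  have hc: "h \<in> carrier G" using subgroup.mem_carrier[OF H h] .
  let ?W = "{x \<in> carrier G. inv h \<otimes> x \<in> V}"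
  have "openin T ?W" using openin_left_translate[OF V(1)] hc by simp
  moreover have "h \<in> ?W" using hc V(2) by simp
  moreover have "?W \<subseteq> H"
  proof
    fix x assume x: "x \<in> ?W"
    then have "h \<otimes> (inv h \<otimes> x) \<in> H" using V(3) subgroup.m_closed[OF H h] by blast
    then show "x \<in> H" using x hc by (simp add: m_assoc[symmetric])
  qed
  ultimately show "\<exists>W. openin T W \<and> h \<in> W \<and> W \<subseteq> H" by blast
qed

lemma rcoset_eq_preimage:
  assumes H: "subgroup H G" and g: "g \<in> carrier G"
  shows "H #> g = {x \<in> carrier G. x \<otimes> inv g \<in> H}"
proof (intro equalityI subsetI)
  fix x assume "x \<in> H #> g"
  then obtain h where h: "h \<in> H" "x = h \<otimes> g" unfolding r_coset_def by blast
  then show "x \<in> {x \<in> carrier G. x \<otimes> inv g \<in> H}"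
    using g subgroup.mem_carrier[OF H h(1)] by (simp add: m_assoc)
next
  fix x assume x: "x \<in> {x \<in> carrier G. x \<otimes> inv g \<in> H}"
  then have "x = (x \<otimes> inv g) \<otimes> g" using g by (simp add: m_assoc)
  then show "x \<in> H #> g" using x unfolding r_coset_def by blast
qed

lemma openin_rcoset:
  assumes "subgroup H G" "openin T H" "g \<in> carrier G"
  shows "openin T (H #> g)"
  unfolding rcoset_eq_preimage[OF assms(1,3)] using openin_right_translate[OF assms(2)] assms(3) by simp

lemma closedin_rcoset:
  assumes "subgroup H G" "closedin T H" "g \<in> carrier G"
  shows "closedin T (H #> g)"
  unfolding rcoset_eq_preimage[OF assms(1,3)] using closedin_right_translate[OF assms(2)] assms(3) by simp

lemma open_subgroup_closedin:
  assumes H: "subgroup H G" "openin T H"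
  shows "closedin T H"
proof -
  have "H = carrier G - \<Union>{C \<in> rcosets H. C \<noteq> H}"
  proof (intro equalityI subsetI)
    fix x assume x: "x \<in> H"
    have "x \<notin> C" if "C \<in> rcosets H" "C \<noteq> H" for C
      using rcos_disjoint[OF H(1)] subgroup.subgroup_in_rcosets[OF H(1) is_group] that x
      unfolding pairwise_def disjnt_def by blast
    then show "x \<in> carrier G - \<Union>{C \<in> rcosets H. C \<noteq> H}" using subgroup.mem_carrier[OF H(1) x] by blast
  next
    fix x assume x: "x \<in> carrier G - \<Union>{C \<in> rcosets H. C \<noteq> H}"
    then have "H #> x \<in> rcosets H" "x \<in> H #> x"
      using rcosetsI[OF subgroup.subset[OF H(1)]] rcos_self[OF _ H(1)] by auto
    then show "x \<in> H" using x by blast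
  qed
  moreover have "openin T (\<Union>{C \<in> rcosets H. C \<noteq> H})"
    using openin_rcoset[OF H] by (intro openin_Union) (auto simp: RCOSETS_def)
  ultimately show ?thesis by (metis closedin_diff closedin_topspace topspace_eq)
qed

lemma closed_subgroups_subgroup: "H \<in> closed_subgroups G T \<Longrightarrow> subgroup H G"
  and closed_subgroups_closedin: "H \<in> closed_subgroups G T \<Longrightarrow> closedin T H"
  unfolding closed_subgroups_def by auto

lemma open_normal_normal: "N \<in> open_normal_subgroups G T \<Longrightarrow> N \<lhd> G"
  and open_normal_subgroup: "N \<in> open_normal_subgroups G T \<Longrightarrow> subgroup N G"
  and open_normal_openin: "N \<in> open_normal_subgroups G T \<Longrightarrow> openin T N"
  unfolding open_normal_subgroups_def using normal_imp_subgroup by auto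

lemma open_normal_closed_subgroup: "N \<in> open_normal_subgroups G T \<Longrightarrow> N \<in> closed_subgroups G T"
  using open_normal_subgroup open_normal_openin open_subgroup_closedin unfolding closed_subgroups_def by blast

lemma closed_subgroups_Inter:
  assumes "\<H> \<subseteq> closed_subgroups G T" "\<H> \<noteq> {}"
  shows "\<Inter>\<H> \<in> closed_subgroups G T"
  using assms subgroups_Inter[of \<H>] closedin_Inter[of \<H> T] unfolding closed_subgroups_def by blast

lemma open_normal_Inter:
  assumes "finite \<N>" "\<N> \<noteq> {}" "\<N> \<subseteq> open_normal_subgroups G T"
  shows "\<Inter>\<N> \<in> open_normal_subgroups G T"
  using assms
proof (induction rule: finite_ne_induct)
  case (insert N F)
  then have "N \<in> open_normal_subgroups G T" "\<Inter>F \<in> open_normal_subgroups G T" by auto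
  then have "N \<inter> \<Inter>F \<lhd> G" "openin T (N \<inter> \<Inter>F)"
    using normal_subgroup_intersect unfolding open_normal_subgroups_def by auto
  then show ?case unfolding open_normal_subgroups_def by simp
qed auto

lemma set_mult_open_normal:
  assumes H: "subgroup H G" and N: "N \<in> open_normal_subgroups G T"
  shows "subgroup (H <#> N) G" "openin T (H <#> N)" "H \<subseteq> H <#> N" "N \<subseteq> H <#> N"
proof -
  show 1: "subgroup (H <#> N) G" by (rule set_mult_normal_subgroup[OF H open_normal_normal[OF N]])
  show "H \<subseteq> H <#> N"
    by (rule subset_set_mult_left) (use H open_normal_subgroup[OF N] subgroup.subset subgroup.one_closed in blast)+
  show 2: "N \<subseteq> H <#> N"
    by (rule subset_set_mult_right) (use H open_normal_subgroup[OF N] subgroup.subset subgroup.one_closed in blast)+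
  show "openin T (H <#> N)"
    by (rule openin_subgroupI[OF 1 open_normal_openin[OF N] subgroup.one_closed[OF open_normal_subgroup[OF N]] 2])
qed

end

context profinite_group begin

lemma clopen_separation:
  assumes "x \<in> carrier G" "y \<in> carrier G" "x \<noteq> y"
  obtains U where "openin T U" "closedin T U" "x \<in> U" "y \<notin> U"
proof -
  have "quasi_component_of T x = connected_component_of T x"
    by (rule quasi_eq_connected_component_of) (use compact Hausdorff in blast)
  moreover have "\<not> connected_component_of T x y"
    using totally_disconnected[of x] assms topspace_eq by auto
  ultimately have "\<not> quasi_component_of T x y" by simp
  then obtain U where U: "closedin T U" "openin T U" "x \<in> U \<longleftrightarrow> y \<notin> U"
    using assms topspace_eq unfolding quasi_component_of_def by auto
  show thesis
  proof (cases "x \<in> U")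
    case True
    then show ?thesis using that U by blast
  next
    case False
    then show ?thesis
      using that[of "topspace T - U"] U assms topspace_eq openin_diff[OF openin_topspace U(1)]
        closedin_diff[OF closedin_topspace U(2)] by blast
  qed
qed

text \<open>In a compact Hausdorff space components are quasi-components, so \<open>U\<close> contains a clopen
  neighbourhood \<open>V\<close> of the identity. The elements that can be inserted into any product of two elements
  without changing its membership in \<open>V\<close> form a normal subgroup contained in \<open>V\<close>. It is open by the tube
  lemma, because \<open>G \<times> G\<close> is compact.\<close>

lemma open_normal_base:
  assumes U: "openin T U" "\<one> \<in> U"
  obtains N where "N \<in> open_normal_subgroups G T" "N \<subseteq> U"
proof -
  obtain V where V: "openin T V" "closedin T V" "\<one> \<in> V" "V \<subseteq> U"
  proof (rule compact_space_clopen_base[OF compact _ U])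
    fix y assume "y \<in> topspace T" "y \<noteq> \<one>"
    then show "\<exists>V. openin T V \<and> closedin T V \<and> y \<in> V \<and> \<one> \<notin> V"
      using clopen_separation[of y \<one>] topspace_eq one_closed by metis
  qed
  define f where "f = (\<lambda>p. fst (fst p) \<otimes> snd p \<otimes> snd (fst p))"
  define e where "e = (\<lambda>p :: ('a \<times> 'a) \<times> 'a. fst (fst p) \<otimes> snd (fst p))"
  let ?P = "prod_topology (prod_topology T T) T"
  have fst_fst: "continuous_map ?P T (\<lambda>p. fst (fst p))"
    using continuous_map_fst_of[OF continuous_map_fst] by (simp add: o_def)
  have snd_fst: "continuous_map ?P T (\<lambda>p. snd (fst p))"
    using continuous_map_snd_of[OF continuous_map_fst] by (simp add: o_def)
  have cf: "continuous_map ?P T f"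
    unfolding f_def by (intro continuous_map_mult fst_fst snd_fst continuous_map_snd)
  have ce: "continuous_map ?P T e"
    unfolding e_def by (intro continuous_map_mult fst_fst snd_fst)
  let ?V' = "topspace T - V"
  have V': "openin T ?V'" using V(2) by blast
  define W where "W = ({p \<in> topspace ?P. f p \<in> V} \<inter> {p \<in> topspace ?P. e p \<in> V}) \<union>
    ({p \<in> topspace ?P. f p \<in> ?V'} \<inter> {p \<in> topspace ?P. e p \<in> ?V'})"
  have "openin ?P W"
    unfolding W_def
    by (intro openin_Un openin_Int openin_continuous_map_preimage[OF cf] openin_continuous_map_preimage[OF ce] V(1) V')
  moreover have "compactin (prod_topology T T) (topspace (prod_topology T T))"
    using compact compact_space_prod_topology[of T T] unfolding compact_space_def by blast
  moreover have "\<one> \<in> topspace T" using topspace_eq by simp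
  moreover have "topspace (prod_topology T T) \<times> {\<one>} \<subseteq> W"
  proof
    fix p assume p: "p \<in> topspace (prod_topology T T) \<times> {\<one>}"
    then obtain g h where gh: "p = ((g, h), \<one>)" "g \<in> carrier G" "h \<in> carrier G"
      unfolding topspace_prod_topology topspace_eq by blast
    have "p \<in> topspace ?P" unfolding gh(1) topspace_prod_topology topspace_eq using gh(2,3) by simp
    moreover have "f p = e p" "f p \<in> topspace T" unfolding gh(1) f_def e_def topspace_eq using gh(2,3) by simp_all
    ultimately show "p \<in> W" unfolding W_def by simp
  qed
  ultimately obtain A B where AB: "openin T B" "topspace (prod_topology T T) \<subseteq> A" "\<one> \<in> B" "A \<times> B \<subseteq> W"
    using tube_lemma_left[where X = "prod_topology T T" and Y = T and W = W] by metis
  \<comment> \<open>Allowing factors on both sides makes this subgroup normal.\<close>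
  define N where "N = {x \<in> carrier G. \<forall>g\<in>carrier G. \<forall>h\<in>carrier G. g \<otimes> x \<otimes> h \<in> V \<longleftrightarrow> g \<otimes> h \<in> V}"
  have BN: "B \<subseteq> N"
  proof
    fix x assume x: "x \<in> B"
    have "g \<otimes> x \<otimes> h \<in> V \<longleftrightarrow> g \<otimes> h \<in> V" if "g \<in> carrier G" "h \<in> carrier G" for g h
    proof -
      have "((g, h), x) \<in> W" using AB that x topspace_eq by auto
      then show ?thesis unfolding W_def f_def e_def by auto
    qed
    then show "x \<in> N" using x openin_subset[OF AB(1)] topspace_eq unfolding N_def by auto
  qed
  have Nc: "\<And>x. x \<in> N \<Longrightarrow> x \<in> carrier G" unfolding N_def by blast
  have N_iff: "\<And>x g h. x \<in> N \<Longrightarrow> g \<in> carrier G \<Longrightarrow> h \<in> carrier G \<Longrightarrow> g \<otimes> x \<otimes> h \<in> V \<longleftrightarrow> g \<otimes> h \<in> V"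
    unfolding N_def by blast
  have "subgroup N G"
  proof (rule subgroupI)
    show "N \<subseteq> carrier G" using Nc by blast
    show "N \<noteq> {}" using BN AB(3) by blast
    fix x assume x: "x \<in> N"
    show "inv x \<in> N"
      unfolding N_def
    proof (intro CollectI conjI ballI)
      show "inv x \<in> carrier G" using Nc[OF x] by simp
      fix g h assume gh: "g \<in> carrier G" "h \<in> carrier G"
      have "g \<otimes> inv x \<otimes> x \<otimes> h \<in> V \<longleftrightarrow> g \<otimes> inv x \<otimes> h \<in> V"
        using N_iff[OF x] gh Nc[OF x] by simp
      then show "g \<otimes> inv x \<otimes> h \<in> V \<longleftrightarrow> g \<otimes> h \<in> V"
        using gh Nc[OF x] by (simp add: m_assoc)
    qed
    fix z assume z: "z \<in> N"
    show "x \<otimes> z \<in> N"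
      unfolding N_def
    proof (intro CollectI conjI ballI)
      show "x \<otimes> z \<in> carrier G" using Nc x z by simp
      fix g h assume gh: "g \<in> carrier G" "h \<in> carrier G"
      have "g \<otimes> (x \<otimes> z) \<otimes> h = (g \<otimes> x) \<otimes> z \<otimes> h" using gh Nc x z by (simp add: m_assoc)
      also have "\<dots> \<in> V \<longleftrightarrow> g \<otimes> x \<otimes> h \<in> V" using N_iff[OF z] gh Nc[OF x] by simp
      also have "\<dots> \<longleftrightarrow> g \<otimes> h \<in> V" using N_iff[OF x] gh by simp
      finally show "g \<otimes> (x \<otimes> z) \<otimes> h \<in> V \<longleftrightarrow> g \<otimes> h \<in> V" .
    qed
  qed
  moreover have "y \<otimes> x \<otimes> inv y \<in> N" if x: "x \<in> N" and y: "y \<in> carrier G" for x y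
    unfolding N_def
  proof (intro CollectI conjI ballI)
    show "y \<otimes> x \<otimes> inv y \<in> carrier G" using Nc x y by simp
    fix g h assume gh: "g \<in> carrier G" "h \<in> carrier G"
    have "g \<otimes> (y \<otimes> x \<otimes> inv y) \<otimes> h = (g \<otimes> y) \<otimes> x \<otimes> (inv y \<otimes> h)"
      using gh Nc[OF x] y by (simp add: m_assoc)
    also have "\<dots> \<in> V \<longleftrightarrow> (g \<otimes> y) \<otimes> (inv y \<otimes> h) \<in> V" using N_iff[OF x] gh y by simp
    also have "(g \<otimes> y) \<otimes> (inv y \<otimes> h) = g \<otimes> (y \<otimes> inv y) \<otimes> h" using gh y by (simp only: m_assoc inv_closed m_closed)
    also have "\<dots> = g \<otimes> h" using gh y by simp
    finally show "g \<otimes> (y \<otimes> x \<otimes> inv y) \<otimes> h \<in> V \<longleftrightarrow> g \<otimes> h \<in> V" .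
  qed
  ultimately have N: "N \<lhd> G" "subgroup N G" unfolding normal_inv_iff by auto
  have "openin T N" by (rule openin_subgroupI[OF N(2) AB(1,3) BN])
  moreover have "N \<subseteq> U"
  proof
    fix x assume x: "x \<in> N"
    have "\<one> \<otimes> x \<otimes> \<one> \<in> V" using N_iff[OF x, of \<one> \<one>] V(3) by simp
    then show "x \<in> U" using V(4) Nc[OF x] by auto
  qed
  ultimately show thesis using that N(1) unfolding open_normal_subgroups_def by blast
qed

lemma open_normal_translate:
  assumes "openin T U" "x \<in> U"
  obtains N where "N \<in> open_normal_subgroups G T" "\<And>n. n \<in> N \<Longrightarrow> x \<otimes> n \<in> U"
proof -
  have x: "x \<in> carrier G" using openin_subset[OF assms(1)] assms(2) topspace_eq by blast
  then have "openin T {y \<in> carrier G. x \<otimes> y \<in> U}" by (rule openin_left_translate[OF assms(1)])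
  moreover have "\<one> \<in> {y \<in> carrier G. x \<otimes> y \<in> U}" using x assms(2) by simp
  ultimately obtain N where "N \<in> open_normal_subgroups G T" "N \<subseteq> {y \<in> carrier G. x \<otimes> y \<in> U}"
    by (rule open_normal_base)
  then show thesis using that[of N] by blast
qed

lemma compactin_closed: "closedin T C \<Longrightarrow> compactin T C"
  by (rule closedin_compact_space[OF compact])

lemma finite_rcosets_open:
  assumes H: "subgroup H G" "openin T H"
  shows "finite (rcosets H)"
proof -
  have "compactin T (carrier G)" using compact topspace_eq unfolding compact_space_def by simp
  moreover have "\<And>C. C \<in> rcosets H \<Longrightarrow> openin T C" using openin_rcoset[OF H] unfolding RCOSETS_def by blast
  moreover have "carrier G \<subseteq> \<Union>(rcosets H)" using rcosets_part_G[OF H(1)] by simp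
  ultimately obtain \<F> where F: "finite \<F>" "\<F> \<subseteq> rcosets H" "carrier G \<subseteq> \<Union>\<F>"
    using compactinD[of T "carrier G" "rcosets H"] by blast
  have "rcosets H \<subseteq> \<F>"
  proof
    fix C assume C: "C \<in> rcosets H"
    then obtain g where g: "g \<in> carrier G" "C = H #> g" unfolding RCOSETS_def by blast
    then have gC: "g \<in> C" using rcos_self[OF g(1) H(1)] by simp
    then obtain D where D: "D \<in> \<F>" "g \<in> D" using F(3) g(1) by blast
    then have "C = D" using rcos_disjoint[OF H(1)] C F(2) gC unfolding pairwise_def disjnt_def by blast
    then show "C \<in> \<F>" using D(1) by simp
  qed
  then show ?thesis using F(1) finite_subset by blast
qed

text \<open>The order of the finite group \<open>G / N\<close> is such an exponent.\<close>

lemma open_normal_pow_mem: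
  assumes "N \<in> open_normal_subgroups G T"
  obtains m :: nat where "m > 0" "\<forall>g\<in>carrier G. g [^] m \<in> N"
proof -
  have N: "N \<lhd> G" "subgroup N G" using open_normal_normal[OF assms] open_normal_subgroup[OF assms] by auto
  interpret Q: group "G Mod N" using normal.factorgroup_is_group[OF N(1)] .
  have fin: "finite (carrier (G Mod N))"
    using finite_rcosets_open[OF N(2) open_normal_openin[OF assms]] unfolding FactGroup_def by simp
  let ?m = "order (G Mod N)"
  have "?m > 0" using Q.order_gt_0_iff_finite fin by simp
  moreover have "g [^] ?m \<in> N" if g: "g \<in> carrier G" for g
  proof -
    have "N #> g \<in> carrier (G Mod N)" using g unfolding carrier_FactGroup by blast
    then have "(N #> g) [^]\<^bsub>G Mod N\<^esub> ?m = N" using Q.pow_order_eq_1 by simp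
    then have "N #> (g [^] ?m) = N" using normal.FactGroup_pow[OF N(1) g] by simp
    then show ?thesis using rcos_self[OF _ N(2), of "g [^] ?m"] g by simp
  qed
  ultimately show thesis using that by blast
qed

lemma closed_subgroup_separation:
  assumes H: "H \<in> closed_subgroups G T" and x: "x \<in> carrier G" "x \<notin> H"
  obtains N where "N \<in> open_normal_subgroups G T" "x \<notin> H <#> N"
proof -
  have HG: "subgroup H G" using closed_subgroups_subgroup[OF H] .
  have "openin T (topspace T - H)" using closed_subgroups_closedin[OF H] by blast
  then obtain N where N: "N \<in> open_normal_subgroups G T" "\<And>n. n \<in> N \<Longrightarrow> x \<otimes> n \<in> topspace T - H"
    by (rule open_normal_translate) (use x topspace_eq in auto)
  have "x \<notin> H <#> N"
  proof
    assume "x \<in> H <#> N"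
    then obtain h n where hn: "x = h \<otimes> n" "h \<in> H" "n \<in> N" unfolding set_mult_def by blast
    have c: "h \<in> carrier G" "n \<in> carrier G"
      using subgroup.mem_carrier[OF HG hn(2)] subgroup.mem_carrier[OF open_normal_subgroup[OF N(1)] hn(3)] .
    have "x \<otimes> inv n \<notin> H" using N(2)[OF subgroup.m_inv_closed[OF open_normal_subgroup[OF N(1)] hn(3)]] by blast
    then show False using hn c by (simp add: m_assoc)
  qed
  with N(1) show thesis using that by blast
qed

lemma closed_subgroup_eqI:
  assumes H: "H \<in> closed_subgroups G T" and K: "K \<in> closed_subgroups G T"
    and eq: "\<And>N. N \<in> open_normal_subgroups G T \<Longrightarrow> H <#> N = K <#> N"
  shows "H = K"
proof -
  have "A \<subseteq> B" if A: "A \<in> closed_subgroups G T" and B: "B \<in> closed_subgroups G T"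
    and eq: "\<And>N. N \<in> open_normal_subgroups G T \<Longrightarrow> A <#> N = B <#> N" for A B
  proof (rule subsetI, rule ccontr)
    fix x assume x: "x \<in> A" "x \<notin> B"
    have "x \<in> carrier G" using subgroup.mem_carrier[OF closed_subgroups_subgroup[OF A] x(1)] .
    then obtain N where N: "N \<in> open_normal_subgroups G T" "x \<notin> B <#> N"
      using closed_subgroup_separation[OF B _ x(2)] by blast
    then show False
      using set_mult_open_normal(3)[OF closed_subgroups_subgroup[OF A] N(1)] x(1) eq[OF N(1)] by blast
  qed
  then show ?thesis using H K eq by (metis subset_antisym)
qed

lemma subgroup_nbhd_eq:
  assumes "K \<in> subgroup_nbhd G T H N"
  shows "subgroup_nbhd G T K N = subgroup_nbhd G T H N"
  using assms unfolding subgroup_nbhd_def by auto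

lemma self_subgroup_nbhd: "H \<in> closed_subgroups G T \<Longrightarrow> H \<in> subgroup_nbhd G T H N"
  unfolding subgroup_nbhd_def by simp

lemma clopen_subgroup_nbhd:
  assumes "H \<in> closed_subgroups G T" and N: "N \<in> open_normal_subgroups G T"
  shows "openin (subgroup_space G T) (subgroup_nbhd G T H N)" "closedin (subgroup_space G T) (subgroup_nbhd G T H N)"
proof -
  show "openin (subgroup_space G T) (subgroup_nbhd G T H N)"
    unfolding openin_subgroup_space_iff
  proof (intro conjI ballI)
    show "subgroup_nbhd G T H N \<subseteq> closed_subgroups G T" unfolding subgroup_nbhd_def by blast
    fix K assume "K \<in> subgroup_nbhd G T H N"
    then show "\<exists>N'\<in>open_normal_subgroups G T. subgroup_nbhd G T K N' \<subseteq> subgroup_nbhd G T H N"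
      using subgroup_nbhd_eq N by blast
  qed
  have "openin (subgroup_space G T) (closed_subgroups G T - subgroup_nbhd G T H N)"
    unfolding openin_subgroup_space_iff
  proof (intro conjI ballI)
    fix K assume K: "K \<in> closed_subgroups G T - subgroup_nbhd G T H N"
    have "subgroup_nbhd G T K N \<subseteq> closed_subgroups G T - subgroup_nbhd G T H N"
      using K unfolding subgroup_nbhd_def by auto
    then show "\<exists>N'\<in>open_normal_subgroups G T. subgroup_nbhd G T K N' \<subseteq> closed_subgroups G T - subgroup_nbhd G T H N"
      using N by blast
  qed blast
  then show "closedin (subgroup_space G T) (subgroup_nbhd G T H N)"
    unfolding closedin_def topspace_subgroup_space subgroup_nbhd_def by blast
qed

text \<open>\<open>subgroup_nbhd G T H N\<close> depends only on \<open>H N\<close>, which is a union of cosets of \<open>N\<close>.\<close>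

lemma finite_subgroup_nbhds:
  assumes N: "N \<in> open_normal_subgroups G T"
  shows "finite {subgroup_nbhd G T H N | H. H \<in> closed_subgroups G T}"
proof -
  have NG: "subgroup N G" using open_normal_subgroup[OF N] .
  have "H <#> N \<in> Union ` Pow (rcosets N)" if H: "H \<in> closed_subgroups G T" for H
  proof -
    have "H <#> N = N <#> H" by (rule commut_normal[OF closed_subgroups_subgroup[OF H] open_normal_normal[OF N]])
    also have "\<dots> = \<Union>((\<lambda>h. N #> h) ` H)" unfolding set_mult_def r_coset_def by blast
    finally have 1: "H <#> N = \<Union>((\<lambda>h. N #> h) ` H)" .
    have 2: "(\<lambda>h. N #> h) ` H \<subseteq> rcosets N"
      using subgroup.mem_carrier[OF closed_subgroups_subgroup[OF H]] unfolding RCOSETS_def by blast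
    show ?thesis using 1 2 by (intro image_eqI[where f = Union]) auto
  qed
  then have "(\<lambda>H. H <#> N) ` closed_subgroups G T \<subseteq> Union ` Pow (rcosets N)" by blast
  moreover have "finite (Union ` Pow (rcosets N))"
    using finite_rcosets_open[OF NG open_normal_openin[OF N]] by simp
  ultimately have "finite ((\<lambda>H. H <#> N) ` closed_subgroups G T)" by (rule finite_subset)
  then have "finite ((\<lambda>Q. {K \<in> closed_subgroups G T. K <#> N = Q}) ` (\<lambda>H. H <#> N) ` closed_subgroups G T)"
    by (rule finite_imageI)
  moreover have "{subgroup_nbhd G T H N | H. H \<in> closed_subgroups G T} =
      (\<lambda>Q. {K \<in> closed_subgroups G T. K <#> N = Q}) ` (\<lambda>H. H <#> N) ` closed_subgroups G T"
    unfolding subgroup_nbhd_def by blast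
  ultimately show ?thesis by simp
qed

end

section \<open>Compactness of the space of closed subgroups\<close>

text \<open>Countability of the set of closed subgroups is needed for Baire's theorem and for the finiteness of
  the set of primes involved. It also provides a decreasing sequence of open normal subgroups that is a
  neighbourhood base of the identity.\<close>

locale countable_subgroups = profinite_group +
  assumes countable_closed_subgroups: "countable (closed_subgroups G T)"
begin

lemma countable_open_normal_subgroups: "countable (open_normal_subgroups G T)"
  using countable_closed_subgroups open_normal_closed_subgroup by (meson countable_subset subsetI)

lemma open_normal_decreasing_base:
  obtains N :: "nat \<Rightarrow> 'a set" where "\<forall>i. N i \<in> open_normal_subgroups G T" "\<forall>i. N (Suc i) \<subseteq> N i"
    "\<forall>M\<in>open_normal_subgroups G T. \<exists>i. N i \<subseteq> M"
proof -
  have ne: "open_normal_subgroups G T \<noteq> {}" using carrier_open_normal by blast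
  define M where "M = from_nat_into (open_normal_subgroups G T)"
  have ran: "range M = open_normal_subgroups G T"
    unfolding M_def by (rule range_from_nat_into[OF ne countable_open_normal_subgroups])
  show thesis
  proof (rule that[of "\<lambda>i. \<Inter>(M ` {..i})"]; intro allI ballI)
    show "\<Inter>(M ` {..i}) \<in> open_normal_subgroups G T" for i
      by (rule open_normal_Inter) (use ran in auto)
    show "\<Inter>(M ` {..Suc i}) \<subseteq> \<Inter>(M ` {..i})" for i by auto
    fix L assume "L \<in> open_normal_subgroups G T"
    then have "L \<in> range M" using ran by simp
    then obtain i where "M i = L" by blast
    then have "\<Inter>(M ` {..i}) \<subseteq> L" by blast
    then show "\<exists>i. \<Inter>(M ` {..i}) \<subseteq> L" ..
  qed
qed

text \<open>The subgroups \<open>H i N i\<close> decrease. Their intersection is the limit: for \<open>x\<close> in \<open>H i N i\<close> the coset \<open>x N i\<close>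
  meets each \<open>H j N j\<close> with \<open>j \<ge> i\<close>, so by compactness it meets the intersection.\<close>

lemma subgroup_limit:
  assumes N: "\<And>i. N i \<in> open_normal_subgroups G T" "\<And>i. N (Suc i) \<subseteq> N i"
    and H: "\<And>i. H i \<in> closed_subgroups G T" "\<And>i. H (Suc i) <#> N i = H i <#> N i"
  obtains K where "K \<in> closed_subgroups G T" "\<forall>i. K <#> N i = H i <#> N i"
proof -
  define Q where "Q i = H i <#> N i" for i
  have HG: "subgroup (H i) G" and NG: "subgroup (N i) G" for i
    using closed_subgroups_subgroup[OF H(1)] open_normal_subgroup[OF N(1)] by auto
  have oneN: "\<one> \<in> N i" for i using subgroup.one_closed[OF NG] .
  have Q: "subgroup (Q i) G" "openin T (Q i)" "H i \<subseteq> Q i" "N i \<subseteq> Q i" for i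
    unfolding Q_def using set_mult_open_normal[OF HG N(1)] by auto
  have Qc: "Q i \<in> closed_subgroups G T" for i
    using Q open_subgroup_closedin unfolding closed_subgroups_def by blast
  have NN: "N j \<subseteq> N i" if "i \<le> j" for i j using lift_Suc_antimono_le[of N, OF N(2) that] .
  have Q_Suc: "Q (Suc j) \<subseteq> Q j" for j
  proof -
    have "H (Suc j) \<subseteq> Q j" using set_mult_open_normal(3)[OF HG N(1)] H(2) unfolding Q_def by blast
    moreover have "N (Suc j) \<subseteq> Q j" using N(2) Q(4) by blast
    ultimately show ?thesis
      using subgroup.m_closed[OF Q(1)[of j]] unfolding Q_def[of "Suc j"] set_mult_def by blast
  qed
  have QQ: "Q j \<subseteq> Q i" if "i \<le> j" for i j using lift_Suc_antimono_le[of Q, OF Q_Suc that] .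
  have Q_absorb: "Q j <#> N i = H j <#> N i" if "i \<le> j" for i j
  proof -
    have "Q j <#> N i = H j <#> (N j <#> N i)"
      unfolding Q_def by (rule set_mult_assoc) (use HG NG subgroup.subset in blast)+
    also have "N j <#> N i = N i" by (rule set_mult_absorb[OF NG oneN NN[OF that]])
    finally show ?thesis .
  qed
  have Q_eq: "Q j <#> N i = Q i" if "i \<le> j" for i j
    using that
  proof (induction j rule: dec_induct)
    case base
    show ?case by (rule set_mult_absorb_right[OF Q(1) oneN Q(4)])
  next
    case (step j)
    have "Q (Suc j) <#> N i = H (Suc j) <#> (N j <#> N i)"
      using Q_absorb[of i "Suc j"] set_mult_absorb[OF NG oneN NN[OF step(1)]] step(1) by simp
    also have "\<dots> = (H (Suc j) <#> N j) <#> N i"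
      by (rule set_mult_assoc[symmetric]) (use HG NG subgroup.subset in blast)+
    also have "\<dots> = Q j <#> N i" using H(2) unfolding Q_def by simp
    finally show ?case using step.IH by simp
  qed
  define K where "K = (\<Inter>i. Q i)"
  have K: "K \<in> closed_subgroups G T" unfolding K_def by (rule closed_subgroups_Inter) (use Qc in auto)
  have "K <#> N i = Q i" for i
  proof
    have "K \<subseteq> Q i" unfolding K_def by blast
    then show "K <#> N i \<subseteq> Q i" using subgroup.m_closed[OF Q(1)[of i]] Q(4)[of i] unfolding set_mult_def by blast
    show "Q i \<subseteq> K <#> N i"
    proof
      fix x assume x: "x \<in> Q i"
      have xc: "x \<in> carrier G" using subgroup.mem_carrier[OF Q(1) x] .
      define C where "C j = {y \<in> carrier G. inv x \<otimes> y \<in> N i} \<inter> Q (i + j)" for j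
      have "closedin T (C j)" for j
        unfolding C_def using closed_subgroups_closedin[OF Qc]
          closedin_left_translate[OF closed_subgroups_closedin[OF open_normal_closed_subgroup[OF N(1)]]] xc
        by (intro closedin_Int) auto
      moreover have "C j \<noteq> {}" for j
      proof -
        have "x \<in> Q (i + j) <#> N i" using Q_eq[of i "i + j"] x by simp
        then obtain q n where qn: "x = q \<otimes> n" "q \<in> Q (i + j)" "n \<in> N i" unfolding set_mult_def by blast
        have c: "q \<in> carrier G" "n \<in> carrier G"
          using subgroup.mem_carrier[OF Q(1) qn(2)] subgroup.mem_carrier[OF NG qn(3)] .
        have "inv x \<otimes> q = inv n" using c unfolding qn(1) by (simp add: inv_mult_group m_assoc)
        then have "q \<in> C j" unfolding C_def using c qn subgroup.m_inv_closed[OF NG qn(3)] by simp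
        then show ?thesis by blast
      qed
      moreover have "decseq C"
        unfolding C_def by (rule decseq_SucI) (use Q_Suc in auto)
      ultimately have "(\<Inter>j. C j) \<noteq> {}" by (intro compact_space_imp_nest[OF compact])
      then obtain y where y: "\<And>j. y \<in> C j" by blast
      have yc: "y \<in> carrier G" "inv x \<otimes> y \<in> N i" using y[of 0] unfolding C_def by auto
      have "y \<in> Q j" for j
        using y[of j] QQ[of j "i + j"] unfolding C_def by auto
      then have yK: "y \<in> K" unfolding K_def by blast
      have "inv y \<otimes> x = inv (inv x \<otimes> y)" using xc yc by (simp add: inv_mult_group)
      then have "inv y \<otimes> x \<in> N i" using subgroup.m_inv_closed[OF NG yc(2)] by simp
      moreover have "x = y \<otimes> (inv y \<otimes> x)" using xc yc by (simp add: m_assoc[symmetric])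
      ultimately show "x \<in> K <#> N i" using yK unfolding set_mult_def by blast
    qed
  qed
  then show thesis using that[of K] K unfolding Q_def by simp
qed

text \<open>Koenig's lemma. The sets \<open>subgroup_nbhd G T H (N i)\<close> form a tree with finite levels. If an open cover
  had no finite subcover then the tree would have an infinite branch of sets without finite subcover,
  but the limit of the branch lies in a member of the cover, which contains all
  sets of the branch from some level on.\<close>

lemma compact_space_subgroup_space: "compact_space (subgroup_space G T)"
  unfolding compact_space_def compactin_def topspace_subgroup_space
proof (intro conjI allI impI subset_refl)
  fix \<U> assume U: "Ball \<U> (openin (subgroup_space G T)) \<and> closed_subgroups G T \<subseteq> \<Union>\<U>"
  obtain N :: "nat \<Rightarrow> 'a set" where base: "\<forall>i. N i \<in> open_normal_subgroups G T" "\<forall>i. N (Suc i) \<subseteq> N i"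
    "\<forall>M\<in>open_normal_subgroups G T. \<exists>i. N i \<subseteq> M"
    by (rule open_normal_decreasing_base)
  note N = base[rule_format]
  define cov where "cov S \<longleftrightarrow> (\<exists>\<F>. finite \<F> \<and> \<F> \<subseteq> \<U> \<and> S \<subseteq> \<Union>\<F>)" for S
  have cov_Union: "cov (\<Union>\<S>)" if "finite \<S>" "\<And>S. S \<in> \<S> \<Longrightarrow> cov S" for \<S>
  proof -
    have "\<forall>S\<in>\<S>. \<exists>\<F>. finite \<F> \<and> \<F> \<subseteq> \<U> \<and> S \<subseteq> \<Union>\<F>" using that(2) unfolding cov_def by blast
    then obtain F where F: "\<And>S. S \<in> \<S> \<Longrightarrow> finite (F S) \<and> F S \<subseteq> \<U> \<and> S \<subseteq> \<Union>(F S)" by metis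
    show ?thesis
      unfolding cov_def
    proof (intro exI conjI)
      show "finite (\<Union>(F ` \<S>))" using F that(1) by simp
      show "\<Union>(F ` \<S>) \<subseteq> \<U>" using F by (simp add: UN_least)
      show "\<Union>\<S> \<subseteq> \<Union>(\<Union>(F ` \<S>))" using F by fastforce
    qed
  qed
  have refine: "\<exists>H \<in> S. \<not> cov (subgroup_nbhd G T H (N i))"
    if "\<not> cov S" "S \<subseteq> closed_subgroups G T" for S i
  proof (rule ccontr)
    assume neg: "\<not> ?thesis"
    let ?\<S> = "{subgroup_nbhd G T H (N i) | H. H \<in> S}"
    have "finite ?\<S>" by (rule finite_subset[OF _ finite_subgroup_nbhds[OF N(1)]]) (use that(2) in blast)
    then have "cov (\<Union>?\<S>)" by (rule cov_Union) (use neg in blast)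
    moreover have "S \<subseteq> \<Union>?\<S>" using that(2) self_subgroup_nbhd by blast
    ultimately show False using that(1) unfolding cov_def by (meson subset_trans)
  qed
  show "\<exists>\<F>. finite \<F> \<and> \<F> \<subseteq> \<U> \<and> closed_subgroups G T \<subseteq> \<Union>\<F>"
  proof (rule ccontr)
    assume "\<not> ?thesis"
    then have bad: "\<not> cov (closed_subgroups G T)" unfolding cov_def .
    have "\<exists>H. \<forall>i. (H i \<in> closed_subgroups G T \<and> \<not> cov (subgroup_nbhd G T (H i) (N i))) \<and>
        H (Suc i) \<in> subgroup_nbhd G T (H i) (N i)"
    proof (rule dependent_nat_choice)
      show "\<exists>H. H \<in> closed_subgroups G T \<and> \<not> cov (subgroup_nbhd G T H (N 0))"
        using refine[OF bad, of 0] by blast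
      fix H i assume H: "H \<in> closed_subgroups G T \<and> \<not> cov (subgroup_nbhd G T H (N i))"
      then have "\<exists>K\<in>subgroup_nbhd G T H (N i). \<not> cov (subgroup_nbhd G T K (N (Suc i)))"
        by (intro refine) (auto simp: subgroup_nbhd_def)
      then show "\<exists>K. (K \<in> closed_subgroups G T \<and> \<not> cov (subgroup_nbhd G T K (N (Suc i)))) \<and> K \<in> subgroup_nbhd G T H (N i)"
        unfolding subgroup_nbhd_def by blast
    qed
    then obtain H where H: "\<And>i. H i \<in> closed_subgroups G T" "\<And>i. \<not> cov (subgroup_nbhd G T (H i) (N i))"
      "\<And>i. H (Suc i) \<in> subgroup_nbhd G T (H i) (N i)" by metis
    have HN: "H (Suc i) <#> N i = H i <#> N i" for i using H(3)[of i] unfolding subgroup_nbhd_def by blast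
    obtain K where K: "K \<in> closed_subgroups G T" "\<forall>i. K <#> N i = H i <#> N i"
      by (rule subgroup_limit[of N H, OF N(1,2) H(1) HN])
    then have "K \<in> \<Union>\<U>" using U by blast
    then obtain W where W: "W \<in> \<U>" "K \<in> W" by blast
    obtain M where M: "M \<in> open_normal_subgroups G T" "subgroup_nbhd G T K M \<subseteq> W"
      using bspec[OF conjunct1[OF U] W(1)] W(2) unfolding openin_subgroup_space_iff by metis
    then obtain i where i: "N i \<subseteq> M" using N(3) by blast
    have "subgroup_nbhd G T K (N i) \<subseteq> W"
      using subgroup_nbhd_mono[OF closed_subgroups_subgroup[OF K(1)] N(1) M(1) i] M(2) by blast
    moreover have "subgroup_nbhd G T K (N i) = subgroup_nbhd G T (H i) (N i)"
      using K(2) unfolding subgroup_nbhd_def by simp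
    ultimately have "cov (subgroup_nbhd G T (H i) (N i))"
      unfolding cov_def using W(1) by (intro exI[of _ "{W}"]) auto
    then show False using H(2) by blast
  qed
qed

section \<open>Procyclic subgroups and the theorem of Baire\<close>

text \<open>The procyclic subgroup topologically generated by \<open>x\<close>.\<close>

definition closed_hull :: "'a \<Rightarrow> 'a set" where
  "closed_hull x = \<Inter>{H \<in> closed_subgroups G T. x \<in> H}"

lemma carrier_closed_subgroup: "carrier G \<in> closed_subgroups G T"
  using carrier_open_normal open_normal_closed_subgroup by blast

lemma closed_hull_closed_subgroup: "x \<in> carrier G \<Longrightarrow> closed_hull x \<in> closed_subgroups G T"
  unfolding closed_hull_def by (rule closed_subgroups_Inter) (use carrier_closed_subgroup in auto)

lemma mem_closed_hull: "x \<in> closed_hull x"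
  unfolding closed_hull_def by blast

lemma closed_hull_least: "H \<in> closed_subgroups G T \<Longrightarrow> x \<in> H \<Longrightarrow> closed_hull x \<subseteq> H"
  unfolding closed_hull_def by blast

lemma centralizer_closed_subgroup:
  assumes x: "x \<in> carrier G"
  shows "{z \<in> carrier G. z \<otimes> x = x \<otimes> z} \<in> closed_subgroups G T"
proof -
  let ?Z = "{z \<in> carrier G. z \<otimes> x = x \<otimes> z}"
  have "closedin T {z \<in> topspace T. z \<otimes> x = x \<otimes> z}"
    by (rule closedin_continuous_maps_eq[OF Hausdorff continuous_map_right_mult[OF x] continuous_map_left_mult[OF x]])
  moreover have "subgroup ?Z G"
  proof (rule subgroupI)
    show "?Z \<noteq> {}" using x by (auto intro!: exI[of _ \<one>])
    fix a assume a: "a \<in> ?Z"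
    then have ac: "a \<in> carrier G" and "inv a \<otimes> (a \<otimes> x) \<otimes> inv a = inv a \<otimes> (x \<otimes> a) \<otimes> inv a" by simp_all
    moreover have "inv a \<otimes> (a \<otimes> x) \<otimes> inv a = x \<otimes> inv a" using ac x by (simp add: m_assoc[symmetric])
    moreover have "inv a \<otimes> (x \<otimes> a) \<otimes> inv a = inv a \<otimes> x" using ac x by (simp add: m_assoc)
    ultimately have "x \<otimes> inv a = inv a \<otimes> x" by simp
    then show "inv a \<in> ?Z" using a by simp
    fix b assume b: "b \<in> ?Z"
    have "a \<otimes> b \<otimes> x = a \<otimes> (x \<otimes> b)" using a b x by (simp add: m_assoc)
    also have "\<dots> = x \<otimes> (a \<otimes> b)" using a b x by (simp add: m_assoc[symmetric])
    finally show "a \<otimes> b \<in> ?Z" using a b by simp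
  qed blast
  ultimately show ?thesis unfolding closed_subgroups_def topspace_eq by simp
qed

text \<open>Centralisers of elements are closed subgroups. So the centraliser of \<open>x\<close> contains the hull of \<open>x\<close>,
  and then the centraliser of each element of the hull contains \<open>x\<close> and therefore the hull.\<close>

lemma closed_hull_commute:
  assumes x: "x \<in> carrier G" and a: "a \<in> closed_hull x" and b: "b \<in> closed_hull x"
  shows "a \<otimes> b = b \<otimes> a"
proof -
  have 1: "a \<otimes> x = x \<otimes> a"
    using closed_hull_least[OF centralizer_closed_subgroup[OF x]] x a by blast
  have ac: "a \<in> carrier G"
    using subgroup.mem_carrier[OF closed_subgroups_subgroup[OF closed_hull_closed_subgroup[OF x]] a] .
  have "b \<otimes> a = a \<otimes> b"
    using closed_hull_least[OF centralizer_closed_subgroup[OF ac], of x] x b 1 by auto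
  then show ?thesis by simp
qed

text \<open>The countably many sets \<open>closed_hull x \<inter> W\<close> are closed and cover \<open>W\<close>, so by Baire's theorem one of
  them has an interior point \<open>w\<close>. This hull contains \<open>w N\<close> for some open normal \<open>N\<close>, and
  then also \<open>N\<close> itself.\<close>

lemma open_set_meets_open_hull:
  assumes W: "openin T W" "closedin T W" "W \<noteq> {}"
  obtains w x N where "w \<in> W" "x \<in> carrier G" "N \<in> open_normal_subgroups G T"
    "w \<in> closed_hull x" "N \<subseteq> closed_hull x"
proof -
  have Wc: "W \<subseteq> carrier G" using openin_subset[OF W(1)] topspace_eq by simp
  let ?\<G> = "(\<lambda>L. L \<inter> W) ` (closed_hull ` carrier G)"
  have "countable (closed_hull ` carrier G)"
    using closed_hull_closed_subgroup by (intro countable_subset[OF _ countable_closed_subgroups]) blast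
  then have cG: "countable ?\<G>" by simp
  have union: "\<Union>?\<G> = W" using mem_closed_hull Wc by blast
  have "\<exists>L\<in>?\<G>. T interior_of L \<noteq> {}"
  proof (rule ccontr)
    assume neg: "\<not> ?thesis"
    have lc: "locally_compact_space T" "regular_space T"
      using compact_imp_locally_compact_space[OF compact] compact_Hausdorff_imp_regular_space[OF compact Hausdorff] .
    have "T interior_of \<Union>?\<G> = {}"
    proof (rule Baire_category_alt[OF _ cG])
      show "completely_metrizable_space T \<or> locally_compact_space T \<and> regular_space T" using lc by simp
      fix L assume L: "L \<in> ?\<G>"
      then obtain x where x: "x \<in> carrier G" "L = closed_hull x \<inter> W" by blast
      have "closedin T L"
        unfolding x(2) using closed_subgroups_closedin[OF closed_hull_closed_subgroup[OF x(1)]] W(2) by (rule closedin_Int)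
      then show "closedin T L \<and> T interior_of L = {}" using neg L by blast
    qed
    then show False using union W(1,3) interior_of_openin[OF W(1)] by simp
  qed
  then obtain x where x: "x \<in> carrier G" "T interior_of (closed_hull x \<inter> W) \<noteq> {}" by blast
  let ?V = "T interior_of (closed_hull x \<inter> W)"
  obtain w where w: "w \<in> ?V" using x(2) by blast
  have VL: "?V \<subseteq> closed_hull x \<inter> W" by (rule interior_of_subset)
  obtain N where N: "N \<in> open_normal_subgroups G T" "\<And>n. n \<in> N \<Longrightarrow> w \<otimes> n \<in> ?V"
    using open_normal_translate[OF openin_interior_of w] by blast
  have LG: "subgroup (closed_hull x) G" using closed_subgroups_subgroup[OF closed_hull_closed_subgroup[OF x(1)]] .
  have wL: "w \<in> closed_hull x" "w \<in> W" using w VL by auto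
  have "N \<subseteq> closed_hull x"
  proof
    fix n assume n: "n \<in> N"
    then have "w \<otimes> n \<in> closed_hull x" using N(2) VL by blast
    then have "inv w \<otimes> (w \<otimes> n) \<in> closed_hull x"
      using subgroup.m_closed[OF LG subgroup.m_inv_closed[OF LG wL(1)]] by blast
    then show "n \<in> closed_hull x"
      using subgroup.mem_carrier[OF LG wL(1)] subgroup.mem_carrier[OF open_normal_subgroup[OF N(1)] n]
      by (simp add: m_assoc[symmetric])
  qed
  then show thesis using that[OF wL(2) x(1) N(1) wL(1)] by blast
qed

text \<open>The preceding lemma for \<open>W = G\<close> gives an open normal subgroup \<open>M\<close> of \<open>G\<close> inside a procyclic one. For each of
  the finitely many cosets \<open>W\<close> of \<open>M\<close> it gives an element of \<open>W\<close> that commutes with an open normal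
  subgroup of \<open>G\<close>, as hulls are abelian. Since \<open>M\<close> is abelian as well, the part of this subgroup in \<open>M\<close>
  commutes with all of \<open>W\<close>. Intersecting over the cosets gives an open central subgroup.\<close>

lemma open_central_subgroup_of_hull:
  obtains x Z where "x \<in> carrier G" "openin T (closed_hull x)" "Z \<in> open_normal_subgroups G T" "Z \<subseteq> closed_hull x"
    "\<And>z g. z \<in> Z \<Longrightarrow> g \<in> carrier G \<Longrightarrow> z \<otimes> g = g \<otimes> z"
proof -
  have "openin T (carrier G)" "closedin T (carrier G)"
    using openin_topspace[of T] closedin_topspace[of T] unfolding topspace_eq .
  moreover have "carrier G \<noteq> {}" using one_closed by blast
  ultimately obtain x M where x: "x \<in> carrier G" and M: "M \<in> open_normal_subgroups G T" "M \<subseteq> closed_hull x"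
    by (rule open_set_meets_open_hull)
  have L: "subgroup (closed_hull x) G" using closed_subgroups_subgroup[OF closed_hull_closed_subgroup[OF x]] .
  have MG: "subgroup M G" using open_normal_subgroup[OF M(1)] .
  have "\<exists>N. N \<in> open_normal_subgroups G T \<and> N \<subseteq> M \<and> (\<forall>n\<in>N. \<forall>g\<in>W. n \<otimes> g = g \<otimes> n)"
    if Wr: "W \<in> rcosets M" for W
  proof -
    obtain h where h: "h \<in> carrier G" "W = M #> h" using Wr unfolding RCOSETS_def by blast
    have W: "openin T W" unfolding h(2) by (rule openin_rcoset[OF MG open_normal_openin[OF M(1)] h(1)])
    have "W \<noteq> {}" using rcos_self[OF h(1) MG] h(2) by blast
    moreover have "closedin T W"
      unfolding h(2) by (rule closedin_rcoset[OF MG open_subgroup_closedin[OF MG open_normal_openin[OF M(1)]] h(1)])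
    ultimately obtain w x' N where w: "w \<in> W" "x' \<in> carrier G" "N \<in> open_normal_subgroups G T"
      "w \<in> closed_hull x'" "N \<subseteq> closed_hull x'"
      using W open_set_meets_open_hull by metis
    have NM: "N \<inter> M \<in> open_normal_subgroups G T"
      using open_normal_Inter[of "{N, M}"] w(3) M(1) by simp
    have wc: "w \<in> carrier G"
      using subgroup.mem_carrier[OF closed_subgroups_subgroup[OF closed_hull_closed_subgroup[OF w(2)]] w(4)] .
    have "n \<otimes> g = g \<otimes> n" if n: "n \<in> N \<inter> M" and g: "g \<in> W" for n g
    proof -
      obtain m m' where m: "m \<in> M" "w = m \<otimes> h" "m' \<in> M" "g = m' \<otimes> h"
        using w(1) g unfolding h(2) r_coset_def by blast
      have c: "m \<in> carrier G" "m' \<in> carrier G" "n \<in> carrier G"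
        using m n subgroup.mem_carrier[OF MG] by auto
      have gw: "g = (m' \<otimes> inv m) \<otimes> w" using m c h(1) by (simp add: m_assoc[symmetric]) (simp add: m_assoc)
      have "m' \<otimes> inv m \<in> closed_hull x"
        using subgroup.m_closed[OF MG m(3) subgroup.m_inv_closed[OF MG m(1)]] M(2) by blast
      then have 1: "n \<otimes> (m' \<otimes> inv m) = (m' \<otimes> inv m) \<otimes> n"
        using closed_hull_commute[OF x] n M(2) by blast
      have 2: "n \<otimes> w = w \<otimes> n" using closed_hull_commute[OF w(2)] n w(4,5) by blast
      have mc: "m' \<otimes> inv m \<in> carrier G" using c by simp
      have "n \<otimes> g = (n \<otimes> (m' \<otimes> inv m)) \<otimes> w" unfolding gw using m_assoc[OF c(3) mc wc] by simp
      also have "\<dots> = (m' \<otimes> inv m) \<otimes> (n \<otimes> w)" unfolding 1 by (rule m_assoc[OF mc c(3) wc])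
      also have "\<dots> = g \<otimes> n" unfolding 2 gw using m_assoc[OF mc wc c(3)] by simp
      finally show ?thesis .
    qed
    then show ?thesis using NM by blast
  qed
  then obtain N where N: "\<And>W. W \<in> rcosets M \<Longrightarrow>
      N W \<in> open_normal_subgroups G T \<and> N W \<subseteq> M \<and> (\<forall>n\<in>N W. \<forall>g\<in>W. n \<otimes> g = g \<otimes> n)" by metis
  have Mr: "M \<in> rcosets M" using subgroup.subgroup_in_rcosets[OF MG is_group] .
  show thesis
  proof
    show "x \<in> carrier G" by (rule x)
    show "openin T (closed_hull x)"
      by (rule openin_subgroupI[OF L open_normal_openin[OF M(1)] subgroup.one_closed[OF MG] M(2)])
    show "\<Inter>(N ` (rcosets M)) \<in> open_normal_subgroups G T"
      by (rule open_normal_Inter) (use N Mr finite_rcosets_open[OF MG open_normal_openin[OF M(1)]] in auto)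
    show "\<Inter>(N ` (rcosets M)) \<subseteq> closed_hull x" using N[OF Mr] Mr M(2) by blast
    fix z g assume z: "z \<in> \<Inter>(N ` (rcosets M))" and g: "g \<in> carrier G"
    then have "M #> g \<in> rcosets M" "g \<in> M #> g"
      using rcosetsI[OF subgroup.subset[OF MG]] rcos_self[OF g MG] by auto
    then show "z \<otimes> g = g \<otimes> z" using N z by blast
  qed
qed

end

section \<open>Open procyclic subgroups\<close>

text \<open>The last assumption says that \<open>y\<close> generates the quotient of \<open>A\<close> by the \<open>n\<close>-th powers. This form of
  topological generation passes from \<open>A\<close> to the subgroup of \<open>m\<close>-th powers, with \<open>y\<close> replaced by its \<open>m\<close>-th
  power.\<close>

locale procyclic_subgroup = countable_subgroups +
  fixes A :: "'a set" and y :: 'a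
  assumes A_subgroup: "subgroup A G" and A_open: "openin T A"
    and A_commute: "\<And>a b. a \<in> A \<Longrightarrow> b \<in> A \<Longrightarrow> a \<otimes> b = b \<otimes> a"
    and y_mem: "y \<in> A"
    and topologically_generates: "\<And>(n::nat) a. n > 0 \<Longrightarrow> a \<in> A \<Longrightarrow> \<exists>(i::nat) b. b \<in> A \<and> a = y [^] i \<otimes> b [^] n"
begin

lemma A_carrier: "a \<in> A \<Longrightarrow> a \<in> carrier G"
  using subgroup.mem_carrier[OF A_subgroup] .

lemma A_closedin: "closedin T A"
  by (rule open_subgroup_closedin[OF A_subgroup A_open])

lemma A_pow_mult: "a \<in> A \<Longrightarrow> b \<in> A \<Longrightarrow> (a \<otimes> b) [^] (n::nat) = a [^] n \<otimes> b [^] n"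
  using pow_mult_distrib A_commute A_carrier by blast

lemmas A_mult = subgroup.m_closed[OF A_subgroup] and A_inv = subgroup.m_inv_closed[OF A_subgroup]
  and A_pow = nat_pow_mem_subgroup[OF A_subgroup]

definition pw :: "nat \<Rightarrow> 'a set" where "pw n = (\<lambda>a. a [^] n) ` A"

lemma pw_I: "a \<in> A \<Longrightarrow> a [^] n \<in> pw n"
  unfolding pw_def by blast

lemma pw_subset: "pw n \<subseteq> A"
  unfolding pw_def using A_pow by blast

lemma pw_subgroup: "subgroup (pw n) G"
proof (rule subgroupI)
  show "pw n \<subseteq> carrier G" using pw_subset A_carrier by blast
  show "pw n \<noteq> {}" using pw_I[OF y_mem] by blast
  fix x assume "x \<in> pw n"
  then obtain a where a: "a \<in> A" "x = a [^] n" unfolding pw_def by blast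
  then have "inv x = (inv a) [^] n" using A_carrier by (simp add: nat_pow_inv)
  then show "inv x \<in> pw n" using pw_I[OF A_inv[OF a(1)]] by simp
  fix z assume "z \<in> pw n"
  then obtain b where b: "b \<in> A" "z = b [^] n" unfolding pw_def by blast
  then have "x \<otimes> z = (a \<otimes> b) [^] n" using a A_pow_mult by simp
  then show "x \<otimes> z \<in> pw n" using pw_I[OF A_mult[OF a(1) b(1)]] by simp
qed

lemmas pw_one = subgroup.one_closed[OF pw_subgroup] and pw_mult = subgroup.m_closed[OF pw_subgroup]
  and pw_inv = subgroup.m_inv_closed[OF pw_subgroup] and pw_pow_mem = nat_pow_mem_subgroup[OF pw_subgroup]

lemma pw_1 [simp]: "pw (Suc 0) = A"
  unfolding pw_def using A_carrier by (auto simp: image_iff)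

lemma pw_pow: "x \<in> pw n \<Longrightarrow> x [^] m \<in> pw (n * m)"
  unfolding pw_def using A_carrier by (auto simp: nat_pow_pow)

lemma pw_dvd_subset:
  assumes "n dvd m"
  shows "pw m \<subseteq> pw n"
proof
  fix x assume "x \<in> pw m"
  then obtain a where a: "a \<in> A" "x = a [^] m" unfolding pw_def by blast
  obtain k where "m = n * k" using assms by blast
  then have "x = (a [^] k) [^] n" using a A_carrier by (simp add: nat_pow_pow mult.commute)
  then show "x \<in> pw n" using pw_I[OF A_pow[OF a(1)]] by simp
qed

lemma pw_closedin: "closedin T (pw n)"
  unfolding pw_def
  by (rule compactin_imp_closedin[OF Hausdorff image_compactin[OF compactin_closed[OF A_closedin] continuous_map_pow]])

lemma pw_decomposition:
  assumes n: "n > 0" and a: "a \<in> A"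
  obtains i :: nat and b where "i < n" "b \<in> pw n" "a = y [^] i \<otimes> b"
proof -
  obtain i :: nat and b where b: "b \<in> A" "a = y [^] i \<otimes> b [^] n"
    using topologically_generates[OF n a] by blast
  have yc: "y \<in> carrier G" using A_carrier[OF y_mem] .
  have "y [^] i = y [^] (i mod n) \<otimes> (y [^] (i div n)) [^] n"
    using yc by (simp add: nat_pow_pow nat_pow_mult mult.commute)
  then have "a = y [^] (i mod n) \<otimes> ((y [^] (i div n)) [^] n \<otimes> b [^] n)"
    using b yc A_carrier by (simp add: m_assoc)
  moreover have "(y [^] (i div n)) [^] n \<otimes> b [^] n \<in> pw n"
    by (rule pw_mult[OF pw_I[OF A_pow[OF y_mem]] pw_I[OF b(1)]])
  moreover have "i mod n < n" using n by simp
  ultimately show thesis using that by blast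
qed

text \<open>\<open>A\<close> is the union of at most \<open>n\<close> cosets of the closed subgroup \<open>pw n\<close>; removing all of them but \<open>pw n\<close>
  itself leaves an open set.\<close>

lemma pw_open:
  assumes n: "n > 0"
  shows "openin T (pw n)"
proof -
  have yc: "y [^] i \<in> carrier G" for i :: nat using A_carrier[OF A_pow[OF y_mem]] .
  define S where "S i = {x \<in> carrier G. inv (y [^] i) \<otimes> x \<in> pw n}" for i :: nat
  let ?I = "{i. i < n \<and> y [^] i \<notin> pw n}"
  have cl: "closedin T (\<Union>(S ` ?I))"
    using closedin_left_translate[OF pw_closedin] yc unfolding S_def by (intro closedin_Union) auto
  have "pw n = A - \<Union>(S ` ?I)"
  proof (intro equalityI subsetI DiffI)
    fix x assume x: "x \<in> pw n"
    then show "x \<in> A" using pw_subset by blast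
    show "x \<notin> \<Union>(S ` ?I)"
    proof
      assume "x \<in> \<Union>(S ` ?I)"
      then obtain i :: nat where i: "y [^] i \<notin> pw n" "inv (y [^] i) \<otimes> x \<in> pw n" "x \<in> carrier G" unfolding S_def by blast
      have "x \<otimes> inv (inv (y [^] i) \<otimes> x) = y [^] i" using yc[of i] i(3) by (simp add: inv_mult_group m_assoc[symmetric])
      then show False using pw_mult[OF x pw_inv[OF i(2)]] i(1) by simp
    qed
  next
    fix x assume x: "x \<in> A - \<Union>(S ` ?I)"
    then obtain i b where i: "i < n" "b \<in> pw n" "x = y [^] i \<otimes> b" using pw_decomposition[OF n] by blast
    have bc: "b \<in> carrier G" using i(2) pw_subset A_carrier by blast
    have "inv (y [^] i) \<otimes> x = b" using i(3) yc[of i] bc by (simp add: m_assoc[symmetric])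
    then have "x \<in> S i" unfolding S_def using i x A_carrier by simp
    then have "y [^] i \<in> pw n" using x i(1) by blast
    then show "x \<in> pw n" using i pw_mult by simp
  qed
  then show ?thesis using openin_diff[OF A_open cl] by simp
qed

text \<open>The number \<open>n\<close> is the order of \<open>y\<close> modulo \<open>U\<close>, which is the index of \<open>U\<close> in \<open>A\<close>. In particular \<open>A\<close> has at
  most one open subgroup of each index.\<close>

lemma open_subgroup_eq_pw:
  assumes U: "subgroup U G" "openin T U" "U \<subseteq> A"
  obtains n where "n > 0" "U = pw n" "\<forall>i::nat. y [^] i \<in> U \<longleftrightarrow> n dvd i"
proof -
  obtain N where N: "N \<in> open_normal_subgroups G T" "N \<subseteq> U"
    by (rule open_normal_base[OF U(2) subgroup.one_closed[OF U(1)]])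
  obtain m :: nat where m: "m > 0" "\<forall>g\<in>carrier G. g [^] m \<in> N"
    using open_normal_pow_mem[OF N(1)] .
  have yc: "y \<in> carrier G" using A_carrier[OF y_mem] .
  define n where "n = (LEAST n::nat. n > 0 \<and> y [^] n \<in> U)"
  have "\<exists>n::nat. n > 0 \<and> y [^] n \<in> U" using m N(2) yc by blast
  then have n: "n > 0" "y [^] n \<in> U" unfolding n_def by (metis (mono_tags, lifting) LeastI_ex)+
  have iff: "y [^] i \<in> U \<longleftrightarrow> n dvd i" for i :: nat
  proof
    assume "n dvd i"
    then obtain k where "i = n * k" by blast
    then show "y [^] i \<in> U" using nat_pow_mem_subgroup[OF U(1) n(2), of k] yc by (simp add: nat_pow_pow)
  next
    assume i: "y [^] i \<in> U"
    then have "y [^] gcd n i \<in> U" using pow_gcd_mem_subgroup[OF U(1) yc n(2) _ n(1)] by blast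
    then have "(LEAST n::nat. n > 0 \<and> y [^] n \<in> U) \<le> gcd n i"
      using n(1) by (intro Least_le) simp
    then have "n \<le> gcd n i" by (simp only: n_def[symmetric])
    moreover have "gcd n i \<le> n" using n(1) by (simp add: gcd_le1_nat)
    ultimately show "n dvd i" by (metis gcd_dvd2 le_antisym)
  qed
  have "U = pw n"
  proof (intro equalityI subsetI)
    fix u assume u: "u \<in> U"
    then obtain i :: nat and b where b: "b \<in> A" "u = y [^] i \<otimes> b [^] (n * m)"
      using topologically_generates[of "n * m" u] n(1) m(1) U(3) by auto
    have bU: "b [^] (n * m) \<in> U"
    proof -
      have "(b [^] n) [^] m \<in> N" using m(2) A_carrier[OF b(1)] by blast
      then show ?thesis using N(2) A_carrier[OF b(1)] by (auto simp: nat_pow_pow)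
    qed
    have "y [^] i = u \<otimes> inv (b [^] (n * m))" using b yc A_carrier by (simp add: m_assoc)
    then have "y [^] i \<in> U" using subgroup.m_closed[OF U(1) u subgroup.m_inv_closed[OF U(1) bU]] by simp
    then have "n dvd i" using iff by blast
    then have "y [^] i \<in> pw n" using pw_dvd_subset pw_I[OF y_mem, of i] by blast
    moreover have "b [^] (n * m) \<in> pw n" using pw_dvd_subset[of n "n * m"] pw_I[OF b(1), of "n * m"] by auto
    ultimately show "u \<in> pw n" using b(2) pw_mult by simp
  next
    fix x assume "x \<in> pw n"
    then obtain a where a: "a \<in> A" "x = a [^] n" unfolding pw_def by blast
    obtain i :: nat and b where b: "b \<in> A" "a = y [^] i \<otimes> b [^] m"
      using topologically_generates[OF m(1) a(1)] by blast
    have "b [^] m \<in> U" using m(2) A_carrier[OF b(1)] N(2) by blast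
    then have 1: "(b [^] m) [^] n \<in> U" by (rule nat_pow_mem_subgroup[OF U(1)])
    have "(y [^] i) [^] n \<in> U" using iff[of "i * n"] yc by (simp add: nat_pow_pow)
    moreover have "x = (y [^] i) [^] n \<otimes> (b [^] m) [^] n"
      unfolding a(2) b(2) by (rule A_pow_mult[OF A_pow[OF y_mem] A_pow[OF b(1)]])
    ultimately show "x \<in> U" using 1 subgroup.m_closed[OF U(1)] by simp
  qed
  with n(1) iff show thesis using that by blast
qed

text \<open>By Bezout's identity \<open>d\<close> is a combination of \<open>u\<close> and \<open>q\<close>.\<close>

lemma pw_gcd:
  assumes a: "a \<in> A" and u: "u > 0" and "gcd u q dvd d"
  shows "\<exists>c\<in>pw q. a [^] d \<otimes> c \<in> pw u"
proof -
  obtain s t where st: "u * s = q * t + gcd u q" using bezout_nat[of u q] u by auto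
  obtain k where k: "d = gcd u q * k" using assms(3) by blast
  define c where "c = (a [^] (t * k)) [^] q"
  have "a [^] d \<otimes> c = a [^] (gcd u q * k + q * t * k)"
    unfolding c_def k using A_carrier[OF a] by (simp add: nat_pow_pow nat_pow_mult algebra_simps)
  also have "gcd u q * k + q * t * k = s * k * u" using st by (metis add.commute distrib_right mult.assoc mult.commute)
  also have "a [^] (s * k * u) = (a [^] (s * k)) [^] u" using A_carrier[OF a] by (simp add: nat_pow_pow)
  finally have "a [^] d \<otimes> c \<in> pw u" using pw_I[OF A_pow[OF a]] by simp
  moreover have "c \<in> pw q" unfolding c_def by (rule pw_I[OF A_pow[OF a]])
  ultimately show ?thesis by blast
qed

text \<open>By compactness the coset \<open>a (pw q)\<close> meets the intersection of the directed family of the \<open>pw u\<close> if it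
  meets each of them.\<close>

lemma pw_Inter_translate:
  assumes a: "a \<in> A" and U: "U \<noteq> {}" "\<And>u v. u \<in> U \<Longrightarrow> v \<in> U \<Longrightarrow> \<exists>w\<in>U. u dvd w \<and> v dvd w"
    and pw: "\<And>u. u \<in> U \<Longrightarrow> \<exists>c\<in>pw q. a \<otimes> c \<in> pw u"
  obtains c where "c \<in> pw q" "\<forall>u\<in>U. a \<otimes> c \<in> pw u"
proof -
  define F where "F u = {c \<in> carrier G. a \<otimes> c \<in> pw u} \<inter> pw q" for u
  have cl: "closedin T (F u)" for u
    unfolding F_def using closedin_left_translate[OF pw_closedin A_carrier[OF a]] pw_closedin by (rule closedin_Int)
  have ne: "F u \<noteq> {}" if "u \<in> U" for u
    using pw[OF that] pw_subset A_carrier unfolding F_def by blast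
  have bound: "\<exists>w\<in>U. \<forall>u\<in>V. u dvd w" if "finite V" "V \<subseteq> U" for V
    using that
  proof (induction V rule: finite_induct)
    case empty
    then show ?case using U(1) by blast
  next
    case (insert v V)
    then obtain w where w: "w \<in> U" "\<forall>u\<in>V. u dvd w" by auto
    obtain w' where "w' \<in> U" "w dvd w'" "v dvd w'" using U(2)[OF w(1), of v] insert.prems by blast
    then show ?case using w(2) dvd_trans by blast
  qed
  have "\<Inter>(F ` U) \<noteq> {}"
  proof (rule compact_space_fip[THEN iffD1, rule_format, OF compact], intro conjI ballI allI impI)
    show "closedin T C" if "C \<in> F ` U" for C using that cl by blast
    fix \<F> assume "finite \<F> \<and> \<F> \<subseteq> F ` U"
    then obtain V where V: "finite V" "V \<subseteq> U" "\<F> = F ` V" by (metis finite_subset_image)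
    obtain w where w: "w \<in> U" "\<forall>u\<in>V. u dvd w" using bound[OF V(1,2)] by blast
    have "F w \<subseteq> F u" if "u \<in> V" for u
      using pw_dvd_subset w(2) that unfolding F_def by blast
    then show "\<Inter>\<F> \<noteq> {}" using ne[OF w(1)] unfolding V(3) by blast
  qed
  then obtain c where c: "\<And>u. u \<in> U \<Longrightarrow> c \<in> F u" by blast
  then show thesis using that[of c] U(1) unfolding F_def by blast
qed

text \<open>For a set \<open>S\<close> of such primes let \<open>E S\<close> be the intersection of the \<open>pw u\<close> over all \<open>u\<close> that are
  products of primes in \<open>S\<close>. If \<open>p\<close> is not in \<open>S\<close> then \<open>E S\<close> and \<open>pw p\<close> together generate \<open>A\<close>, since \<open>u\<close>
  and \<open>p\<close> are coprime. So \<open>p \<in> S\<close> can be recovered as \<open>E S \<subseteq> pw p\<close>, and an infinite set of primes would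
  produce uncountably many closed subgroups.\<close>

lemma finite_relevant_primes: "finite {p. prime p \<and> pw p \<noteq> A}" (is "finite ?R")
proof (rule ccontr)
  assume inf: "infinite ?R"
  define V where "V S = {u. u > 0 \<and> (\<forall>p. prime p \<longrightarrow> p dvd u \<longrightarrow> p \<in> S)}" for S :: "nat set"
  have ne: "V S \<noteq> {}" for S unfolding V_def by (auto intro!: exI[of _ "1::nat"])
  define E where "E S = (\<Inter>u\<in>V S. pw u)" for S :: "nat set"
  have E: "E S \<in> closed_subgroups G T" for S
    unfolding E_def
  proof (rule closed_subgroups_Inter)
    show "pw ` V S \<subseteq> closed_subgroups G T"
      using pw_subgroup pw_closedin unfolding closed_subgroups_def by blast
    show "pw ` V S \<noteq> {}" using ne by simp
  qed
  have E_iff: "E S \<subseteq> pw p \<longleftrightarrow> p \<in> S" if S: "S \<subseteq> ?R" and p: "p \<in> ?R" for S p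
  proof
    assume "p \<in> S"
    moreover have "prime p" using p by simp
    ultimately have "p > 0 \<and> (\<forall>q. prime q \<longrightarrow> q dvd p \<longrightarrow> q \<in> S)"
      using primes_dvd_imp_eq prime_gt_0_nat by blast
    then have "p \<in> V S" unfolding V_def by blast
    then show "E S \<subseteq> pw p" unfolding E_def by blast
  next
    assume sub: "E S \<subseteq> pw p"
    show "p \<in> S"
    proof (rule ccontr)
      assume "p \<notin> S"
      have pp: "prime p" using p by simp
      have "a \<in> pw p" if a: "a \<in> A" for a
      proof -
        obtain c where c: "c \<in> pw p" "\<forall>u\<in>V S. a \<otimes> c \<in> pw u"
        proof (rule pw_Inter_translate[OF a])
          show "V S \<noteq> {}" by (rule ne)
          show "\<exists>w\<in>V S. u dvd w \<and> v dvd w"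
            if "u \<in> V S" "v \<in> V S" for u v
            using that unfolding V_def by (intro bexI[of _ "u * v"]) (auto simp: prime_dvd_mult_iff)
          fix u assume u: "u \<in> V S"
          then have u0: "u > 0" and "\<not> p dvd u" using \<open>p \<notin> S\<close> pp unfolding V_def by blast+
          then have "gcd u p = 1" using pp by (metis coprime_iff_gcd_eq_1 gcd.commute prime_imp_coprime_nat)
          then show "\<exists>c\<in>pw p. a \<otimes> c \<in> pw u"
            using pw_gcd[OF a u0, of p 1] A_carrier[OF a] by auto
        qed
        then have ac: "a \<otimes> c \<in> pw p" using sub unfolding E_def by blast
        have "c \<in> carrier G" using c(1) pw_subset A_carrier by blast
        then have "a = (a \<otimes> c) \<otimes> inv c" using A_carrier[OF a] by (simp add: m_assoc)
        then show ?thesis using pw_mult[OF ac pw_inv[OF c(1)]] by simp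
      qed
      then show False using p pw_subset by blast
    qed
  qed
  have "inj_on E (Pow ?R)"
  proof (rule inj_onI)
    fix S S' assume "S \<in> Pow ?R" "S' \<in> Pow ?R" "E S = E S'"
    then have "p \<in> S \<longleftrightarrow> p \<in> S'" if "p \<in> ?R" for p using E_iff[of S p] E_iff[of S' p] that by auto
    then show "S = S'" using \<open>S \<in> Pow ?R\<close> \<open>S' \<in> Pow ?R\<close> by blast
  qed
  moreover have "countable (E ` Pow ?R)"
    by (rule countable_subset[OF _ countable_closed_subgroups]) (use E in blast)
  ultimately have cnt: "countable (Pow ?R)" by (metis countable_image_inj_on)
  have "range (from_nat_into (Pow ?R)) = Pow ?R" by (rule range_from_nat_into) (use cnt in auto)
  moreover have "to_nat_on ?R ` ?R = UNIV" using inf by (intro image_to_nat_on) auto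
  ultimately have "(from_nat_into (Pow ?R) \<circ> to_nat_on ?R) ` ?R = Pow ?R" by (metis image_comp)
  then show False using Cantors_theorem by blast
qed

end

section \<open>A central open procyclic subgroup\<close>

locale central_procyclic_subgroup = procyclic_subgroup +
  assumes A_central: "\<And>a g. a \<in> A \<Longrightarrow> g \<in> carrier G \<Longrightarrow> a \<otimes> g = g \<otimes> a"

context countable_subgroups begin

text \<open>The products of a power of \<open>x\<close> and an \<open>n\<close>-th power form a subgroup. It is closed, because the exponent
  of \<open>x\<close> may be reduced modulo \<open>n\<close>, and contains \<open>x\<close>, so it is the whole hull.\<close>

lemma procyclic_subgroup_closed_hull:
  assumes x: "x \<in> carrier G" and op: "openin T (closed_hull x)"
  shows "procyclic_subgroup G T (closed_hull x) x"
proof -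
  let ?C = "closed_hull x"
  have C: "subgroup ?C G" "closedin T ?C"
    using closed_subgroups_subgroup closed_subgroups_closedin closed_hull_closed_subgroup[OF x] by blast+
  note Cc = subgroup.mem_carrier[OF C(1)]
  have "\<exists>(i::nat) b. b \<in> ?C \<and> a = x [^] i \<otimes> b [^] n" if n: "n > 0" and a: "a \<in> ?C" for n :: nat and a
  proof -
    define P where "P = (\<lambda>a. a [^] n) ` ?C"
    define D where "D = {x [^] i \<otimes> b [^] n | (i::nat) b. b \<in> ?C}"
    have P_closed: "closedin T P"
      unfolding P_def by (rule compactin_imp_closedin[OF Hausdorff image_compactin[OF compactin_closed[OF C(2)] continuous_map_pow]])
    have xi: "x [^] i \<in> ?C" for i :: nat by (rule nat_pow_mem_subgroup[OF C(1) mem_closed_hull])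
    have comm: "(a \<otimes> b) [^] n = a [^] n \<otimes> b [^] n" if "a \<in> ?C" "b \<in> ?C" for a b and n :: nat
      using pow_mult_distrib closed_hull_commute[OF x that] Cc that by blast
    have "D = (\<Union>i<n. {z \<in> carrier G. inv (x [^] i) \<otimes> z \<in> P})"
    proof (intro equalityI subsetI)
      fix z assume "z \<in> D"
      then obtain i :: nat and b where b: "b \<in> ?C" "z = x [^] i \<otimes> b [^] n" unfolding D_def by blast
      have "x [^] i = x [^] (i mod n) \<otimes> (x [^] (i div n)) [^] n"
        using x by (simp add: nat_pow_pow nat_pow_mult mult.commute)
      then have z: "z = x [^] (i mod n) \<otimes> (x [^] (i div n) \<otimes> b) [^] n"
        using b x Cc comm[OF xi b(1)] by (simp add: m_assoc)
      then have "inv (x [^] (i mod n)) \<otimes> z = (x [^] (i div n) \<otimes> b) [^] n"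
        using x Cc[OF b(1)] by (simp add: m_assoc[symmetric])
      then have "inv (x [^] (i mod n)) \<otimes> z \<in> P"
        unfolding P_def using subgroup.m_closed[OF C(1) xi b(1)] by blast
      moreover have "i mod n < n" using n by simp
      moreover have "z \<in> carrier G" using b x Cc by simp
      ultimately show "z \<in> (\<Union>i<n. {z \<in> carrier G. inv (x [^] i) \<otimes> z \<in> P})" by blast
    next
      fix z assume "z \<in> (\<Union>i<n. {z \<in> carrier G. inv (x [^] i) \<otimes> z \<in> P})"
      then obtain i :: nat and b where i: "z \<in> carrier G" "b \<in> ?C" "inv (x [^] i) \<otimes> z = b [^] n"
        unfolding P_def by blast
      have "z = x [^] i \<otimes> (inv (x [^] i) \<otimes> z)" using i(1) x by (simp add: m_assoc[symmetric])
      then show "z \<in> D" unfolding D_def using i by auto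
    qed
    moreover have "closedin T (\<Union>i<n. {z \<in> carrier G. inv (x [^] i) \<otimes> z \<in> P})"
      using closedin_left_translate[OF P_closed] x by (intro closedin_Union) auto
    ultimately have "closedin T D" by simp
    moreover have "subgroup D G"
    proof -
      have D_C: "D \<subseteq> ?C"
        unfolding D_def using subgroup.m_closed[OF C(1) xi nat_pow_mem_subgroup[OF C(1)]] by blast
      have D_I: "b [^] n \<in> D" if "b \<in> ?C" for b
      proof -
        have "b [^] n = x [^] (0::nat) \<otimes> b [^] n" using Cc[OF that] by simp
        then show ?thesis unfolding D_def using that by blast
      qed
      have D_mult: "u \<otimes> v \<in> D" if "u \<in> D" "v \<in> D" for u v
      proof -
        obtain i :: nat and b where b: "b \<in> ?C" "u = x [^] i \<otimes> b [^] n"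
          using \<open>u \<in> D\<close> unfolding D_def by blast
        obtain j :: nat and d where d: "d \<in> ?C" "v = x [^] j \<otimes> d [^] n"
          using \<open>v \<in> D\<close> unfolding D_def by blast
        have bc: "b \<in> carrier G" and dc: "d \<in> carrier G" using Cc b(1) d(1) by auto
        have "u \<otimes> v = x [^] i \<otimes> (b [^] n \<otimes> x [^] j) \<otimes> d [^] n" using b d x bc dc by (simp add: m_assoc)
        also have "b [^] n \<otimes> x [^] j = x [^] j \<otimes> b [^] n"
          by (rule closed_hull_commute[OF x nat_pow_mem_subgroup[OF C(1) b(1)] xi])
        also have "x [^] i \<otimes> (x [^] j \<otimes> b [^] n) \<otimes> d [^] n = x [^] (i + j) \<otimes> (b \<otimes> d) [^] n"
          using comm[OF b(1) d(1)] x bc dc by (simp add: m_assoc nat_pow_mult[symmetric])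
        finally show ?thesis unfolding D_def using subgroup.m_closed[OF C(1) b(1) d(1)] by blast
      qed
      show ?thesis
      proof (rule subgroupI)
        show "D \<subseteq> carrier G" using D_C Cc by blast
        show "D \<noteq> {}" using D_I[OF mem_closed_hull] by blast
        fix u assume u: "u \<in> D"
        have uC: "u \<in> ?C" "inv u \<in> ?C" using u D_C subgroup.m_inv_closed[OF C(1)] by auto
        have "u [^] k \<in> D" for k :: nat
          using D_mult[OF _ u] D_I[OF subgroup.one_closed[OF C(1)]] by (induction k) auto
        \<comment> \<open>The inverse of \<open>u\<close> is the product of a power of \<open>u\<close> and an \<open>n\<close>-th power.\<close>
        then have "u [^] (n - 1) \<otimes> (inv u) [^] n \<in> D" using D_mult D_I[OF uC(2)] by blast
        moreover have "u [^] n = u \<otimes> u [^] (n - 1)" using n Cc[OF uC(1)] nat_pow_Suc2[of u "n - 1"] by simp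
        then have "u [^] (n - 1) \<otimes> (inv u) [^] n = inv u"
          using Cc[OF uC(1)] by (simp add: nat_pow_inv inv_mult_group m_assoc[symmetric])
        ultimately show "inv u \<in> D" by simp
      qed (rule D_mult)
    qed
    moreover have "x \<in> D"
    proof -
      have "x = x [^] (1::nat) \<otimes> \<one> [^] n" using x by simp
      then show ?thesis unfolding D_def using subgroup.one_closed[OF C(1)] by blast
    qed
    ultimately have "?C \<subseteq> D" by (intro closed_hull_least) (simp_all add: closed_subgroups_def)
    then show ?thesis using a unfolding D_def by blast
  qed
  then show ?thesis
    using C(1) op closed_hull_commute[OF x] mem_closed_hull
    by (intro procyclic_subgroup.intro countable_subgroups_axioms procyclic_subgroup_axioms.intro)
qed

text \<open>If \<open>m\<close>-th powers lie in the open central subgroup \<open>Z\<close> then the \<open>m\<close>-th powers of elements of an open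
  procyclic subgroup form a central procyclic subgroup, which is still open.\<close>

theorem central_procyclic_subgroup_exists:
  obtains A y where "central_procyclic_subgroup G T A y"
proof -
  obtain x Z where x: "x \<in> carrier G" "openin T (closed_hull x)" and Z: "Z \<in> open_normal_subgroups G T" "Z \<subseteq> closed_hull x"
    and central: "\<And>z g. z \<in> Z \<Longrightarrow> g \<in> carrier G \<Longrightarrow> z \<otimes> g = g \<otimes> z"
    using open_central_subgroup_of_hull by metis
  interpret C: procyclic_subgroup G T "closed_hull x" x by (rule procyclic_subgroup_closed_hull[OF x])
  obtain m :: nat where m: "m > 0" "\<forall>g\<in>carrier G. g [^] m \<in> Z" using open_normal_pow_mem[OF Z(1)] .
  have AZ: "C.pw m \<subseteq> Z" unfolding C.pw_def using m(2) C.A_carrier by blast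
  have "central_procyclic_subgroup G T (C.pw m) (x [^] m)"
  proof (intro central_procyclic_subgroup.intro procyclic_subgroup.intro countable_subgroups_axioms
      procyclic_subgroup_axioms.intro central_procyclic_subgroup_axioms.intro)
    show "subgroup (C.pw m) G" by (rule C.pw_subgroup)
    show "openin T (C.pw m)" by (rule C.pw_open[OF m(1)])
    show "a \<otimes> b = b \<otimes> a" if "a \<in> C.pw m" "b \<in> C.pw m" for a b
      using C.A_commute C.pw_subset that by blast
    show "x [^] m \<in> C.pw m" by (rule C.pw_I[OF C.y_mem])
    show "\<exists>(i::nat) b. b \<in> C.pw m \<and> a = (x [^] m) [^] i \<otimes> b [^] n" if n: "n > 0" and a: "a \<in> C.pw m" for n :: nat and a
    proof -
      obtain c where c: "c \<in> closed_hull x" "a = c [^] m" using a unfolding C.pw_def by blast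
      obtain i :: nat and b where b: "b \<in> closed_hull x" "c = x [^] i \<otimes> b [^] n"
        using C.topologically_generates[OF n c(1)] by blast
      have "a = (x [^] i) [^] m \<otimes> (b [^] n) [^] m"
        unfolding c(2) b(2) by (rule C.A_pow_mult[OF C.A_pow[OF C.y_mem] C.A_pow[OF b(1)]])
      also have "\<dots> = (x [^] m) [^] i \<otimes> (b [^] m) [^] n"
        using x(1) C.A_carrier[OF b(1)] by (simp add: nat_pow_pow mult.commute)
      finally show ?thesis using C.pw_I[OF b(1)] by blast
    qed
    show "a \<otimes> g = g \<otimes> a" if "a \<in> C.pw m" "g \<in> carrier G" for a g
      using central AZ that by blast
  qed
  then show thesis by (rule that)
qed

end

section \<open>Subgroups of the central procyclic subgroup\<close>

context central_procyclic_subgroup begin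

lemma central_normal:
  assumes H: "subgroup H G" "H \<subseteq> A"
  shows "H \<lhd> G"
  unfolding normal_inv_iff
proof (intro conjI ballI)
  fix x h assume x: "x \<in> carrier G" and h: "h \<in> H"
  then have "x \<otimes> h \<otimes> inv x = h"
    using A_central[of h x] H(2) A_carrier by (auto simp: m_assoc simp flip: A_central)
  then show "x \<otimes> h \<otimes> inv x \<in> H" using h by simp
qed (rule H)

lemma pw_open_normal: "n > 0 \<Longrightarrow> pw n \<in> open_normal_subgroups G T"
  using central_normal[OF pw_subgroup pw_subset] pw_open unfolding open_normal_subgroups_def by blast

lemma set_mult_pw_subset: "B \<subseteq> A \<Longrightarrow> B <#> pw n \<subseteq> A"
  using A_mult pw_subset unfolding set_mult_def by blast

lemma set_mult_pw_antimono: "m dvd n \<Longrightarrow> B <#> pw n \<subseteq> B <#> pw m"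
  by (rule mono_set_mult[OF subset_refl pw_dvd_subset])

lemma set_mult_pw_absorb:
  assumes "B \<subseteq> carrier G" "n dvd m"
  shows "B <#> pw m <#> pw n = B <#> pw n"
proof -
  have "B <#> pw m <#> pw n = B <#> (pw m <#> pw n)"
    by (rule set_mult_assoc) (use assms pw_subset A_carrier in blast)+
  then show ?thesis using set_mult_absorb[OF pw_subgroup pw_one pw_dvd_subset[OF assms(2)]] by simp
qed

text \<open>Raising to a power \<open>p ^ e\<close> turns an equation between consecutive members of the chain
  \<open>B <#> pw (p ^ j)\<close> into the inclusion \<open>e\<close> steps further down.\<close>

lemma set_mult_pw_stabilises:
  assumes B: "subgroup B G" "B \<subseteq> A" and eq: "B <#> pw (p ^ Suc j) = B <#> pw (p ^ j)" and "j \<le> l"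
  shows "B <#> pw (p ^ l) = B <#> pw (p ^ j)"
  using \<open>j \<le> l\<close>
proof (induction l rule: dec_induct)
  case (step l)
  have "B <#> pw (p ^ l) \<subseteq> B <#> pw (p ^ Suc l)"
  proof
    fix x assume "x \<in> B <#> pw (p ^ l)"
    then obtain b a where b: "b \<in> B" "a \<in> A" "x = b \<otimes> a [^] (p ^ l)" unfolding set_mult_def pw_def by blast
    \<comment> \<open>Membership of \<open>a [^] (p ^ j)\<close> in \<open>B <#> pw (p ^ Suc j)\<close>, raised to the power \<open>p ^ (l - j)\<close>.\<close>
    have "a [^] (p ^ j) \<in> B <#> pw (p ^ j)"
      using subset_set_mult_right[of "pw (p ^ j)" B] subgroup.one_closed[OF B(1)] pw_I[OF b(2)]
        subgroup.subset[OF pw_subgroup] by blast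
    then obtain b' c where c: "b' \<in> B" "c \<in> A" "a [^] (p ^ j) = b' \<otimes> c [^] (p ^ Suc j)"
      unfolding eq[symmetric] unfolding set_mult_def pw_def by blast
    define e where "e = p ^ (l - j)"
    have pl: "p ^ l = p ^ j * e" unfolding e_def using step(1) by (simp flip: power_add)
    have "a [^] (p ^ l) = (b' \<otimes> c [^] (p ^ Suc j)) [^] e"
      using c(3) A_carrier[OF b(2)] unfolding pl by (simp add: nat_pow_pow[symmetric])
    also have "\<dots> = b' [^] e \<otimes> (c [^] (p ^ Suc j)) [^] e"
      by (rule A_pow_mult) (use c B(2) A_pow in blast)+
    also have "(c [^] (p ^ Suc j)) [^] e = c [^] (p ^ Suc l)"
      unfolding pl power_Suc using A_carrier[OF c(2)] by (simp add: nat_pow_pow pl mult.assoc)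
    finally have "x = (b \<otimes> b' [^] e) \<otimes> c [^] (p ^ Suc l)"
      using b(3) A_carrier[OF c(2)] subgroup.mem_carrier[OF B(1)] b(1) c(1) by (simp add: m_assoc)
    moreover have "b \<otimes> b' [^] e \<in> B"
      by (rule subgroup.m_closed[OF B(1) b(1) nat_pow_mem_subgroup[OF B(1) c(1)]])
    ultimately show "x \<in> B <#> pw (p ^ Suc l)" using pw_I[OF c(2)] unfolding set_mult_def by blast
  qed
  then have "B <#> pw (p ^ Suc l) = B <#> pw (p ^ l)"
    using set_mult_pw_antimono[of "p ^ l" "p ^ Suc l" B] by (simp add: subset_antisym)
  then show ?case using step.IH by simp
qed simp

text \<open>The index of \<open>B <#> pw (p ^ j)\<close> in \<open>A\<close> is the largest power of \<open>p\<close> that divides both \<open>p ^ j\<close> and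
  the index of \<open>B\<close>. Hence these are the primes \<open>p\<close> for which \<open>p^\<infinity>\<close> divides the index of \<open>B\<close> in \<open>A\<close>.\<close>

definition infinite_index_primes :: "'a set \<Rightarrow> nat set" where
  "infinite_index_primes B = {p. prime p \<and> (\<forall>j. B <#> pw (p ^ Suc j) \<noteq> B <#> pw (p ^ j))}"

lemma infinite_index_primes_relevant:
  assumes B: "subgroup B G" "B \<subseteq> A"
  shows "infinite_index_primes B \<subseteq> {p. prime p \<and> pw p \<noteq> A}"
proof
  fix p assume p: "p \<in> infinite_index_primes B"
  then have "prime p" "B <#> pw (p ^ Suc 0) \<noteq> B <#> pw (p ^ 0)" unfolding infinite_index_primes_def by blast+
  then show "p \<in> {p. prime p \<and> pw p \<noteq> A}" by auto
qed

lemma finite_infinite_index_primes: "subgroup B G \<Longrightarrow> B \<subseteq> A \<Longrightarrow> finite (infinite_index_primes B)"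
  using finite_subset[OF infinite_index_primes_relevant finite_relevant_primes] .

lemma irrelevant_prime_pw:
  assumes "pw p = A"
  shows "pw (p ^ l) = A"
proof (induction l)
  case (Suc l)
  have "A \<subseteq> pw (p ^ Suc l)"
  proof
    fix a assume "a \<in> A"
    then obtain b where b: "b \<in> A" "a = b [^] (p ^ l)" using Suc unfolding pw_def by blast
    then obtain c where "c \<in> A" "b = c [^] p" using assms unfolding pw_def by blast
    then have "a = c [^] (p ^ Suc l)" using b A_carrier by (simp add: nat_pow_pow)
    then show "a \<in> pw (p ^ Suc l)" using pw_I[OF \<open>c \<in> A\<close>] by simp
  qed
  then show ?case using pw_subset by blast
qed simp

text \<open>The subgroup \<open>B <#> pw (p ^ l)\<close> is open, so it is \<open>pw (p ^ e)\<close> for some \<open>e \<le> l\<close>. If \<open>e < l\<close> then the chain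
  would be constant from \<open>e\<close> to \<open>l\<close>.\<close>

lemma infinite_index_prime_pw:
  assumes B: "subgroup B G" "B \<subseteq> A" and p: "p \<in> infinite_index_primes B"
  shows "B <#> pw (p ^ l) = pw (p ^ l)" "B \<subseteq> pw (p ^ l)" "y [^] i \<in> pw (p ^ l) \<longleftrightarrow> p ^ l dvd i"
proof -
  have pp: "prime p" using p unfolding infinite_index_primes_def by blast
  then have "p ^ l > 0" using prime_gt_0_nat by simp
  note U = set_mult_open_normal[OF B(1) pw_open_normal[OF this]]
  obtain n where n: "n > 0" "B <#> pw (p ^ l) = pw n" "\<forall>i. y [^] i \<in> B <#> pw (p ^ l) \<longleftrightarrow> n dvd i"
    using open_subgroup_eq_pw[OF U(1,2) set_mult_pw_subset[OF B(2)]] by metis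
  have "y [^] (p ^ l) \<in> B <#> pw (p ^ l)" using pw_I[OF y_mem] U(4) by blast
  then have "n dvd p ^ l" using n(3) by blast
  then obtain e where i: "e \<le> l" "n = p ^ e" using divides_primepow_nat[OF pp] by blast
  have el: "e = l"
  proof (rule ccontr)
    assume "e \<noteq> l"
    then have il: "Suc e \<le> l" using i(1) by simp
    have "B \<subseteq> pw (p ^ e)" using U(3) n(2) i(2) by simp
    then have "B <#> pw (p ^ e) = pw (p ^ e)" by (rule set_mult_absorb[OF pw_subgroup subgroup.one_closed[OF B(1)]])
    also have "\<dots> \<subseteq> B <#> pw (p ^ Suc e)"
    proof -
      have "pw (p ^ e) = B <#> pw (p ^ l)" using n(2) i(2) by simp
      also have "\<dots> \<subseteq> B <#> pw (p ^ Suc e)" by (rule set_mult_pw_antimono[OF le_imp_power_dvd[OF il]])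
      finally show ?thesis .
    qed
    finally have "B <#> pw (p ^ Suc e) = B <#> pw (p ^ e)"
      using set_mult_pw_antimono[OF le_imp_power_dvd[of e "Suc e" p], of B] by (simp add: subset_antisym)
    then show False using p unfolding infinite_index_primes_def by blast
  qed
  show "B <#> pw (p ^ l) = pw (p ^ l)" using n(2) i(2) el by simp
  then show "B \<subseteq> pw (p ^ l)" "y [^] i \<in> pw (p ^ l) \<longleftrightarrow> p ^ l dvd i"
    using U(3) n(3) i(2) el by auto
qed

text \<open>\<open>B\<close> is an intersection of open subgroups \<open>pw n\<close>, and \<open>pw n\<close> is the intersection of the \<open>pw (q ^ v)\<close>
  for the prime powers \<open>q ^ v\<close> exactly dividing \<open>n\<close>. The latter is the Chinese remainder theorem: the
  order \<open>d\<close> of \<open>a\<close> modulo \<open>pw n\<close> divides the part of \<open>n\<close> prime to \<open>q\<close> for every prime \<open>q\<close> dividing \<open>d\<close>.\<close>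

lemma mem_closed_subgroup_if_locally:
  assumes B: "B \<in> closed_subgroups G T" "B \<subseteq> A" and a: "a \<in> A"
    and loc: "\<And>p l. prime p \<Longrightarrow> a \<in> B <#> pw (p ^ l)"
  shows "a \<in> B"
proof (rule ccontr)
  assume "a \<notin> B"
  have BG: "subgroup B G" using closed_subgroups_subgroup[OF B(1)] .
  have ac: "a \<in> carrier G" using A_carrier[OF a] .
  obtain N where N: "N \<in> open_normal_subgroups G T" "a \<notin> B <#> N"
    using closed_subgroup_separation[OF B(1) ac \<open>a \<notin> B\<close>] .
  have NA: "subgroup (N \<inter> A) G" "openin T (N \<inter> A)"
    using subgroups_Inter_pair[OF open_normal_subgroup[OF N(1)] A_subgroup] open_normal_openin[OF N(1)] A_open by auto
  then have "N \<inter> A \<in> open_normal_subgroups G T"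
    using central_normal unfolding open_normal_subgroups_def by blast
  note U = set_mult_open_normal[OF BG this]
  have "B <#> (N \<inter> A) \<subseteq> A" using A_mult B(2) unfolding set_mult_def by blast
  then obtain n where n: "n > 0" "B <#> (N \<inter> A) = pw n"
    using open_subgroup_eq_pw[OF U(1,2)] by metis
  have an: "a \<notin> pw n" using N(2) n(2) unfolding set_mult_def by blast
  have Bn: "B \<subseteq> pw n" using U(3) n(2) by simp
  define d where "d = (LEAST d::nat. d > 0 \<and> a [^] d \<in> pw n)"
  have "n > 0 \<and> a [^] n \<in> pw n" using n(1) pw_I[OF a] by blast
  then have d: "d > 0" "a [^] d \<in> pw n" unfolding d_def by (metis (mono_tags, lifting) LeastI)+
  have d_dvd: "d dvd e" if "a [^] e \<in> pw n" for e
  proof -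
    have "a [^] gcd d e \<in> pw n" by (rule pow_gcd_mem_subgroup[OF pw_subgroup ac d(2) that d(1)])
    then have "(LEAST d::nat. d > 0 \<and> a [^] d \<in> pw n) \<le> gcd d e"
      using d(1) by (intro Least_le) simp
    then have "d \<le> gcd d e" by (simp only: d_def[symmetric])
    moreover have "gcd d e \<le> d" using d(1) by (simp add: gcd_le1_nat)
    ultimately show ?thesis by (metis gcd_dvd2 le_antisym)
  qed
  have "d \<noteq> 1" using d(2) an ac by auto
  then obtain q where q: "prime q" "q dvd d" using prime_factor_nat by blast
  obtain m where m: "n = q ^ multiplicity q n * m" "\<not> q dvd m"
    using multiplicity_decompose'[of n q] n(1) q(1) by (metis not_prime_unit not_gr0)
  let ?v = "multiplicity q n"
  have "B \<subseteq> pw (q ^ ?v)" using Bn pw_dvd_subset[of "q ^ ?v" n] m(1) by (metis dvd_triv_left subset_trans)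
  then have "B <#> pw (q ^ ?v) = pw (q ^ ?v)"
    by (rule set_mult_absorb[OF pw_subgroup subgroup.one_closed[OF BG]])
  then have "a \<in> pw (q ^ ?v)" using loc[OF q(1), of ?v] by simp
  then have "a [^] m \<in> pw (q ^ ?v * m)" by (rule pw_pow)
  then have "d dvd m" using d_dvd m(1) by simp
  then show False using q(2) m(2) dvd_trans by blast
qed

end

section \<open>The rank of a closed subgroup\<close>

context central_procyclic_subgroup begin

text \<open>Dedekind's modular law.\<close>

lemma set_mult_Int_modular:
  assumes K: "subgroup K G" and N: "N \<subseteq> A"
  shows "(K <#> N) \<inter> A = (K \<inter> A) <#> N"
proof (intro equalityI subsetI)
  fix x assume x: "x \<in> (K <#> N) \<inter> A"
  then obtain k n where kn: "k \<in> K" "n \<in> N" "x = k \<otimes> n" unfolding set_mult_def by blast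
  have "k = x \<otimes> inv n"
    using kn subgroup.mem_carrier[OF K kn(1)] N A_carrier by (auto simp: m_assoc)
  then have "k \<in> A" using x kn(2) N A_mult A_inv by blast
  then show "x \<in> (K \<inter> A) <#> N" using kn unfolding set_mult_def by blast
next
  fix x assume "x \<in> (K \<inter> A) <#> N"
  then show "x \<in> (K <#> N) \<inter> A" using N A_mult unfolding set_mult_def by blast
qed

lemma Int_A_closed_subgroup:
  assumes "K \<in> closed_subgroups G T"
  shows "K \<inter> A \<in> closed_subgroups G T"
  using assms subgroups_Inter_pair[OF _ A_subgroup, of K] A_closedin unfolding closed_subgroups_def by auto

text \<open>As \<open>A\<close> has finite index in \<open>G\<close>, this is the number of primes \<open>p\<close> such that \<open>p^\<infinity>\<close> divides the index of \<open>K\<close> in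
  \<open>G\<close>.\<close>

definition corank :: "'a set \<Rightarrow> nat" where
  "corank K = card (infinite_index_primes (K \<inter> A))"

text \<open>For every prime whose chain \<open>B <#> pw (p ^ j)\<close> becomes constant, \<open>pw n\<close> lies in the final member
  of the chain. That it is final has to be visible modulo \<open>pw n\<close>, which is why \<open>p ^ Suc j\<close> and not
  \<open>p ^ j\<close> has to divide \<open>n\<close>. All but finitely many primes satisfy \<open>pw p = A\<close>, and their chains are
  constant from the start.\<close>

definition stabilising :: "'a set \<Rightarrow> nat \<Rightarrow> bool" where
  "stabilising B n \<longleftrightarrow> n > 0 \<and> (\<forall>p. prime p \<longrightarrow> pw p \<noteq> A \<longrightarrow> p \<notin> infinite_index_primes B \<longrightarrow>
     (\<exists>j. p ^ Suc j dvd n \<and> B <#> pw (p ^ Suc j) = B <#> pw (p ^ j)))"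

lemma stabilising_exists: "\<exists>n. stabilising B n"
proof -
  let ?S = "{p. prime p \<and> pw p \<noteq> A} - infinite_index_primes B"
  have "\<forall>p\<in>?S. \<exists>j. B <#> pw (p ^ Suc j) = B <#> pw (p ^ j)"
    unfolding infinite_index_primes_def by blast
  from bchoice[OF this] obtain j where j: "\<forall>p\<in>?S. B <#> pw (p ^ Suc (j p)) = B <#> pw (p ^ j p)" by blast
  have fin: "finite ?S" using finite_relevant_primes by simp
  have "(\<Prod>p\<in>?S. p ^ Suc (j p)) > 0" by (rule prod_pos) (auto simp: prime_gt_0_nat)
  moreover have "p ^ Suc (j p) dvd (\<Prod>p\<in>?S. p ^ Suc (j p))" if "p \<in> ?S" for p
    using dvd_prodI[OF fin that] .
  ultimately have "stabilising B (\<Prod>p\<in>?S. p ^ Suc (j p))" unfolding stabilising_def using j by blast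
  then show ?thesis ..
qed

text \<open>\<open>A / B\<close> has no torsion near the identity: its \<open>p\<close>-part is a copy of the \<open>p\<close>-adic integers, and
  torsion-free, if \<open>p^\<infinity>\<close> divides the index of \<open>B\<close>, and the other \<open>p\<close>-parts of elements of \<open>pw n\<close> are trivial.\<close>

lemma mem_if_pow_mem:
  fixes m :: nat
  assumes B: "B \<in> closed_subgroups G T" "B \<subseteq> A" and n: "stabilising B n" and m: "m > 0"
    and a: "a \<in> pw n" "a [^] m \<in> B"
  shows "a \<in> B"
proof (rule mem_closed_subgroup_if_locally[OF B])
  have BG: "subgroup B G" using closed_subgroups_subgroup[OF B(1)] .
  show aA: "a \<in> A" using a(1) pw_subset by blast
  have ac: "a \<in> carrier G" using A_carrier[OF aA] .
  have right: "pw l \<subseteq> B <#> pw l" for l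
    by (rule subset_set_mult_right[OF subgroup.subset[OF pw_subgroup] subgroup.one_closed[OF BG]])
  fix p l :: nat assume p: "prime p"
  consider "p \<in> infinite_index_primes B" | "pw p = A" | "pw p \<noteq> A" "p \<notin> infinite_index_primes B" by blast
  then show "a \<in> B <#> pw (p ^ l)"
  proof cases
    case 1
    \<comment> \<open>\<open>A / pw (p^i)\<close> is cyclic of order \<open>p^i\<close> for every \<open>i\<close>. The extra \<open>s\<close> absorbs the \<open>p\<close>-part of \<open>m\<close>.\<close>
    obtain u where u: "m = p ^ multiplicity p m * u" "\<not> p dvd u"
      using multiplicity_decompose'[of m p] m p by (metis not_prime_unit not_gr0)
    define s where "s = multiplicity p m"
    have "p ^ (l + s) > 0" using p prime_gt_0_nat by simp
    then obtain i :: nat and b where b: "b \<in> A" "a = y [^] i \<otimes> b [^] (p ^ (l + s))"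
      using topologically_generates aA by blast
    have yc: "y \<in> carrier G" and bc: "b \<in> carrier G" using A_carrier y_mem b(1) by auto
    have bp: "(b [^] (p ^ (l + s))) [^] m \<in> pw (p ^ (l + s))" by (rule pw_pow_mem[OF pw_I[OF b(1)]])
    have "a [^] m = (y [^] i) [^] m \<otimes> (b [^] (p ^ (l + s))) [^] m"
      unfolding b(2) by (rule A_pow_mult[OF A_pow[OF y_mem] A_pow[OF b(1)]])
    then have "y [^] (i * m) = a [^] m \<otimes> inv ((b [^] (p ^ (l + s))) [^] m)"
      using yc bc by (simp add: nat_pow_pow m_assoc)
    moreover have "a [^] m \<in> pw (p ^ (l + s))" using a(2) infinite_index_prime_pw(2)[OF BG B(2) 1] by blast
    ultimately have "y [^] (i * m) \<in> pw (p ^ (l + s))" using pw_mult pw_inv[OF bp] by simp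
    then have "p ^ (l + s) dvd i * m" using infinite_index_prime_pw(3)[OF BG B(2) 1] by blast
    then have "p ^ s * p ^ l dvd p ^ s * (i * u)"
      using u(1) s_def by (metis power_add mult.commute mult.left_commute)
    then have "p ^ l dvd i * u" using p by (simp add: prime_gt_0_nat)
    moreover have "coprime (p ^ l) u"
      using u(2) p by (simp add: prime_imp_coprime)
    ultimately have "p ^ l dvd i" by (simp add: coprime_dvd_mult_left_iff)
    then have "y [^] i \<in> pw (p ^ l)" using infinite_index_prime_pw(3)[OF BG B(2) 1] by blast
    moreover have "b [^] (p ^ (l + s)) \<in> pw (p ^ l)"
      using pw_dvd_subset[OF le_imp_power_dvd[of l "l + s" p]] pw_I[OF b(1)] by auto
    ultimately show ?thesis using b(2) pw_mult right by blast
  next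
    case 2
    then show ?thesis using irrelevant_prime_pw[OF 2, of l] aA right by blast
  next
    case 3
    then obtain j where j: "p ^ Suc j dvd n" "B <#> pw (p ^ Suc j) = B <#> pw (p ^ j)"
      using n p unfolding stabilising_def by blast
    have aj: "a \<in> pw (p ^ Suc j)" using a(1) pw_dvd_subset[OF j(1)] by blast
    show ?thesis
    proof (cases "l \<le> Suc j")
      case True
      then show ?thesis using aj pw_dvd_subset[OF le_imp_power_dvd[OF True]] right by blast
    next
      case False
      then have "B <#> pw (p ^ l) = B <#> pw (p ^ Suc j)"
        using set_mult_pw_stabilises[OF BG B(2) j(2), of l] j(2) by simp
      then show ?thesis using aj right by blast
    qed
  qed
qed

text \<open>If \<open>K' (pw n) = K (pw n)\<close> then \<open>B' = K' \<inter> A\<close> has the same chain as \<open>B = K \<inter> A\<close> at every prime where the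
  chain of \<open>B\<close> stabilises, so the rank of \<open>K'\<close> is at most that of \<open>K\<close>. If the ranks are equal then the
  chains agree at all primes and \<open>B' = B\<close>. Elements of \<open>K\<close> and \<open>K'\<close> that agree modulo \<open>pw n\<close>
  then differ by a torsion element of \<open>A / B\<close> that comes from \<open>pw n\<close>, and so is trivial.\<close>

lemma corank_isolating:
  assumes K: "K \<in> closed_subgroups G T"
  shows "\<exists>N\<in>open_normal_subgroups G T. \<forall>K'\<in>subgroup_nbhd G T K N. K' \<noteq> K \<longrightarrow> corank K' < corank K"
proof -
  define B where "B = K \<inter> A"
  have B: "B \<in> closed_subgroups G T" "B \<subseteq> A" "subgroup B G"
    unfolding B_def using Int_A_closed_subgroup[OF K] closed_subgroups_subgroup by auto
  obtain n where n: "stabilising B n" using stabilising_exists by blast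
  then have n0: "n > 0" unfolding stabilising_def by blast
  obtain m :: nat where m: "m > 0" "\<forall>g\<in>carrier G. g [^] m \<in> pw n"
    using open_normal_pow_mem[OF pw_open_normal[OF n0]] .
  show ?thesis
  proof (rule bexI[OF _ pw_open_normal[OF n0]], intro ballI impI)
    fix K' assume nb: "K' \<in> subgroup_nbhd G T K (pw n)" and ne: "K' \<noteq> K"
    then have K': "K' \<in> closed_subgroups G T" and eq: "K' <#> pw n = K <#> pw n"
      unfolding subgroup_nbhd_def by auto
    define B' where "B' = K' \<inter> A"
    have B': "B' \<in> closed_subgroups G T" "B' \<subseteq> A" "subgroup B' G"
      unfolding B'_def using Int_A_closed_subgroup[OF K'] closed_subgroups_subgroup by auto
    have BB: "B' <#> pw n = B <#> pw n"
      unfolding B_def B'_def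
      using set_mult_Int_modular[OF closed_subgroups_subgroup[OF K] pw_subset]
        set_mult_Int_modular[OF closed_subgroups_subgroup[OF K'] pw_subset] eq by metis
    have BBd: "B' <#> pw d = B <#> pw d" if "d dvd n" for d
      using set_mult_pw_absorb[OF subgroup.subset[OF B(3)] that] set_mult_pw_absorb[OF subgroup.subset[OF B'(3)] that] BB
      by metis
    have other: "p \<notin> infinite_index_primes B' \<and> (\<forall>l. B' <#> pw (p ^ l) = B <#> pw (p ^ l))"
      if p: "prime p" "p \<notin> infinite_index_primes B" for p
    proof (cases "pw p = A")
      case True
      have "A \<subseteq> X <#> pw (p ^ l)" if "subgroup X G" for X l
        using subset_set_mult_right[of A X] subgroup.one_closed[OF that] subgroup.subset[OF A_subgroup] irrelevant_prime_pw[OF True]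
        by simp
      then have XA: "X <#> pw (p ^ l) = A" if "subgroup X G" "X \<subseteq> A" for X l
        using that set_mult_pw_subset by blast
      then show ?thesis using B(2,3) B'(2,3) p(1) XA[OF B'(3,2)] unfolding infinite_index_primes_def by blast
    next
      case False
      then obtain j where j: "p ^ Suc j dvd n" "B <#> pw (p ^ Suc j) = B <#> pw (p ^ j)"
        using n p unfolding stabilising_def by blast
      have "p ^ j dvd n" using j(1) le_imp_power_dvd[of j "Suc j" p] dvd_trans by fastforce
      then have j': "B' <#> pw (p ^ Suc j) = B' <#> pw (p ^ j)" using BBd[OF j(1)] BBd j(2) by simp
      have "B' <#> pw (p ^ l) = B <#> pw (p ^ l)" for l
      proof (cases "l \<le> j")
        case True
        then have "p ^ l dvd n" using \<open>p ^ j dvd n\<close> le_imp_power_dvd[of l j p] dvd_trans by blast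
        then show ?thesis by (rule BBd)
      next
        case False
        then show ?thesis
          using set_mult_pw_stabilises[OF B(3,2) j(2), of l] set_mult_pw_stabilises[OF B'(3,2) j', of l]
            BBd[OF \<open>p ^ j dvd n\<close>] by simp
      qed
      then show ?thesis using j' unfolding infinite_index_primes_def by blast
    qed
    have sub: "infinite_index_primes B' \<subseteq> infinite_index_primes B"
      using other unfolding infinite_index_primes_def by blast
    have "infinite_index_primes B' \<noteq> infinite_index_primes B"
    proof
      assume same: "infinite_index_primes B' = infinite_index_primes B"
      have loc: "B' <#> pw (p ^ l) = B <#> pw (p ^ l)" if p: "prime p" for p l
        using infinite_index_prime_pw(1)[OF B(3,2)] infinite_index_prime_pw(1)[OF B'(3,2)] other[OF p] same by metis
      have incl: "X \<subseteq> Y" if X: "subgroup X G" "X \<subseteq> A" and Y: "Y \<in> closed_subgroups G T" "Y \<subseteq> A"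
        and XY: "\<And>p l. prime p \<Longrightarrow> X <#> pw (p ^ l) = Y <#> pw (p ^ l)" for X Y
      proof
        fix x assume x: "x \<in> X"
        show "x \<in> Y"
        proof (rule mem_closed_subgroup_if_locally[OF Y])
          show "x \<in> A" using x X(2) by blast
          show "x \<in> Y <#> pw (p ^ l)" if "prime p" for p l
            using subset_set_mult_left[OF subgroup.subset[OF X(1)] pw_one[of "p ^ l"]] x XY[OF that] by blast
        qed
      qed
      have B_eq: "B' = B"
        using incl[OF B'(3,2) B(1,2)] incl[OF B(3,2) B'(1,2)] loc by (metis subset_antisym)
      \<comment> \<open>An element of one group differs from an element of the other by some \<open>a\<close> in \<open>pw n\<close> with \<open>a^m\<close> in \<open>B\<close>.\<close>
      have incl': "X \<subseteq> Y" if X: "subgroup X G" "X \<inter> A = B" and Y: "subgroup Y G" "Y \<inter> A = B"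
        and XY: "X <#> pw n = Y <#> pw n" for X Y
      proof
        fix k assume k: "k \<in> X"
        have kc: "k \<in> carrier G" using subgroup.mem_carrier[OF X(1) k] .
        have "k \<in> Y <#> pw n"
          using subset_set_mult_left[OF subgroup.subset[OF X(1)] pw_one[of n]] k XY by blast
        then obtain k' a where k': "k' \<in> Y" "a \<in> pw n" "k = k' \<otimes> a" unfolding set_mult_def by blast
        have kc': "k' \<in> carrier G" using subgroup.mem_carrier[OF Y(1) k'(1)] .
        have aA: "a \<in> A" using k'(2) pw_subset by blast
        have "k [^] m \<in> B" "k' [^] m \<in> B"
          using m(2) kc kc' pw_subset nat_pow_mem_subgroup[OF X(1) k] nat_pow_mem_subgroup[OF Y(1) k'(1)] X(2) Y(2) by blast+
        moreover have "k [^] m = k' [^] m \<otimes> a [^] m"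
          unfolding k'(3) by (rule pow_mult_distrib[OF A_central[OF aA kc', symmetric] kc' A_carrier[OF aA]])
        then have "a [^] m = inv (k' [^] m) \<otimes> k [^] m" using kc' A_carrier[OF aA] by (simp add: m_assoc[symmetric])
        ultimately have "a [^] m \<in> B"
          using subgroup.m_closed[OF B(3) subgroup.m_inv_closed[OF B(3)]] by simp
        then have "a \<in> Y" using mem_if_pow_mem[OF B(1,2) n m(1) k'(2)] Y(2) by blast
        then show "k \<in> Y" using subgroup.m_closed[OF Y(1) k'(1)] k'(3) by simp
      qed
      have "K' = K"
        using incl'[of K' K] incl'[of K K'] closed_subgroups_subgroup[OF K] closed_subgroups_subgroup[OF K'] B_eq eq
        unfolding B_def B'_def by (metis subset_antisym)
      then show False using ne by blast
    qed
    then have "infinite_index_primes B' \<subset> infinite_index_primes B" using sub by blast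
    then show "corank K' < corank K"
      unfolding corank_def B_def[symmetric] B'_def[symmetric]
      using psubset_card_mono[OF finite_infinite_index_primes[OF B(3,2)]] by blast
  qed
qed

lemma set_mult_closed_subgroup:
  assumes K: "K \<in> closed_subgroups G T" and E: "E \<in> closed_subgroups G T" "E \<subseteq> A"
  shows "K <#> E \<in> closed_subgroups G T"
proof -
  have "subgroup (K <#> E) G"
    by (rule set_mult_normal_subgroup[OF closed_subgroups_subgroup[OF K] central_normal[OF closed_subgroups_subgroup[OF E(1)] E(2)]])
  moreover have eq: "(\<lambda>(x, y). x \<otimes> y) ` (K \<times> E) = K <#> E" unfolding set_mult_def by force
  have "compactin (prod_topology T T) (K \<times> E)"
    using compactin_closed closed_subgroups_closedin K E(1) by (simp add: compactin_Times)
  from image_compactin[OF this continuous_mult] have "compactin T (K <#> E)"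
    unfolding eq .
  then have "closedin T (K <#> E)" by (rule compactin_imp_closedin[OF Hausdorff])
  ultimately show ?thesis unfolding closed_subgroups_def by blast
qed

text \<open>The intersection \<open>E\<close> of all \<open>pw (p ^ j * u)\<close> with \<open>u\<close> prime to \<open>p\<close> is an open subgroup of the \<open>p\<close>-part of \<open>A\<close>,
  and lies in \<open>N\<close> if \<open>j\<close> is large. Replacing \<open>K\<close> by \<open>K E\<close> makes the \<open>p\<close>-part of the index finite and
  does not affect the other primes.\<close>

lemma corank_accumulation:
  assumes K: "K \<in> closed_subgroups G T" and pos: "corank K > 0" and N: "N \<in> open_normal_subgroups G T"
  shows "\<exists>K'\<in>subgroup_nbhd G T K N. Suc (corank K') = corank K"
proof -
  define B where "B = K \<inter> A"
  have KG: "subgroup K G" using closed_subgroups_subgroup[OF K] .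
  have B: "B \<in> closed_subgroups G T" "B \<subseteq> A" "subgroup B G"
    unfolding B_def using Int_A_closed_subgroup[OF K] closed_subgroups_subgroup by auto
  have "infinite_index_primes B \<noteq> {}" using pos unfolding corank_def B_def by force
  then obtain p where p: "p \<in> infinite_index_primes B" by blast
  then have pp: "prime p" unfolding infinite_index_primes_def by blast
  have NA: "subgroup (N \<inter> A) G" "openin T (N \<inter> A)"
    using subgroups_Inter_pair[OF open_normal_subgroup[OF N] A_subgroup] open_normal_openin[OF N] A_open by auto
  obtain n where n: "n > 0" "N \<inter> A = pw n" using open_subgroup_eq_pw[OF NA Int_lower2] by metis
  define j where "j = multiplicity p n"
  obtain u0 where u0: "n = p ^ j * u0" "\<not> p dvd u0"
    unfolding j_def using multiplicity_decompose'[of n p] n(1) pp by (metis not_prime_unit not_gr0)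
  define U where "U = {p ^ j * u | u. u > 0 \<and> coprime u p}"
  have u0U: "n \<in> U"
    unfolding U_def using u0 n(1) pp by (auto simp: coprime_commute prime_imp_coprime intro!: exI[of _ u0])
  define E where "E = \<Inter>(pw ` U)"
  have E: "E \<in> closed_subgroups G T"
    unfolding E_def by (rule closed_subgroups_Inter) (use u0U pw_subgroup pw_closedin in \<open>auto simp: closed_subgroups_def\<close>)
  have EN: "E \<subseteq> N" and EA: "E \<subseteq> A" using u0U n(2) unfolding E_def by blast+
  have EG: "subgroup E G" using closed_subgroups_subgroup[OF E] .
  define K' where "K' = K <#> E"
  have K': "K' \<in> closed_subgroups G T" unfolding K'_def by (rule set_mult_closed_subgroup[OF K E EA])
  have "K' <#> N = K <#> (E <#> N)"
    unfolding K'_def by (rule set_mult_assoc) (use KG EG open_normal_subgroup[OF N] subgroup.subset in blast)+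
  also have "E <#> N = N" by (rule set_mult_absorb[OF open_normal_subgroup[OF N] subgroup.one_closed[OF EG] EN])
  finally have nb: "K' \<in> subgroup_nbhd G T K N" using K' unfolding subgroup_nbhd_def by simp
  define B' where "B' = B <#> E"
  have B'_eq: "K' \<inter> A = B'" unfolding K'_def B'_def B_def by (rule set_mult_Int_modular[OF KG EA])
  have B': "subgroup B' G" "B' \<subseteq> A"
    using Int_A_closed_subgroup[OF K'] closed_subgroups_subgroup B'_eq by auto
  have q: "B' <#> pw (q ^ l) = B <#> pw (q ^ l)" if "prime q" "q \<noteq> p" for q l
  proof -
    have "coprime (q ^ l) p" using that pp by (simp add: primes_coprime)
    then have "p ^ j * q ^ l \<in> U" unfolding U_def using that(1) by (auto simp: prime_gt_0_nat)
    then have "E \<subseteq> pw (q ^ l)" using pw_dvd_subset[of "q ^ l" "p ^ j * q ^ l"] unfolding E_def by auto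
    then have "E <#> pw (q ^ l) = pw (q ^ l)" by (rule set_mult_absorb[OF pw_subgroup subgroup.one_closed[OF EG]])
    moreover have "B' <#> pw (q ^ l) = B <#> (E <#> pw (q ^ l))"
      unfolding B'_def by (rule set_mult_assoc) (use B(3) EG pw_subgroup subgroup.subset in blast)+
    ultimately show ?thesis by simp
  qed
  have "pw (p ^ j) \<subseteq> B' <#> pw (p ^ Suc j)"
  proof
    fix x assume "x \<in> pw (p ^ j)"
    then obtain a where a: "a \<in> A" "x = a [^] (p ^ j)" unfolding pw_def by blast
    have xA: "x \<in> A" unfolding a(2) by (rule A_pow[OF a(1)])
    obtain c where c: "c \<in> pw (p ^ Suc j)" "\<forall>u\<in>U. x \<otimes> c \<in> pw u"
    proof (rule pw_Inter_translate[OF xA])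
      show "U \<noteq> {}" using u0U by blast
      show "\<exists>w\<in>U. u dvd w \<and> v dvd w" if uv: "u \<in> U" "v \<in> U" for u v
      proof -
        obtain r s where rs: "u = p ^ j * r" "v = p ^ j * s" "r > 0" "s > 0" "coprime r p" "coprime s p"
          using uv unfolding U_def by blast
        then have "p ^ j * (r * s) \<in> U" unfolding U_def by auto
        then show ?thesis using rs by (intro bexI[of _ "p ^ j * (r * s)"]) auto
      qed
      fix u assume u: "u \<in> U"
      then obtain r where r: "u = p ^ j * r" "r > 0" "coprime r p" unfolding U_def by blast
      have "gcd u (p ^ Suc j) = p ^ j * gcd r p"
        unfolding r(1) power_Suc2 by (rule gcd_mult_distrib_nat[symmetric])
      then have "gcd u (p ^ Suc j) dvd p ^ j" using r(3) by simp
      moreover have "u > 0" using r pp by (simp add: prime_gt_0_nat)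
      ultimately show "\<exists>c\<in>pw (p ^ Suc j). x \<otimes> c \<in> pw u"
        unfolding a(2) using pw_gcd[OF a(1)] by blast
    qed
    have xc: "x \<otimes> c \<in> E" using c(2) unfolding E_def by blast
    then have "x \<otimes> c \<in> B'"
      using subset_set_mult_right[OF subgroup.subset[OF EG] subgroup.one_closed[OF B(3)]] unfolding B'_def by blast
    moreover have "x = (x \<otimes> c) \<otimes> inv c"
      using A_carrier[OF xA] subgroup.mem_carrier[OF pw_subgroup c(1)] by (simp add: m_assoc)
    ultimately show "x \<in> B' <#> pw (p ^ Suc j)"
      using pw_inv[OF c(1)] unfolding set_mult_def by blast
  qed
  then have "B' <#> pw (p ^ j) \<subseteq> B' <#> (B' <#> pw (p ^ Suc j))" by (rule mono_set_mult[OF subset_refl])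
  also have "\<dots> = (B' <#> B') <#> pw (p ^ Suc j)"
    by (rule set_mult_assoc[symmetric]) (use B'(1) pw_subgroup subgroup.subset in blast)+
  also have "B' <#> B' = B'" by (rule set_mult_absorb[OF B'(1) subgroup.one_closed[OF B'(1)] subset_refl])
  finally have "B' <#> pw (p ^ Suc j) = B' <#> pw (p ^ j)"
    using set_mult_pw_antimono[OF le_imp_power_dvd[of j "Suc j" p], of B'] by (simp add: subset_antisym)
  then have "p \<notin> infinite_index_primes B'" unfolding infinite_index_primes_def by blast
  moreover have iff: "q' \<in> infinite_index_primes B' \<longleftrightarrow> q' \<in> infinite_index_primes B" if "q' \<noteq> p" for q'
  proof (cases "prime q'")
    case True
    then show ?thesis unfolding infinite_index_primes_def mem_Collect_eq q[OF True that] by simp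
  qed (simp add: infinite_index_primes_def)
  ultimately have "infinite_index_primes B' = infinite_index_primes B - {p}"
  proof (intro Set.set_eqI)
    fix r assume p': "p \<notin> infinite_index_primes B'"
    show "r \<in> infinite_index_primes B' \<longleftrightarrow> r \<in> infinite_index_primes B - {p}"
      using p' iff[of r] by (cases "r = p") simp_all
  qed
  then have "corank K = Suc (corank K')"
    unfolding corank_def B'_eq B_def[symmetric]
    using card_Suc_Diff1[OF finite_infinite_index_primes[OF B(3,2)] p] by simp
  then show ?thesis using nb by metis
qed

theorem ranked_space_subgroup_space: "ranked_space (subgroup_space G T) corank"
  unfolding ranked_space_def topspace_subgroup_space
proof (intro conjI ballI allI impI)
  show "compact_space (subgroup_space G T)" by (rule compact_space_subgroup_space)
  show "countable (closed_subgroups G T)" by (rule countable_closed_subgroups)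
next
  fix H K assume HK: "H \<in> closed_subgroups G T" "K \<in> closed_subgroups G T" "H \<noteq> K"
  then obtain N where N: "N \<in> open_normal_subgroups G T" "H <#> N \<noteq> K <#> N"
    using closed_subgroup_eqI[OF HK(1,2)] by metis
  then have "K \<notin> subgroup_nbhd G T H N" unfolding subgroup_nbhd_def by auto
  then show "\<exists>V. openin (subgroup_space G T) V \<and> closedin (subgroup_space G T) V \<and> H \<in> V \<and> K \<notin> V"
    using clopen_subgroup_nbhd[OF HK(1) N(1)] self_subgroup_nbhd[OF HK(1)] by blast
next
  fix K assume K: "K \<in> closed_subgroups G T"
  then obtain N where N: "N \<in> open_normal_subgroups G T" "\<forall>K'\<in>subgroup_nbhd G T K N. K' \<noteq> K \<longrightarrow> corank K' < corank K"
    using corank_isolating[OF K] by meson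
  show "\<exists>U. openin (subgroup_space G T) U \<and> K \<in> U \<and> (\<forall>K'\<in>U. K' \<noteq> K \<longrightarrow> corank K' < corank K)"
    by (rule exI[of _ "subgroup_nbhd G T K N"])
      (intro conjI clopen_subgroup_nbhd(1)[OF K N(1)] self_subgroup_nbhd[OF K] N(2))
next
  fix K U assume U: "openin (subgroup_space G T) U" "K \<in> U" and pos: "0 < corank K"
  then obtain N where N: "N \<in> open_normal_subgroups G T" "subgroup_nbhd G T K N \<subseteq> U"
    unfolding openin_subgroup_space_iff by meson
  have "K \<in> closed_subgroups G T" using openin_subset[OF U(1)] U(2) topspace_subgroup_space by auto
  then show "\<exists>K'\<in>U. Suc (corank K') = corank K" using corank_accumulation[OF _ pos N(1)] N(2) by blast
qed

lemma trivial_subgroup: "{\<one>} \<in> closed_subgroups G T"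
  using closedin_Hausdorff_singleton[OF Hausdorff] topspace_eq triv_subgroup unfolding closed_subgroups_def by auto

lemma corank_le: 
  assumes K: "K \<in> closed_subgroups G T"
  shows "corank K \<le> corank {\<one>}"
proof -
  have 1: "{\<one>} \<inter> A = {\<one>}" using subgroup.one_closed[OF A_subgroup] by blast
  have B: "subgroup (K \<inter> A) G" "K \<inter> A \<subseteq> A"
    using closed_subgroups_subgroup[OF Int_A_closed_subgroup[OF K]] by auto
  have triv: "subgroup {\<one>} G" "{\<one>} \<subseteq> A" using triv_subgroup subgroup.one_closed[OF A_subgroup] by auto
  have one: "{\<one>} <#> pw n = pw n" for n by (rule set_mult_absorb[OF pw_subgroup]) (use pw_one in auto)
  have "infinite_index_primes (K \<inter> A) \<subseteq> infinite_index_primes {\<one>}"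
  proof
    fix p assume p: "p \<in> infinite_index_primes (K \<inter> A)"
    have "pw (p ^ Suc j) \<noteq> pw (p ^ j)" for j
    proof
      assume "pw (p ^ Suc j) = pw (p ^ j)"
      then have "K \<inter> A <#> pw (p ^ Suc j) = K \<inter> A <#> pw (p ^ j)" by (rule arg_cong)
      then show False using p unfolding infinite_index_primes_def by blast
    qed
    then show "p \<in> infinite_index_primes {\<one>}" using p unfolding infinite_index_primes_def one by simp
  qed
  then show ?thesis
    unfolding corank_def 1 by (rule card_mono[OF finite_infinite_index_primes[OF triv]])
qed

end

section \<open>Primes of infinite order\<close>

context profinite_group begin

lemma card_rcosets_open_pos:
  assumes "subgroup H G" "openin T H"
  shows "card (rcosets H) > 0"
  using finite_rcosets_open[OF assms] subgroup.subgroup_in_rcosets[OF assms(1) is_group] by (auto simp: card_gt_0_iff)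

text \<open>The exponent of \<open>p\<close> in the order of \<open>G\<close> is a supremum of natural numbers, so it is infinite if and only if
  these are unbounded.\<close>

lemma infinite_order_primes_iff:
  "p \<in> infinite_order_primes G T \<longleftrightarrow>
     prime p \<and> (\<forall>m. \<exists>N\<in>open_normal_subgroups G T. p ^ m dvd card (rcosets N))"
proof (cases "prime p")
  case p: True
  define f where "f N = multiplicity p (card (rcosets N))" for N
  have ord: "profinite_order G T p = (SUP N\<in>open_normal_subgroups G T. enat (f N))"
    unfolding profinite_order_def supernatural_of_nat_def f_def using p by (simp add: image_comp SUP_apply)
  have le: "supernatural_of_nat (p ^ m) \<le> profinite_order G T \<longleftrightarrow> enat m \<le> profinite_order G T p" for m
  proof
    assume "supernatural_of_nat (p ^ m) \<le> profinite_order G T"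
    then have "supernatural_of_nat (p ^ m) p \<le> profinite_order G T p" by (rule le_funD)
    then show "enat m \<le> profinite_order G T p"
      using p unfolding supernatural_of_nat_def by simp
  next
    assume m: "enat m \<le> profinite_order G T p"
    show "supernatural_of_nat (p ^ m) \<le> profinite_order G T"
    proof (rule le_funI)
      fix q
      show "supernatural_of_nat (p ^ m) q \<le> profinite_order G T q"
      proof (cases "q = p")
        case True
        then show ?thesis using m p unfolding supernatural_of_nat_def by simp
      next
        case False
        then have "supernatural_of_nat (p ^ m) q = 0"
          using p unfolding supernatural_of_nat_def
          by (auto simp: prime_multiplicity_other zero_enat_def multiplicity_distinct_prime_power)
        then show ?thesis by simp
      qed
    qed
  qed
  have "(\<forall>m. enat m \<le> profinite_order G T p) \<longleftrightarrow> (\<forall>m. \<exists>N\<in>open_normal_subgroups G T. m \<le> f N)"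
  proof (intro iffI allI)
    fix m assume "\<forall>m. enat m \<le> profinite_order G T p"
    then have "enat (Suc m) \<le> profinite_order G T p" by blast
    moreover have "enat m < enat (Suc m)" by simp
    ultimately have "enat m < (SUP N\<in>open_normal_subgroups G T. enat (f N))" unfolding ord by (rule less_le_trans[rotated])
    then obtain N where "N \<in> open_normal_subgroups G T" "enat m < enat (f N)" unfolding less_SUP_iff by blast
    then show "\<exists>N\<in>open_normal_subgroups G T. m \<le> f N" by (intro bexI[of _ N]) auto
  next
    fix m assume "\<forall>m. \<exists>N\<in>open_normal_subgroups G T. m \<le> f N"
    then obtain N where N: "N \<in> open_normal_subgroups G T" "m \<le> f N" by blast
    have "enat m \<le> enat (f N)" using N(2) by simp
    also have "\<dots> \<le> profinite_order G T p" unfolding ord by (rule SUP_upper[OF N(1)])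
    finally show "enat m \<le> profinite_order G T p" .
  qed
  moreover have "m \<le> f N \<longleftrightarrow> p ^ m dvd card (rcosets N)" if "N \<in> open_normal_subgroups G T" for m N
    unfolding f_def
    using card_rcosets_open_pos[OF open_normal_subgroup[OF that] open_normal_openin[OF that]] p
    by (subst power_dvd_iff_le_multiplicity) (auto simp: not_prime_unit)
  ultimately have "(\<forall>m. enat m \<le> profinite_order G T p) \<longleftrightarrow>
      (\<forall>m. \<exists>N\<in>open_normal_subgroups G T. p ^ m dvd card (rcosets N))" by simp
  then show ?thesis unfolding infinite_order_primes_def using p le by simp
qed (simp add: infinite_order_primes_def)

end

context central_procyclic_subgroup begin

text \<open>The powers \<open>y ^ i\<close> with \<open>i < n\<close> represent the cosets of \<open>pw n\<close> in \<open>A\<close>.\<close>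

lemma card_rcosets_pw:
  assumes n: "n > 0" and iff: "\<forall>i::nat. y [^] i \<in> pw n \<longleftrightarrow> n dvd i"
  shows "card (rcosets (pw n)) = card (rcosets A) * n"
proof -
  have yc: "y [^] i \<in> carrier G" for i :: nat using A_carrier[OF A_pow[OF y_mem]] .
  have Pc: "pw n \<subseteq> carrier G" by (rule subgroup.subset[OF pw_subgroup])
  have inj: "i = j" if ij: "i \<le> j" "j < n" and eq: "pw n #> y [^] i = pw n #> y [^] j" for i j :: nat
  proof -
    have "y [^] j \<in> pw n #> y [^] i" using rcos_self[OF yc pw_subgroup] eq by simp
    then obtain b where b: "b \<in> pw n" "y [^] j = b \<otimes> y [^] i" unfolding r_coset_def by blast
    have bc: "b \<in> carrier G" using b(1) Pc by blast
    have "y [^] j = y [^] (j - i) \<otimes> y [^] i" using ij(1) A_carrier[OF y_mem] by (simp add: nat_pow_mult)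
    then have "y [^] (j - i) = b" using b(2) bc yc by (metis right_cancel)
    then have "n dvd j - i" using b(1) iff by metis
    then show ?thesis using ij by (auto dest: dvd_imp_le)
  qed
  have "inj_on (\<lambda>i. pw n #> y [^] i) {..<n}"
    by (rule inj_onI) (metis inj lessThan_iff nat_le_linear)
  moreover have "(\<lambda>i::nat. pw n #> y [^] i) ` {..<n} = (\<lambda>a. pw n #> a) ` A"
  proof (intro equalityI subsetI)
    fix C assume "C \<in> (\<lambda>i::nat. pw n #> y [^] i) ` {..<n}"
    then show "C \<in> (\<lambda>a. pw n #> a) ` A" using A_pow[OF y_mem] by blast
  next
    fix C assume "C \<in> (\<lambda>a. pw n #> a) ` A"
    then obtain a where a: "a \<in> A" "C = pw n #> a" by blast
    obtain i :: nat and b where b: "i < n" "b \<in> pw n" "a = y [^] i \<otimes> b" using pw_decomposition[OF n a(1)] .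
    have "a = b \<otimes> y [^] i" using b(2,3) A_commute pw_subset A_pow[OF y_mem] by blast
    then have "C = (pw n #> b) #> y [^] i" using a(2) b(2) Pc coset_mult_assoc[OF Pc _ yc] by auto
    also have "pw n #> b = pw n" by (rule coset_join2[OF _ pw_subgroup b(2)]) (use b(2) Pc in blast)
    finally show "C \<in> (\<lambda>i::nat. pw n #> y [^] i) ` {..<n}" using b(1) by blast
  qed
  ultimately have "card ((\<lambda>a. pw n #> a) ` A) = n" by (metis card_image card_lessThan)
  then show ?thesis using index_eq_index_times[OF pw_subgroup A_subgroup pw_subset, of n] by simp
qed

lemma trivial_set_mult_pw: "{\<one>} <#> pw n = pw n"
  by (rule set_mult_absorb[OF pw_subgroup]) (use pw_one in auto)

text \<open>If the powers \<open>pw (p ^ j)\<close> decrease strictly then their indices are divisible by arbitrary powers of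
  \<open>p\<close>. If they become constant at \<open>j\<close> then every open \<open>pw n\<close> has index not divisible by
  \<open>p ^ (j + 1)\<close> in \<open>A\<close>, so the powers of \<open>p\<close> dividing the index of an open normal subgroup are bounded.\<close>

theorem infinite_order_primes_eq: "infinite_order_primes G T = infinite_index_primes {\<one>}"
proof (rule Set.set_eqI)
  fix p
  have triv: "subgroup {\<one>} G" "{\<one>} \<subseteq> A" using triv_subgroup subgroup.one_closed[OF A_subgroup] by auto
  show "p \<in> infinite_order_primes G T \<longleftrightarrow> p \<in> infinite_index_primes {\<one>}"
  proof
    assume p: "p \<in> infinite_index_primes {\<one>}"
    then have pp: "prime p" unfolding infinite_index_primes_def by blast
    have "\<exists>N\<in>open_normal_subgroups G T. p ^ m dvd card (rcosets N)" for m
    proof (rule bexI)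
      have "p ^ m > 0" using pp by (simp add: prime_gt_0_nat)
      then show "pw (p ^ m) \<in> open_normal_subgroups G T" by (rule pw_open_normal)
      show "p ^ m dvd card (rcosets (pw (p ^ m)))"
        using card_rcosets_pw[OF \<open>p ^ m > 0\<close>] infinite_index_prime_pw(3)[OF triv p] by simp
    qed
    then show "p \<in> infinite_order_primes G T" using pp infinite_order_primes_iff by blast
  next
    assume p: "p \<in> infinite_order_primes G T"
    then have pp: "prime p" unfolding infinite_order_primes_iff by blast
    show "p \<in> infinite_index_primes {\<one>}"
    proof (rule ccontr)
      assume "p \<notin> infinite_index_primes {\<one>}"
      then obtain j where j: "{\<one>} <#> pw (p ^ Suc j) = {\<one>} <#> pw (p ^ j)"
        using pp unfolding infinite_index_primes_def by blast
      have stab: "pw (p ^ l) = pw (p ^ j)" if "j \<le> l" for l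
        using set_mult_pw_stabilises[OF triv j that] unfolding trivial_set_mult_pw .
      define c where "c = card (rcosets A)"
      have c: "c > 0" unfolding c_def by (rule card_rcosets_open_pos[OF A_subgroup A_open])
      obtain N where N: "N \<in> open_normal_subgroups G T" "p ^ (Suc j + multiplicity p c) dvd card (rcosets N)"
        using p unfolding infinite_order_primes_iff by blast
      have NA: "subgroup (N \<inter> A) G" "openin T (N \<inter> A)"
        using subgroups_Inter_pair[OF open_normal_subgroup[OF N(1)] A_subgroup] open_normal_openin[OF N(1)] A_open by auto
      obtain n where n: "n > 0" "N \<inter> A = pw n" "\<forall>i::nat. y [^] i \<in> N \<inter> A \<longleftrightarrow> n dvd i"
        using open_subgroup_eq_pw[OF NA Int_lower2] by metis
      have "card (rcosets N) dvd card (rcosets (N \<inter> A))"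
        using index_eq_index_times[OF NA(1) open_normal_subgroup[OF N(1)]] by simp
      also have "card (rcosets (N \<inter> A)) = c * n"
        using card_rcosets_pw[OF n(1)] n(2,3) unfolding c_def by simp
      finally have "p ^ (Suc j + multiplicity p c) dvd c * n" using N(2) dvd_trans by blast
      then have "Suc j + multiplicity p c \<le> multiplicity p (c * n)"
        using c n(1) pp by (subst (asm) power_dvd_iff_le_multiplicity) (auto simp: not_prime_unit)
      also have "\<dots> = multiplicity p c + multiplicity p n"
        using c n(1) pp by (intro prime_elem_multiplicity_mult_distrib) auto
      finally have v: "Suc j \<le> multiplicity p n" by simp
      obtain u where u: "n = p ^ multiplicity p n * u" "\<not> p dvd u"
        using multiplicity_decompose'[of n p] n(1) pp by (metis not_prime_unit not_gr0)
      have "y [^] (p ^ j) \<in> pw (p ^ multiplicity p n)" using stab[of "multiplicity p n"] v pw_I[OF y_mem] by simp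
      then have "(y [^] (p ^ j)) [^] u \<in> pw (p ^ multiplicity p n * u)" by (rule pw_pow)
      then have "y [^] (p ^ j * u) \<in> pw n" using u(1) A_carrier[OF y_mem] by (simp add: nat_pow_pow)
      then have "n dvd p ^ j * u" using n(2,3) by simp
      then have "p ^ multiplicity p n * u dvd p ^ j * u" using u(1) by simp
      moreover have "u > 0" using u n(1) by (auto intro: Nat.gr0I)
      ultimately have "p ^ multiplicity p n dvd p ^ j" by simp
      then have "multiplicity p n \<le> j" using pp by (metis power_dvd_imp_le prime_gt_1_nat)
      then show False using v by simp
    qed
  qed
qed

end

section \<open>The homeomorphism type\<close>

theorem theorem4p2:
  fixes G :: "('a, 'b) monoid_scheme" and T :: "'a topology"
  assumes "profinite_group G T"
    and "infinite (closed_subgroups G T)"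
    and "countable (closed_subgroups G T)"
  shows "finite (infinite_order_primes G T) \<and>
    (\<exists>n::nat. n > 0 \<and>
       subgroup_space G T homeomorphic_space
         ord_topology (omega_power_mult_plus_one (card (infinite_order_primes G T)) n))"
proof -
  interpret countable_subgroups G T
    using assms(1,3) by (intro countable_subgroups.intro countable_subgroups_axioms.intro)
  obtain A y where "central_procyclic_subgroup G T A y" by (rule central_procyclic_subgroup_exists)
  then interpret A: central_procyclic_subgroup G T A y .
  let ?X = "subgroup_space G T"
  define k where "k = card (infinite_order_primes G T)"
  have one: "{\<one>\<^bsub>G\<^esub>} \<inter> A = {\<one>\<^bsub>G\<^esub>}" using subgroup.one_closed[OF A.A_subgroup] by blast
  then have k: "A.corank {\<one>\<^bsub>G\<^esub>} = k"
    unfolding A.corank_def k_def A.infinite_order_primes_eq by simp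
  have fin: "finite (infinite_order_primes G T)"
    unfolding A.infinite_order_primes_eq
    by (rule A.finite_infinite_index_primes) (use triv_subgroup subgroup.one_closed[OF A.A_subgroup] in auto)
  note ranked = A.ranked_space_subgroup_space
  have le: "A.corank K \<le> k" if "K \<in> topspace ?X" for K
    using A.corank_le that k unfolding topspace_subgroup_space by simp
  let ?M = "{K \<in> topspace ?X. A.corank K = k}"
  have finM: "finite ?M" by (rule ranked_space_finite_top[OF ranked le])
  \<comment> \<open>If all ranks were zero then all points would be of top rank, and there are only finitely many of those.\<close>
  have "k > 0"
  proof (rule ccontr)
    assume "\<not> k > 0"
    then have "?M = closed_subgroups G T" using le unfolding topspace_subgroup_space by auto
    then show False using finM assms(2) by simp
  qed
  define n where "n = card ?M"
  have "{\<one>\<^bsub>G\<^esub>} \<in> ?M" using A.trivial_subgroup k unfolding topspace_subgroup_space by simp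
  then have n: "n > 0" unfolding n_def using finM card_gt_0_iff by blast
  then obtain n' where n': "n = Suc n'" using gr0_implies_Suc by blast
  have "?X homeomorphic_space ord_topology (omega_power_mult_plus_one k n)"
  proof (rule homeomorphic_space_ranked[OF ranked le _ ranked_space_ordinal])
    show "card ?M = Suc n'" using n' n_def by simp
    show "trailing_zeros (ordinal_digits k n p) \<le> k" if "p \<in> topspace (ord_topology (omega_power_mult_plus_one k n))" for p
      using ordinal_rank_le that by simp
    show "card {p \<in> topspace (ord_topology (omega_power_mult_plus_one k n)). trailing_zeros (ordinal_digits k n p) = k} = Suc n'"
      using card_ordinal_top_rank[OF \<open>k > 0\<close> n] n' by simp
  qed
  then show ?thesis using fin n unfolding k_def by blast
qed

end
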